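(* Let $E$ be a locally complete lcHs over $\mathbb{C}$. a) Then $\bigl(\sum_{n\in\mathbb{Z}^{d},|n|\leq k}\mathfrak{F}^{E}_{n}e^{i\langle n,\cdot\rangle}\bigr)_{k\in\mathbb{N}}$ is a Schauder decomposition of $\mathcal{C}^{\infty}_{2\pi}(\mathbb{R}^{d},E)$ and \[ f=\sum_{n\in\mathbb{Z}^{d}}\widehat{f}(n)e^{i\langle n,\cdot\rangle},\quad f\in\mathcal{C}^{\infty}_{2\pi}(\mathbb{R}^{d},E). \] b) The map \[ \mathfrak{F}^{E}\colon\mathcal{C}^{\infty}_{2\pi}(\mathbb{R}^{d},E)\to s(\mathbb{Z}^{d},E),\;\mathfrak{F}^{E}(f):=\bigl(\widehat{f}(n)\bigr)_{n\in\mathbb{Z}^{d}}, \] is an isomorphism and $\mathfrak{F}^{E}=S_{s(\mathbb{Z}^{d})}\circ(\mathfrak{F}^{\mathbb{C}}\varepsilon\operatorname{id}_{E})\circ S^{-1}_{\mathcal{C}^{\infty}_{2\pi}(\mathbb{R}^{d})}$.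
   Context: $d\in\mathbb{N}$. An lcHs is a non-trivial locally convex Hausdorff space; the topology of $E$ is given by a directed system of seminorms $(p_\alpha)_{\alpha\in\mathfrak{A}}$. $E$ is locally complete if for every closed bounded absolutely convex $D\subset E$ the space $E_D:=\bigcup_n nD$, normed by the gauge of $D$, is a Banach space. Isomorphisms are linear and topological. $\mathcal{C}^{\infty}_{2\pi}(\mathbb{R}^{d},E)$ is the space of $f\in\mathcal{C}^{\infty}(\mathbb{R}^{d},E)$ that are $2\pi$-periodic in each variable, with the topology given by the seminorms $\sup_{x\in K,|\beta|\le m}p_\alpha((\partial^{\beta})^{E}f(x))$, $K\subset\mathbb{R}^{d}$ compact, $m\in\mathbb{N}_0$, $\alpha\in\mathfrak{A}$. $s(\mathbb{Z}^{d},E)$ is the space of $x=(x_k)\in E^{\mathbb{Z}^{d}}$ with $\sup_{k}p_\alpha(x_k)(1+|k|^{2})^{j/2}<\infty$ for all $j\in\mathbb{N}$, $\alpha\in\mathfrak{A}$, with these seminorms ($|k|$ Euclidean norm). For $E=\mathbb{C}$ write $\mathcal{C}^{\infty}_{2\pi}(\mathbb{R}^{d})$, $s(\mathbb{Z}^{d})$. $\langle\cdot,\cdot\rangle$ is the usual scalar product on $\mathbb{R}^{d}$. For $f\in\mathcal{C}^{\infty}_{2\pi}(\mathbb{R}^{d},E)$, $n\in\mathbb{Z}^{d}$: $\widehat f(n):=\mathfrak{F}^{E}_n(f):=(2\pi)^{-d}\int_{[-\pi,\pi]^{d}}f(x)e^{-i\langle n,x\rangle}\,dx\in E$ as a Pettis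 integral, i.e. the unique element with $e'(\widehat f(n))=(2\pi)^{-d}\int_{[-\pi,\pi]^{d}}e'(f(x))e^{-i\langle n,x\rangle}\,dx$ for all $e'\in E'$ (it exists since $E$ is locally complete). $\mathfrak{F}^{E}_ne^{i\langle n,\cdot\rangle}$ denotes the operator $f\mapsto\widehat f(n)e^{i\langle n,\cdot\rangle}$. For an lcHs $F$, $F'_\kappa$ is $F'$ with the topology of uniform convergence on absolutely convex compact subsets of $F$; $F\varepsilon E:=L_e(F'_\kappa,E)$ carries the topology of uniform convergence on equicontinuous subsets of $F'$; for $T\in L(F_1,F_2)$, $(T\varepsilon\operatorname{id}_E)(u):=u\circ T^{t}$. For a space $\mathcal{F}(\Omega)$ of scalar functions, $S_{\mathcal{F}(\Omega)}(u):=[x\mapsto u(\delta_x)]$, $u\in\mathcal{F}(\Omega)\varepsilon E$, with $\delta_x(f)=f(x)$; here $S_{\mathcal{C}^{\infty}_{2\pi}(\mathbb{R}^{d})}\colon\mathcal{C}^{\infty}_{2\pi}(\mathbb{R}^{d})\varepsilon E\to\mathcal{C}^{\infty}_{2\pi}(\mathbb{R}^{d},E)$ and $S_{s(\mathbb{Z}^{d})}\colon s(\mathbb{Z}^{d})\varepsilon E\to s(\mathbb{Z}^{d},E)$ are isomorphisms. A Schauder decomposition of an lcHs $X$ is a sequence $(P_k)_{k\in\mathbb{N}}$ of continuous linear projections on $X$ such that $P_kP_j=P_{\min(j,k)}$, $P_k\neq P_j$ for $k\neq j$, and $P_kx\to x$ for each $x\in X$. *)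

theory Defs
  imports "HOL-Analysis.Analysis" "HOL-Library.Function_Algebras"
begin

text \<open>Complex vector spaces. Spaces of functions carry the pointwise operations.\<close>

class complex_vector = ab_group_add +
  fixes scaleC :: "complex \<Rightarrow> 'a \<Rightarrow> 'a"  (infixr "*\<^sub>C" 75)
  assumes scaleC_add_right: "a *\<^sub>C (x + y) = a *\<^sub>C x + a *\<^sub>C y"
    and scaleC_add_left: "(a + b) *\<^sub>C x = a *\<^sub>C x + b *\<^sub>C x"
    and scaleC_scaleC: "a *\<^sub>C b *\<^sub>C x = (a * b) *\<^sub>C x"
    and scaleC_one: "1 *\<^sub>C x = x"

instantiation complex :: complex_vector
begin
definition scaleC_complex :: "complex \<Rightarrow> complex \<Rightarrow> complex" where
  "scaleC_complex a x = a * x"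
instance
  by standard (simp_all add: scaleC_complex_def algebra_simps)
end

instantiation "fun" :: (type, complex_vector) complex_vector
begin
definition scaleC_fun :: "complex \<Rightarrow> ('a \<Rightarrow> 'b) \<Rightarrow> 'a \<Rightarrow> 'b" where
  "scaleC_fun a f = (\<lambda>x. a *\<^sub>C f x)"
instance
  by standard
    (simp_all add: scaleC_fun_def fun_eq_iff scaleC_add_right scaleC_add_left scaleC_scaleC scaleC_one)
end


section \<open>Locally convex spaces\<close>

text \<open>A locally convex space is a linear subspace \<^term>\<open>points X\<close> of some complex vector space
  together with a family of seminorms. Only the values of the seminorms on \<^term>\<open>points X\<close> matter.\<close>

datatype 'a lcs = Lcs (points: "'a set") (seminorms: "('a \<Rightarrow> real) set")

definition lc_topology :: "'a::complex_vector lcs \<Rightarrow> 'a topology" where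
  "lc_topology X = topology_generated_by
     {{y \<in> points X. p (y - x) < r} | p x r. p \<in> seminorms X \<and> x \<in> points X \<and> 0 < r}"

definition lcHs :: "'a::complex_vector lcs \<Rightarrow> bool" where
  "lcHs X \<longleftrightarrow>
     0 \<in> points X \<and>
     (\<forall>x\<in>points X. \<forall>y\<in>points X. x + y \<in> points X) \<and>
     (\<forall>a. \<forall>x\<in>points X. a *\<^sub>C x \<in> points X) \<and>
     points X \<noteq> {0} \<and>
     (\<forall>p\<in>seminorms X.
        (\<forall>x\<in>points X. 0 \<le> p x) \<and>
        (\<forall>x\<in>points X. \<forall>y\<in>points X. p (x + y) \<le> p x + p y) \<and>
        (\<forall>a. \<forall>x\<in>points X. p (a *\<^sub>C x) = norm a * p x)) \<and>
     seminorms X \<noteq> {} \<and>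
     (\<forall>p\<in>seminorms X. \<forall>q\<in>seminorms X. \<exists>r\<in>seminorms X. \<exists>C>0.
        \<forall>x\<in>points X. max (p x) (q x) \<le> C * r x) \<and>
     Hausdorff_space (lc_topology X)"

definition scalar_lcs :: "complex lcs" where
  "scalar_lcs = Lcs UNIV {norm}"

definition continuous_linear ::
    "'a::complex_vector lcs \<Rightarrow> 'b::complex_vector lcs \<Rightarrow> ('a \<Rightarrow> 'b) \<Rightarrow> bool" where
  "continuous_linear X Y T \<longleftrightarrow>
     (\<forall>x\<in>points X. \<forall>y\<in>points X. T (x + y) = T x + T y) \<and>
     (\<forall>a. \<forall>x\<in>points X. T (a *\<^sub>C x) = a *\<^sub>C T x) \<and>
     continuous_map (lc_topology X) (lc_topology Y) T"

definition isomorphism ::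
    "'a::complex_vector lcs \<Rightarrow> 'b::complex_vector lcs \<Rightarrow> ('a \<Rightarrow> 'b) \<Rightarrow> bool" where
  "isomorphism X Y T \<longleftrightarrow>
     continuous_linear X Y T \<and> homeomorphic_map (lc_topology X) (lc_topology Y) T"

text \<open>Operators on \<^term>\<open>points X\<close> are represented by total functions vanishing outside
  \<^term>\<open>points X\<close>, so that equal operators are equal functions and the operators form a linear
  subspace of the function space.\<close>

definition operators ::
    "'a::complex_vector lcs \<Rightarrow> 'b::complex_vector lcs \<Rightarrow> ('a \<Rightarrow> 'b) set" where
  "operators X Y = {T. continuous_linear X Y T \<and> (\<forall>x. x \<notin> points X \<longrightarrow> T x = 0)}"

definition dual :: "'a::complex_vector lcs \<Rightarrow> ('a \<Rightarrow> complex) set" where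
  "dual X = operators X scalar_lcs"

definition absolutely_convex :: "'a::complex_vector set \<Rightarrow> bool" where
  "absolutely_convex D \<longleftrightarrow> D \<noteq> {} \<and>
     (\<forall>x\<in>D. \<forall>y\<in>D. \<forall>a b. norm a + norm b \<le> 1 \<longrightarrow> a *\<^sub>C x + b *\<^sub>C y \<in> D)"

definition lc_bounded :: "'a::complex_vector lcs \<Rightarrow> 'a set \<Rightarrow> bool" where
  "lc_bounded X D \<longleftrightarrow> D \<subseteq> points X \<and> (\<forall>p\<in>seminorms X. bdd_above (p ` D))"

definition disc_span :: "'a::complex_vector set \<Rightarrow> 'a set" where
  "disc_span D = (\<Union>n::nat. (\<lambda>x. of_nat n *\<^sub>C x) ` D)"

definition gauge_of :: "'a::complex_vector set \<Rightarrow> 'a \<Rightarrow> real" where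
  "gauge_of D x = Inf {t. 0 < t \<and> x \<in> (\<lambda>y. complex_of_real t *\<^sub>C y) ` D}"

text \<open>The gauge of a bounded absolutely convex subset of a Hausdorff space is a norm on its span,
  so being a Banach space amounts to completeness with respect to the gauge.\<close>

definition locally_complete :: "'a::complex_vector lcs \<Rightarrow> bool" where
  "locally_complete X \<longleftrightarrow>
     (\<forall>D. closedin (lc_topology X) D \<and> lc_bounded X D \<and> absolutely_convex D \<longrightarrow>
       (\<forall>u :: nat \<Rightarrow> 'a.
          (\<forall>n. u n \<in> disc_span D) \<and>
          (\<forall>e>0. \<exists>N. \<forall>m\<ge>N. \<forall>n\<ge>N. gauge_of D (u m - u n) < e) \<longrightarrow>
          (\<exists>l\<in>disc_span D. (\<lambda>n. gauge_of D (u n - l)) \<longlonglongrightarrow> 0)))"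

text \<open>The decomposition is indexed by the positive integers; the value at 0 is irrelevant.\<close>

definition schauder_decomposition ::
    "'a::complex_vector lcs \<Rightarrow> (nat \<Rightarrow> 'a \<Rightarrow> 'a) \<Rightarrow> bool" where
  "schauder_decomposition X P \<longleftrightarrow>
     (\<forall>k\<ge>1. continuous_linear X X (P k) \<and> (\<forall>x\<in>points X. P k (P k x) = P k x)) \<and>
     (\<forall>k\<ge>1. \<forall>j\<ge>1. \<forall>x\<in>points X. P k (P j x) = P (min j k) x) \<and>
     (\<forall>k\<ge>1. \<forall>j\<ge>1. k \<noteq> j \<longrightarrow> (\<exists>x\<in>points X. P k x \<noteq> P j x)) \<and>
     (\<forall>x\<in>points X. limitin (lc_topology X) (\<lambda>k. P k x) x sequentially)"


section \<open>The \<open>\<epsilon>\<close>-product\<close>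

definition dual_kappa :: "'a::complex_vector lcs \<Rightarrow> ('a \<Rightarrow> complex) lcs" where
  "dual_kappa F = Lcs (dual F)
     {(\<lambda>\<phi>. SUP x\<in>K. norm (\<phi> x)) | K. absolutely_convex K \<and> compactin (lc_topology F) K}"

definition equicontinuous_dual :: "'a::complex_vector lcs \<Rightarrow> ('a \<Rightarrow> complex) set \<Rightarrow> bool" where
  "equicontinuous_dual F M \<longleftrightarrow> M \<subseteq> dual F \<and>
     (\<forall>x\<in>points F. \<forall>e>0. \<exists>U. openin (lc_topology F) U \<and> x \<in> U \<and>
        (\<forall>\<phi>\<in>M. \<forall>y\<in>U. norm (\<phi> y - \<phi> x) < e))"

definition eps_product ::
    "'f::complex_vector lcs \<Rightarrow> 'e::complex_vector lcs \<Rightarrow> (('f \<Rightarrow> complex) \<Rightarrow> 'e) lcs" where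
  "eps_product F E = Lcs (operators (dual_kappa F) E)
     {(\<lambda>u. SUP \<phi>\<in>M. p (u \<phi>)) | M p.
        M \<noteq> {} \<and> equicontinuous_dual F M \<and> p \<in> seminorms E}"

definition transpose_op ::
    "'f::complex_vector lcs \<Rightarrow> ('f \<Rightarrow> 'g) \<Rightarrow> ('g \<Rightarrow> complex) \<Rightarrow> ('f \<Rightarrow> complex)" where
  "transpose_op F T \<phi> = (\<lambda>x. if x \<in> points F then \<phi> (T x) else 0)"

text \<open>\<^term>\<open>eps_id F G T\<close> is the map \<open>T \<epsilon> id\<close> from the \<open>\<epsilon>\<close>-product of \<^term>\<open>F\<close> to that of \<^term>\<open>G\<close>.\<close>

definition eps_id ::
    "'f::complex_vector lcs \<Rightarrow> 'g::complex_vector lcs \<Rightarrow> ('f \<Rightarrow> 'g) \<Rightarrow>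
     (('f \<Rightarrow> complex) \<Rightarrow> 'e::complex_vector) \<Rightarrow> (('g \<Rightarrow> complex) \<Rightarrow> 'e)" where
  "eps_id F G T u = (\<lambda>\<phi>. if \<phi> \<in> dual G then u (transpose_op F T \<phi>) else 0)"

definition point_eval :: "('x \<Rightarrow> complex) lcs \<Rightarrow> 'x \<Rightarrow> ('x \<Rightarrow> complex) \<Rightarrow> complex" where
  "point_eval F x = (\<lambda>f. if f \<in> points F then f x else 0)"

definition S_map :: "('x \<Rightarrow> complex) lcs \<Rightarrow> ((('x \<Rightarrow> complex) \<Rightarrow> complex) \<Rightarrow> 'e) \<Rightarrow> 'x \<Rightarrow> 'e" where
  "S_map F u = (\<lambda>x. u (point_eval F x))"


section \<open>Smooth periodic functions\<close>

definition has_partial ::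
    "'e::complex_vector lcs \<Rightarrow> 'd::finite \<Rightarrow> (real^'d \<Rightarrow> 'e) \<Rightarrow> real^'d \<Rightarrow> 'e \<Rightarrow> bool" where
  "has_partial E i f x y \<longleftrightarrow>
     limitin (lc_topology E)
       (\<lambda>h. complex_of_real (1 / h) *\<^sub>C (f (x + h *\<^sub>R axis i 1) - f x)) y (at (0::real))"

definition partial ::
    "'e::complex_vector lcs \<Rightarrow> 'd::finite \<Rightarrow> (real^'d \<Rightarrow> 'e) \<Rightarrow> real^'d \<Rightarrow> 'e" where
  "partial E i f = (\<lambda>x. THE y. has_partial E i f x y)"

primrec C_k :: "'e::complex_vector lcs \<Rightarrow> nat \<Rightarrow> (real^'d::finite \<Rightarrow> 'e) \<Rightarrow> bool" where
  "C_k E 0 f \<longleftrightarrow> continuous_map euclidean (lc_topology E) f"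
| "C_k E (Suc k) f \<longleftrightarrow>
     (\<forall>i x. \<exists>y. has_partial E i f x y) \<and> (\<forall>i. C_k E k (partial E i f))"

definition C_infinity :: "'e::complex_vector lcs \<Rightarrow> (real^'d::finite \<Rightarrow> 'e) \<Rightarrow> bool" where
  "C_infinity E f \<longleftrightarrow> (\<forall>k. C_k E k f)"

text \<open>The linear order on the index type fixes the order in which the coordinates are enumerated:
  with coordinates \<open>1, \<dots>, d\<close> the derivative \<open>\<partial>\<^sup>\<beta>\<close> is \<open>\<partial>\<^sub>1\<^sup>\<beta>\<^sup>1 (\<dots> (\<partial>\<^sub>d\<^sup>\<beta>\<^sup>d f))\<close>.\<close>

definition multi_partial ::
    "'e::complex_vector lcs \<Rightarrow> ('d::{finite,linorder} \<Rightarrow> nat) \<Rightarrow>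
     (real^'d::{finite,linorder} \<Rightarrow> 'e) \<Rightarrow> real^'d::{finite,linorder} \<Rightarrow> 'e" where
  "multi_partial E \<beta> f = foldr (\<lambda>i. partial E i ^^ \<beta> i) (sorted_list_of_set UNIV) f"

definition smooth_periodic ::
    "'e::complex_vector lcs \<Rightarrow> (real^'d::{finite,linorder} \<Rightarrow> 'e) lcs" where
  "smooth_periodic E = Lcs
     {f. C_infinity E f \<and> (\<forall>i x. f (x + axis i (2 * pi)) = f x)}
     {(\<lambda>f. SUP (x, \<beta>) \<in> K \<times> {\<beta>. (\<Sum>i\<in>UNIV. \<beta> i) \<le> m}. p (multi_partial E \<beta> f x)) | K m p.
        compact K \<and> K \<noteq> {} \<and> p \<in> seminorms E}"


section \<open>Rapidly decreasing families and Fourier coefficients\<close>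

definition real_vec :: "int^'d::finite \<Rightarrow> real^'d" where
  "real_vec n = (\<chi> i. real_of_int (n $ i))"

definition rapidly_decreasing ::
    "'e::complex_vector lcs \<Rightarrow> (int^'d::finite \<Rightarrow> 'e) lcs" where
  "rapidly_decreasing E = Lcs
     {x. (\<forall>k. x k \<in> points E) \<and>
         (\<forall>j::nat. \<forall>p\<in>seminorms E. j \<ge> 1 \<longrightarrow>
            bdd_above (range (\<lambda>k. p (x k) * (1 + (norm (real_vec k))\<^sup>2) powr (real j / 2))))}
     {(\<lambda>x. SUP k. p (x k) * (1 + (norm (real_vec k))\<^sup>2) powr (real j / 2)) | (j::nat) p.
        j \<ge> 1 \<and> p \<in> seminorms E}"

definition fourier_coeff ::
    "'e::complex_vector lcs \<Rightarrow> (real^'d::finite \<Rightarrow> 'e) \<Rightarrow> int^'d \<Rightarrow> 'e" where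
  "fourier_coeff E f n = (THE y. y \<in> points E \<and>
     (\<forall>e'\<in>dual E. e' y =
        complex_of_real (1 / (2 * pi) ^ CARD('d)) *
        (LINT x : cbox (\<chi> i. - pi) (\<chi> i. pi) | lborel.
           e' (f x) * exp (- (\<i> * complex_of_real (real_vec n \<bullet> x))))))"

definition fourier_term ::
    "'e::complex_vector lcs \<Rightarrow> int^'d::finite \<Rightarrow> (real^'d \<Rightarrow> 'e) \<Rightarrow> (real^'d \<Rightarrow> 'e)" where
  "fourier_term E n f =
     (\<lambda>x. exp (\<i> * complex_of_real (real_vec n \<bullet> x)) *\<^sub>C fourier_coeff E f n)"

end

theory Submission
  imports Defs
begin

text \<open>Synthesis \<open>a \<mapsto> \<Sum>n. e\<^sub>n a\<^sub>n\<close> maps rapidly decreasing families to smooth periodic functions, and the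
  whole theorem reduces to the fact that it is inverse to \<open>f \<mapsto> (f^(n))\<close>, with explicit seminorm
  estimates in both directions. Local completeness enters only through the convergence of sequences
  whose increments are \<open>O(2\<^sup>-\<^sup>k)\<close> in every seminorm: this gives both the sums of rapidly decreasing series
  and the Pettis integrals, the latter as limits of dyadic Riemann sums, since smooth functions are
  Lipschitz. By the Hahn-Banach theorem, estimates and identities in \<open>E\<close> follow from those for
  the scalar functions \<open>e' \<circ> f\<close>: invariance of the integral under translation gives the orthogonality
  of the characters and the rule \<open>(\<partial>\<^sub>i f)^(n) = i n\<^sub>i f^(n)\<close>, and powers of a trigonometric peak function
  show that a continuous periodic function is determined by its coefficients.

  In the factorisation through the \<open>\<epsilon>\<close>-product, the transpose of the scalar Fourier transform maps the
  evaluation at \<open>n\<close> to the functional \<open>g \<mapsto> g^(n)\<close>. In \<open>F'\<^sub>\<kappa>\<close> this is the limit of Riemann sums of point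
  evaluations, uniformly on compact sets, so every \<open>u\<close> with \<open>u(\<delta>\<^sub>x) = f(x)\<close> sends it to \<open>f^(n)\<close>.\<close>

section \<open>Locally convex spaces\<close>

text \<open>Local completeness says nothing about nets or general Cauchy sequences. Hence lattice
  series are first summed along the sets where the bracket is at most 2^k, and the Riemann sums have
  mesh 2^-k: for every seminorm the increments are then geometric with the same ratio, and only the
  constant depends on the seminorm. Differentiation in \<open>E\<close> is computed on coefficients.
  As soon as every smooth periodic function is known to be a synthesis, its sums, multiples and
  derivatives become operations on rapidly decreasing families, and even the vector space and
  seminorm axioms of the function space are obtained in this way. In the factorisation,
  \<open>inv_into\<close> chooses a preimage under S, so each \<open>f\<close> must have one:
  u(\<phi>) is the sum of the \<phi>(e_n) f^(n). Its continuity on the dual with compact convergence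
  asks, for each seminorm p, for one compact absolutely convex K such that p(u(\<phi>)) is at most a
  constant times the supremum of |\<phi>| on K. Syntheses of the families with |c_n| \<le> b_n serve
  as K, where b_n is p(f^(n)) times a bracket power.\<close>

global_interpretation complex_vector: vector_space "scaleC :: complex \<Rightarrow> 'a \<Rightarrow> 'a::complex_vector"
  by standard (simp_all add: scaleC_add_right scaleC_add_left scaleC_scaleC scaleC_one)

declare complex_vector.scale_scale [simp del]

lemmas scaleC_rules [simp] =
  complex_vector.scale_zero_left complex_vector.scale_zero_right complex_vector.scale_one
  complex_vector.scale_minus_left complex_vector.scale_minus_right

locale lc_space =
  fixes X :: "'a::complex_vector lcs"
  assumes zero_mem: "0 \<in> points X"
    and add_mem: "x \<in> points X \<Longrightarrow> y \<in> points X \<Longrightarrow> x + y \<in> points X"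
    and scale_mem: "x \<in> points X \<Longrightarrow> a *\<^sub>C x \<in> points X"
    and sn_nonneg: "p \<in> seminorms X \<Longrightarrow> x \<in> points X \<Longrightarrow> 0 \<le> p x"
    and sn_add: "p \<in> seminorms X \<Longrightarrow> x \<in> points X \<Longrightarrow> y \<in> points X \<Longrightarrow> p (x + y) \<le> p x + p y"
    and sn_scale: "p \<in> seminorms X \<Longrightarrow> x \<in> points X \<Longrightarrow> p (a *\<^sub>C x) = norm a * p x"
    and sn_ex: "seminorms X \<noteq> {}"
begin

lemma minus_mem: "x \<in> points X \<Longrightarrow> - x \<in> points X"
  using scale_mem[of x "-1"] by simp

lemma diff_mem: "x \<in> points X \<Longrightarrow> y \<in> points X \<Longrightarrow> x - y \<in> points X"
  using add_mem[of x "-y"] minus_mem by simp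

lemma sum_mem: "(\<And>i. i \<in> A \<Longrightarrow> f i \<in> points X) \<Longrightarrow> sum f A \<in> points X"
  by (induction A rule: infinite_finite_induct) (auto simp: zero_mem add_mem)

lemma sn_zero: "p \<in> seminorms X \<Longrightarrow> p 0 = 0"
  using sn_scale[of p 0 0] zero_mem by simp

lemma sn_minus: "p \<in> seminorms X \<Longrightarrow> x \<in> points X \<Longrightarrow> p (- x) = p x"
  using sn_scale[of p x "-1"] by simp

lemma sn_diff_commute:
  "p \<in> seminorms X \<Longrightarrow> x \<in> points X \<Longrightarrow> y \<in> points X \<Longrightarrow> p (x - y) = p (y - x)"
  using sn_minus[of p "x - y"] diff_mem by simp

lemma sn_diff: "p \<in> seminorms X \<Longrightarrow> x \<in> points X \<Longrightarrow> y \<in> points X \<Longrightarrow> p (x - y) \<le> p x + p y"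
  using sn_add[of p x "-y"] minus_mem[of y] sn_minus[of p y] by simp

lemma sn_triangle:
  assumes "p \<in> seminorms X" "x \<in> points X" "y \<in> points X" "z \<in> points X"
  shows "p (x - z) \<le> p (x - y) + p (y - z)"
  using sn_add[of p "x - y" "y - z"] assms diff_mem by simp

lemma sn_sum:
  assumes "p \<in> seminorms X" "\<And>i. i \<in> A \<Longrightarrow> f i \<in> points X"
  shows "p (sum f A) \<le> (\<Sum>i\<in>A. p (f i))"
  using assms(2)
proof (induction A rule: infinite_finite_induct)
  case (insert x F)
  then show ?case
    using sn_add[OF assms(1), of "f x" "sum f F"] sum_mem[of F f] by fastforce
qed (auto simp: sn_zero assms)

lemma topspace_lc [simp]: "topspace (lc_topology X) = points X"
proof -
  obtain p where "p \<in> seminorms X"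
    using sn_ex by auto
  then have "x \<in> {y \<in> points X. p (y - x) < 1}" if "x \<in> points X" for x
    using that by (simp add: sn_zero)
  then show ?thesis
    unfolding lc_topology_def topology_generated_by_topspace
    using \<open>p \<in> seminorms X\<close> zero_less_one by blast
qed

text \<open>\<open>lc_space\<close> does not ask for directedness, so a neighbourhood is described
  by finitely many seminorms with a common radius. Open sets arise from the balls by finite
  intersections and unions, hence the induction.\<close>

lemma openin_lcD:
  assumes "openin (lc_topology X) U" "x \<in> U"
  shows "\<exists>S r. finite S \<and> S \<subseteq> seminorms X \<and> 0 < r \<and>
    (\<forall>y\<in>points X. (\<forall>p\<in>S. p (y - x) < r) \<longrightarrow> y \<in> U)"
proof -
  have "generate_topology_on {{y \<in> points X. p (y - x) < r} | p x r.
      p \<in> seminorms X \<and> x \<in> points X \<and> 0 < r} U"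
    using assms(1) unfolding lc_topology_def by (rule openin_topology_generated_by)
  then show ?thesis
    using assms(2)
  proof induction
    case Empty
    then show ?case by simp
  next
    case (Int a b)
    obtain S r S' r' where "finite S" "S \<subseteq> seminorms X" "0 < r"
      "\<forall>y\<in>points X. (\<forall>p\<in>S. p (y - x) < r) \<longrightarrow> y \<in> a"
      "finite S'" "S' \<subseteq> seminorms X" "0 < r'"
      "\<forall>y\<in>points X. (\<forall>p\<in>S'. p (y - x) < r') \<longrightarrow> y \<in> b"
      using Int.IH Int.prems by (metis IntE)
    then show ?case
      by (intro exI[of _ "S \<union> S'"] exI[of _ "min r r'"]) auto
  next
    case (UN K)
    obtain k where k: "k \<in> K" "x \<in> k" using UN.prems by blast
    with UN.IH[OF k] obtain S r where "finite S" "S \<subseteq> seminorms X" "0 < r"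
      "\<forall>y\<in>points X. (\<forall>p\<in>S. p (y - x) < r) \<longrightarrow> y \<in> k"
      by blast
    with k show ?case by blast
  next
    case (Basis s)
    from Basis.hyps obtain p z r where p: "p \<in> seminorms X" "z \<in> points X" "0 < r"
      and s: "s = {y \<in> points X. p (y - z) < r}" by auto
    have x: "x \<in> points X" "p (x - z) < r"
      using Basis.prems s by auto
    have "y \<in> s" if "y \<in> points X" "p (y - x) < r - p (x - z)" for y
      using sn_triangle[OF p(1) that(1) x(1) p(2)] that s by auto
    then show ?case
      using p(1) x by (intro exI[of _ "{p}"] exI[of _ "r - p (x - z)"]) auto
  qed
qed

lemma openin_lcI:
  assumes "p \<in> seminorms X" "x \<in> points X" "0 < r"
  shows "openin (lc_topology X) {y \<in> points X. p (y - x) < r}"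
  unfolding lc_topology_def using assms by (intro topology_generated_by_Basis) blast

lemma limitin_lcI:
  assumes "l \<in> points X" "\<forall>\<^sub>F k in F. f k \<in> points X"
    "\<And>p. p \<in> seminorms X \<Longrightarrow> ((\<lambda>k. p (f k - l)) \<longlongrightarrow> 0) F"
  shows "limitin (lc_topology X) f l F"
  unfolding limitin_def
proof (intro conjI allI impI)
  show "l \<in> topspace (lc_topology X)"
    using assms by simp
  fix U assume U: "openin (lc_topology X) U \<and> l \<in> U"
  then obtain S r where S: "finite S" "S \<subseteq> seminorms X" "0 < r"
    "\<forall>y\<in>points X. (\<forall>p\<in>S. p (y - l) < r) \<longrightarrow> y \<in> U"
    using openin_lcD[of U l] by blast
  have "\<forall>\<^sub>F k in F. \<forall>p\<in>S. p (f k - l) < r"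
    using S assms(3) by (auto simp: eventually_ball_finite_distrib order_tendsto_iff)
  with assms(2) show "\<forall>\<^sub>F k in F. f k \<in> U"
    by eventually_elim (use S in auto)
qed

lemma limitin_lcD:
  assumes "limitin (lc_topology X) f l F"
  shows "l \<in> points X" "\<forall>\<^sub>F k in F. f k \<in> points X"
    "p \<in> seminorms X \<Longrightarrow> ((\<lambda>k. p (f k - l)) \<longlongrightarrow> 0) F"
proof -
  show l: "l \<in> points X"
    using assms by (simp add: limitin_def)
  show ev: "\<forall>\<^sub>F k in F. f k \<in> points X"
    using assms l unfolding limitin_def by (metis openin_topspace topspace_lc)
  assume p: "p \<in> seminorms X"
  show "((\<lambda>k. p (f k - l)) \<longlongrightarrow> 0) F"
  proof (rule order_tendstoI)
    fix a :: real assume "a < 0"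
    from ev show "\<forall>\<^sub>F k in F. a < p (f k - l)"
      by eventually_elim (use sn_nonneg[OF p] diff_mem l \<open>a < 0\<close> in force)
  next
    fix a :: real assume "0 < a"
    then have "l \<in> {y \<in> points X. p (y - l) < a}"
      using l p by (simp add: sn_zero)
    then have "\<forall>\<^sub>F k in F. f k \<in> {y \<in> points X. p (y - l) < a}"
      using assms openin_lcI[OF p l \<open>0 < a\<close>] unfolding limitin_def by blast
    then show "\<forall>\<^sub>F k in F. p (f k - l) < a"
      by eventually_elim auto
  qed
qed

text \<open>Continuity is tested on one seminorm at a time; the finitely many neighbourhoods that
  \<open>openin_lcD\<close> asks for are intersected. The source may be any topology, which later
  includes a box of coefficient families with coordinatewise convergence.\<close>

lemma continuous_map_from_bound:
  assumes T: "\<And>x. x \<in> topspace T \<Longrightarrow> f x \<in> points X"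
    and b: "\<And>p x e. p \<in> seminorms X \<Longrightarrow> x \<in> topspace T \<Longrightarrow> e > 0 \<Longrightarrow>
      \<exists>U. openin T U \<and> x \<in> U \<and> (\<forall>y\<in>U. p (f y - f x) < e)"
  shows "continuous_map T (lc_topology X) f"
  unfolding continuous_map_def
proof (intro conjI allI impI)
  show "f \<in> topspace T \<rightarrow> topspace (lc_topology X)"
    using T by simp
  fix U assume U: "openin (lc_topology X) U"
  show "openin T {x \<in> topspace T. f x \<in> U}"
  proof (subst openin_subopen, intro ballI)
    fix x assume x: "x \<in> {x \<in> topspace T. f x \<in> U}"
    then have "f x \<in> U" by simp
    from openin_lcD[OF U this] obtain S r where S: "finite S" "S \<subseteq> seminorms X" "0 < r"
      "\<forall>y\<in>points X. (\<forall>p\<in>S. p (y - f x) < r) \<longrightarrow> y \<in> U"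
      by blast
    have "\<forall>p\<in>S. \<exists>V. openin T V \<and> x \<in> V \<and> (\<forall>y\<in>V. p (f y - f x) < r)"
      using b S x by blast
    then obtain V where V: "\<And>p. p \<in> S \<Longrightarrow> openin T (V p) \<and> x \<in> V p \<and> (\<forall>y\<in>V p. p (f y - f x) < r)"
      by metis
    \<comment> \<open>\<open>topspace T\<close> is intersected in because the intersection over an
      empty S would be the whole type.\<close>
    have "openin T (topspace T \<inter> \<Inter> (V ` S))"
      using S(1) V
    proof (induction S)
      case (insert a S)
      have "topspace T \<inter> \<Inter> (V ` insert a S) = V a \<inter> (topspace T \<inter> \<Inter> (V ` S))"
        by blast
      with insert show ?case by (simp add: openin_Int)
    qed simp
    moreover have "x \<in> topspace T \<inter> \<Inter> (V ` S)"
      using x V by auto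
    moreover have "topspace T \<inter> \<Inter> (V ` S) \<subseteq> {x \<in> topspace T. f x \<in> U}"
      using S(4) T V by fastforce
    ultimately show "\<exists>W. openin T W \<and> x \<in> W \<and> W \<subseteq> {x \<in> topspace T. f x \<in> U}"
      by blast
  qed
qed

lemma continuous_map_euclideanI:
  fixes f :: "'b::topological_space \<Rightarrow> 'a"
  assumes "\<And>x. f x \<in> points X"
    "\<And>p x. p \<in> seminorms X \<Longrightarrow> ((\<lambda>y. p (f y - f x)) \<longlongrightarrow> 0) (at x)"
  shows "continuous_map euclidean (lc_topology X) f"
proof (rule continuous_map_from_bound)
  fix p x and e :: real
  assume p: "p \<in> seminorms X" "e > 0"
  have "\<forall>\<^sub>F y in at x. p (f y - f x) < e"
    using assms(2)[OF p(1), of x] p(2) by (auto simp: order_tendsto_iff)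
  then have "\<forall>\<^sub>F y in nhds x. y \<noteq> x \<longrightarrow> p (f y - f x) < e"
    by (simp add: eventually_at_filter)
  then have "\<forall>\<^sub>F y in nhds x. p (f y - f x) < e"
    by eventually_elim (use p sn_zero in \<open>metis diff_self\<close>)
  then show "\<exists>U. openin euclidean U \<and> x \<in> U \<and> (\<forall>y\<in>U. p (f y - f x) < e)"
    by (auto simp: eventually_nhds)
qed (use assms in auto)

lemma continuous_map_euclideanD:
  fixes f :: "'b::topological_space \<Rightarrow> 'a"
  assumes "continuous_map euclidean (lc_topology X) f"
  shows "f x \<in> points X" "p \<in> seminorms X \<Longrightarrow> continuous_on UNIV (\<lambda>x. p (f x))"
proof -
  show m: "f x \<in> points X" for x
    using assms unfolding continuous_map_def by auto
  assume p: "p \<in> seminorms X"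
  have "((\<lambda>y. p (f y)) \<longlongrightarrow> p (f x)) (at x)" for x
  proof (rule LIM_zero_cancel, rule tendsto_rabs_zero_cancel,
      rule tendsto_sandwich[where f = "\<lambda>_. 0" and h = "\<lambda>y. p (f y - f x)"])
    show "((\<lambda>y. p (f y - f x)) \<longlongrightarrow> 0) (at x)"
    proof (rule order_tendstoI)
      fix a :: real assume "a < 0"
      then show "\<forall>\<^sub>F y in at x. a < p (f y - f x)"
        using sn_nonneg[OF p] diff_mem m by (intro always_eventually) (metis less_le_trans)
    next
      fix a :: real assume "0 < a"
      have "openin euclidean {y \<in> topspace euclidean. f y \<in> {z \<in> points X. p (z - f x) < a}}"
        using assms openin_lcI[OF p m \<open>0 < a\<close>] unfolding continuous_map_def by blast
      then show "\<forall>\<^sub>F y in at x. p (f y - f x) < a"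
        using m p \<open>0 < a\<close> by (auto simp: eventually_at_topological sn_zero)
    qed
    show "\<forall>\<^sub>F y in at x. \<bar>p (f y) - p (f x)\<bar> \<le> p (f y - f x)"
    proof (intro always_eventually allI)
      fix y
      show "\<bar>p (f y) - p (f x)\<bar> \<le> p (f y - f x)"
        using sn_add[OF p, of "f y - f x" "f x"] sn_add[OF p, of "f x - f y" "f y"]
          sn_diff_commute[OF p] m[of x] m[of y] diff_mem by (fastforce simp: abs_le_iff)
    qed
  qed auto
  then show "continuous_on UNIV (\<lambda>x. p (f x))"
    by (simp add: continuous_on_def)
qed

end

lemma lcHs_imp_lc_space: "lcHs E \<Longrightarrow> lc_space E"
  unfolding lcHs_def lc_space_def by blast

section \<open>Continuous linear maps and seminorm estimates\<close>

lemma continuous_linearI: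
  assumes X: "lc_space X" and Y: "lc_space Y"
    and mem: "\<And>x. x \<in> points X \<Longrightarrow> T x \<in> points Y"
    and add: "\<And>x y. x \<in> points X \<Longrightarrow> y \<in> points X \<Longrightarrow> T (x + y) = T x + T y"
    and scale: "\<And>a x. x \<in> points X \<Longrightarrow> T (a *\<^sub>C x) = a *\<^sub>C T x"
    and bound: "\<And>q. q \<in> seminorms Y \<Longrightarrow> \<exists>p\<in>seminorms X. \<exists>C. \<forall>x\<in>points X. q (T x) \<le> C * p x"
  shows "continuous_linear X Y T"
  unfolding continuous_linear_def
proof (intro conjI ballI allI add scale)
  interpret X: lc_space X by fact
  interpret Y: lc_space Y by fact
  show "continuous_map (lc_topology X) (lc_topology Y) T"
  proof (rule Y.continuous_map_from_bound)
    fix q x and e :: real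
    assume q: "q \<in> seminorms Y" and x: "x \<in> topspace (lc_topology X)" and e: "e > 0"
    obtain p C where p: "p \<in> seminorms X" and C: "\<And>x. x \<in> points X \<Longrightarrow> q (T x) \<le> C * p x"
      using bound[OF q] by blast
    \<comment> \<open>The constant C comes without a sign; |C| + 1 is positive and dominates
      it.\<close>
    define r where "r = e / (\<bar>C\<bar> + 1)"
    have r: "r > 0" using e by (simp add: r_def)
    have "q (T y - T x) < e" if y: "y \<in> points X" "p (y - x) < r" for y
    proof -
      have "T y = T (y - x) + T x"
        using add[of "y - x" x] X.diff_mem[OF y(1), of x] x by simp
      then have "q (T y - T x) \<le> C * p (y - x)"
        using C[of "y - x"] X.diff_mem[OF y(1), of x] x by simp
      also have "\<dots> \<le> (\<bar>C\<bar> + 1) * p (y - x)"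
        using X.sn_nonneg[OF p X.diff_mem[OF y(1), of x]] x by (intro mult_right_mono) auto
      also have "\<dots> < (\<bar>C\<bar> + 1) * r"
        using y by (intro mult_strict_left_mono) auto
      finally show ?thesis by (simp add: r_def)
    qed
    moreover have "x \<in> {y \<in> points X. p (y - x) < r}"
      using x r p by (simp add: X.sn_zero)
    ultimately show "\<exists>U. openin (lc_topology X) U \<and> x \<in> U \<and> (\<forall>y\<in>U. q (T y - T x) < e)"
      using X.openin_lcI[OF p _ r, of x] x
      by (intro exI[of _ "{y \<in> points X. p (y - x) < r}"]) auto
  qed (use mem in auto)
qed

lemma continuous_linear_mem:
  assumes "lc_space X" "lc_space Y" "continuous_linear X Y T" "x \<in> points X"
  shows "T x \<in> points Y"
proof -
  interpret X: lc_space X by fact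
  interpret Y: lc_space Y by fact
  show ?thesis
    using assms unfolding continuous_linear_def continuous_map_def by auto
qed

text \<open>A converse of \<open>continuous_linearI\<close>, by scaling x into a neighbourhood of 0
  that T maps into the unit ball of q. A sum over finitely many seminorms stands for their
  maximum.\<close>

lemma continuous_linear_bound:
  assumes X: "lc_space X" and Y: "lc_space Y" and T: "continuous_linear X Y T"
    and q: "q \<in> seminorms Y"
  obtains S C where "finite S" "S \<subseteq> seminorms X" "C \<ge> 0"
    "\<And>x. x \<in> points X \<Longrightarrow> q (T x) \<le> C * (\<Sum>p\<in>S. p x)"
proof -
  interpret X: lc_space X by fact
  interpret Y: lc_space Y by fact
  have add: "T (x + y) = T x + T y" if "x \<in> points X" "y \<in> points X" for x y
    using T that unfolding continuous_linear_def by blast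
  have scale: "T (a *\<^sub>C x) = a *\<^sub>C T x" if "x \<in> points X" for a x
    using T that unfolding continuous_linear_def by blast
  have T0: "T 0 = 0"
    using scale[OF X.zero_mem, of 0] by simp
  let ?U = "{x \<in> topspace (lc_topology X). T x \<in> {y \<in> points Y. q (y - 0) < 1}}"
  have "openin (lc_topology X) ?U"
    using T Y.openin_lcI[OF q Y.zero_mem, of 1]
    unfolding continuous_linear_def continuous_map_def by fastforce
  moreover have "0 \<in> ?U"
    using X.zero_mem Y.zero_mem q by (auto simp: T0 Y.sn_zero)
  ultimately have "\<exists>S r. finite S \<and> S \<subseteq> seminorms X \<and> 0 < r \<and>
    (\<forall>y\<in>points X. (\<forall>p\<in>S. p (y - 0) < r) \<longrightarrow> y \<in> ?U)"
    by (rule X.openin_lcD)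
  then obtain S r where S: "finite S" "S \<subseteq> seminorms X" "0 < r"
    and SU: "\<forall>y\<in>points X. (\<forall>p\<in>S. p (y - 0) < r) \<longrightarrow> y \<in> ?U"
    by (elim exE conjE)
  have mem: "T x \<in> points Y" if "x \<in> points X" for x
    using continuous_linear_mem[OF X Y T that] .
  have "q (T x) \<le> 2 / r * (\<Sum>p\<in>S. p x)" if x: "x \<in> points X" for x
  proof -
    define s where "s = (\<Sum>p\<in>S. p x)"
    have nn: "p x \<ge> 0" if "p \<in> S" for p
      using X.sn_nonneg S that x by auto
    have ps: "p x \<le> s" if "p \<in> S" for p
      unfolding s_def using S nn that by (intro member_le_sum) auto
    have s: "s \<ge> 0"
      unfolding s_def using nn by (intro sum_nonneg)
    \<comment> \<open>The vector x / t lies in ?U as soon as s < t r. For s = 0 this holds for all t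
      > 0, and q (T x) vanishes; otherwise t = 2 s / r is taken, whence the constant 2 / r.\<close>
    have main: "q (T x) \<le> t" if t: "t > 0" "s < t * r" for t
    proof -
      have "complex_of_real (1 / t) *\<^sub>C x \<in> ?U"
      proof (rule SU[rule_format])
        fix p assume p: "p \<in> S"
        then have "p (complex_of_real (1 / t) *\<^sub>C x - 0) = p x / t"
          using X.sn_scale[of p x "complex_of_real (1 / t)"] S x t by (auto simp: norm_divide)
        also have "\<dots> < r"
          using ps[OF p] t by (simp add: field_simps)
        finally show "p (complex_of_real (1 / t) *\<^sub>C x - 0) < r" .
      qed (use X.scale_mem x in auto)
      then have "q (complex_of_real (1 / t) *\<^sub>C T x) < 1"
        using scale[OF x] by auto
      then have "q (T x) / t < 1"
        using Y.sn_scale[OF q mem[OF x], of "complex_of_real (1 / t)"] t by (auto simp: norm_divide)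
      then show ?thesis
        using t by (simp add: field_simps)
    qed
    show ?thesis
    proof (cases "s = 0")
      case True
      then have "q (T x) \<le> 0 + e" if "e > 0" for e
        using main[of e] that S by simp
      then show ?thesis
        using True field_le_epsilon[of "q (T x)" 0] by (simp add: s_def)
    next
      case False
      then show ?thesis
        using main[of "2 / r * s"] s S by (simp add: s_def)
    qed
  qed
  then show ?thesis
    using that[of S "2 / r"] S by auto
qed

lemma limitin_continuous_linear:
  assumes "continuous_linear X Y T" "limitin (lc_topology X) f l F"
  shows "limitin (lc_topology Y) (\<lambda>k. T (f k)) (T l) F"
  using assms continuous_map_limit unfolding continuous_linear_def by (fastforce simp: o_def)

section \<open>The scalar field as a locally convex space, and continuous functionals\<close>

lemma lc_space_scalar: "lc_space scalar_lcs"
  by standard (auto simp: scalar_lcs_def scaleC_complex_def norm_triangle_ineq norm_mult)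

lemma lc_topology_scalar: "lc_topology scalar_lcs = euclidean"
proof -
  interpret lc_space scalar_lcs by (rule lc_space_scalar)
  have "openin (lc_topology scalar_lcs) U \<longleftrightarrow> open U" for U
  proof
    assume U: "openin (lc_topology scalar_lcs) U"
    show "open U"
    proof (subst open_subopen, intro ballI)
      fix x assume "x \<in> U"
      from openin_lcD[OF U this] obtain S r where S: "finite S" "S \<subseteq> seminorms scalar_lcs" "0 < r"
        "\<forall>y\<in>points scalar_lcs. (\<forall>p\<in>S. p (y - x) < r) \<longrightarrow> y \<in> U"
        by blast
      have "y \<in> U" if "dist x y < r" for y
      proof -
        have "\<forall>p\<in>S. p (y - x) < r"
          using S(2) that by (auto simp: scalar_lcs_def dist_norm norm_minus_commute)
        then show ?thesis using S(4) by (simp add: scalar_lcs_def)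
      qed
      then have "ball x r \<subseteq> U" by auto
      with \<open>0 < r\<close> show "\<exists>T. open T \<and> x \<in> T \<and> T \<subseteq> U"
        by (intro exI[of _ "ball x r"]) auto
    qed
  next
    assume U: "open U"
    show "openin (lc_topology scalar_lcs) U"
    proof (subst openin_subopen, intro ballI)
      fix x assume "x \<in> U"
      with U obtain r where r: "r > 0" "ball x r \<subseteq> U"
        using openE by blast
      have "openin (lc_topology scalar_lcs) {y \<in> points scalar_lcs. norm (y - x) < r}"
        using openin_lcI[of norm x r] r by (simp add: scalar_lcs_def)
      then show "\<exists>T. openin (lc_topology scalar_lcs) T \<and> x \<in> T \<and> T \<subseteq> U"
        using r by (intro exI[of _ "{y \<in> points scalar_lcs. norm (y - x) < r}"])
          (auto simp: scalar_lcs_def dist_norm norm_minus_commute)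
    qed
  qed
  then show ?thesis
    by (simp add: topology_eq)
qed

lemma scalar_points [simp]: "points scalar_lcs = UNIV" "seminorms scalar_lcs = {norm}"
  by (auto simp: scalar_lcs_def)

context lc_space
begin

lemma dual_add: "\<phi> \<in> dual X \<Longrightarrow> x \<in> points X \<Longrightarrow> y \<in> points X \<Longrightarrow> \<phi> (x + y) = \<phi> x + \<phi> y"
  and dual_scale: "\<phi> \<in> dual X \<Longrightarrow> x \<in> points X \<Longrightarrow> \<phi> (a *\<^sub>C x) = a * \<phi> x"
  and dual_outside: "\<phi> \<in> dual X \<Longrightarrow> x \<notin> points X \<Longrightarrow> \<phi> x = 0"
  unfolding dual_def operators_def continuous_linear_def by (auto simp: scaleC_complex_def)

lemma dual_zero: "\<phi> \<in> dual X \<Longrightarrow> \<phi> 0 = 0"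
  using dual_scale[of \<phi> 0 0] zero_mem by simp

lemma dual_diff: "\<phi> \<in> dual X \<Longrightarrow> x \<in> points X \<Longrightarrow> y \<in> points X \<Longrightarrow> \<phi> (x - y) = \<phi> x - \<phi> y"
  using dual_add[of \<phi> "x - y" y] diff_mem by simp

lemma dual_sum:
  "\<phi> \<in> dual X \<Longrightarrow> (\<And>i. i \<in> A \<Longrightarrow> f i \<in> points X) \<Longrightarrow> \<phi> (sum f A) = (\<Sum>i\<in>A. \<phi> (f i))"
proof (induction A rule: infinite_finite_induct)
  case (insert x F)
  then show ?case
    using dual_add[of \<phi> "f x" "sum f F"] sum_mem[of F f] by simp
qed (simp_all add: dual_zero)

lemma dual_continuous_linear: "\<phi> \<in> dual X \<Longrightarrow> continuous_linear X scalar_lcs \<phi>"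
  by (simp add: dual_def operators_def)

lemma dual_continuous_map: "\<phi> \<in> dual X \<Longrightarrow> continuous_map (lc_topology X) euclidean \<phi>"
  using dual_continuous_linear unfolding continuous_linear_def lc_topology_scalar by blast

lemma dual_limit:
  "\<phi> \<in> dual X \<Longrightarrow> limitin (lc_topology X) f l F \<Longrightarrow> ((\<lambda>k. \<phi> (f k)) \<longlongrightarrow> \<phi> l) F"
  using limitin_continuous_linear[OF dual_continuous_linear, of \<phi> f l F]
  by (simp add: lc_topology_scalar)

lemma dualI:
  assumes "\<And>x y. x \<in> points X \<Longrightarrow> y \<in> points X \<Longrightarrow> \<phi> (x + y) = \<phi> x + \<phi> y"
    "\<And>a x. x \<in> points X \<Longrightarrow> \<phi> (a *\<^sub>C x) = a * \<phi> x"
    "\<And>x. x \<notin> points X \<Longrightarrow> \<phi> x = 0"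
    "p \<in> seminorms X" "\<And>x. x \<in> points X \<Longrightarrow> norm (\<phi> x) \<le> C * p x"
  shows "\<phi> \<in> dual X"
proof -
  have "continuous_linear X scalar_lcs \<phi>"
  proof (rule continuous_linearI[OF lc_space_axioms lc_space_scalar])
    fix q :: "complex \<Rightarrow> real" assume "q \<in> seminorms scalar_lcs"
    then show "\<exists>p\<in>seminorms X. \<exists>C. \<forall>x\<in>points X. q (\<phi> x) \<le> C * p x"
      using assms(4,5) by (intro bexI[of _ p] exI[of _ C]) auto
  qed (use assms in \<open>auto simp: scaleC_complex_def\<close>)
  then show ?thesis
    using assms by (auto simp: dual_def operators_def)
qed

lemma dual_bound:
  assumes "\<phi> \<in> dual X"
  obtains S C where "finite S" "S \<subseteq> seminorms X" "C \<ge> 0"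
    "\<And>x. x \<in> points X \<Longrightarrow> norm (\<phi> x) \<le> C * (\<Sum>p\<in>S. p x)"
  using continuous_linear_bound[OF lc_space_axioms lc_space_scalar dual_continuous_linear[OF assms], of norm]
  by auto

end

section \<open>The Hahn--Banach theorem\<close>

context lc_space
begin

text \<open>Zero outside \<open>points X\<close> lets minimality be stated as equality of functions.
  Homogeneity is asked only as an inequality for positive reals, which is what infima deliver;
  \<open>sublinearD\<close> recovers the equality by scaling back.\<close>

definition sublinear :: "('a \<Rightarrow> real) \<Rightarrow> bool" where
  "sublinear q \<longleftrightarrow> q 0 = 0 \<and>
     (\<forall>x\<in>points X. \<forall>y\<in>points X. q (x + y) \<le> q x + q y) \<and>
     (\<forall>x\<in>points X. \<forall>c>0. q (complex_of_real c *\<^sub>C x) \<le> c * q x) \<and>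
     (\<forall>x. x \<notin> points X \<longrightarrow> q x = 0)"

lemma sublinearD:
  assumes "sublinear q"
  shows "q 0 = 0" "x \<in> points X \<Longrightarrow> y \<in> points X \<Longrightarrow> q (x + y) \<le> q x + q y"
    "x \<notin> points X \<Longrightarrow> q x = 0"
    "x \<in> points X \<Longrightarrow> - q (- x) \<le> q x"
    "x \<in> points X \<Longrightarrow> c \<ge> 0 \<Longrightarrow> q (complex_of_real c *\<^sub>C x) = c * q x"
proof -
  show q0: "q 0 = 0" and add: "\<And>x y. x \<in> points X \<Longrightarrow> y \<in> points X \<Longrightarrow> q (x + y) \<le> q x + q y"
    and "x \<notin> points X \<Longrightarrow> q x = 0"
    using assms unfolding sublinear_def by blast+
  show "x \<in> points X \<Longrightarrow> - q (- x) \<le> q x"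
    using add[of x "-x"] q0 minus_mem by simp
  have le: "q (complex_of_real c *\<^sub>C x) \<le> c * q x" if "x \<in> points X" "c > 0" for c x
    using assms that unfolding sublinear_def by blast
  assume x: "x \<in> points X" and c: "c \<ge> 0"
  show "q (complex_of_real c *\<^sub>C x) = c * q x"
  proof (cases "c = 0")
    case False
    then have "q x \<le> 1 / c * q (complex_of_real c *\<^sub>C x)"
      using le[OF scale_mem[OF x], of "1 / c" "complex_of_real c"] c
      by (simp add: scaleC_scaleC flip: of_real_mult)
    then show ?thesis
      using le[OF x, of c] c False by (simp add: field_simps)
  qed (use q0 in simp)
qed

text \<open>The reduction of \<open>q\<close> in the direction \<open>z\<close> cannot be strictly smaller than a minimal \<open>q\<close>; this
  makes minimal sublinear functionals additive.\<close>

lemma sublinear_reduce: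
  assumes q: "sublinear q" and z: "z \<in> points X"
  shows "\<exists>r. sublinear r \<and> r \<le> q \<and>
    (\<forall>x\<in>points X. \<forall>t\<ge>0. r x \<le> q (x + complex_of_real t *\<^sub>C z) - t * q z)"
proof -
  define g where "g x t = q (x + complex_of_real t *\<^sub>C z) - t * q z" for x t
  define r where "r x = (if x \<in> points X then INF t\<in>{0..}. g x t else 0)" for x
  \<comment> \<open>This bound does not depend on t, so the infimum defining r is finite.\<close>
  have lb: "- q (- x) \<le> g x t" if x: "x \<in> points X" and t: "t \<ge> 0" for x t
  proof -
    have "t * q z = q (x + complex_of_real t *\<^sub>C z + - x)"
      using sublinearD(5)[OF q z t] by simp
    also have "\<dots> \<le> q (x + complex_of_real t *\<^sub>C z) + q (- x)"
      using x z by (intro sublinearD(2)[OF q]) (auto intro: add_mem scale_mem minus_mem)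
    finally show ?thesis by (simp add: g_def)
  qed
  have bdd: "bdd_below (g x ` {0..})" if "x \<in> points X" for x
    using lb[OF that] by (intro bdd_belowI2[of _ "- q (- x)"]) auto
  have upper: "r x \<le> g x t" if "x \<in> points X" "t \<ge> 0" for x t
    using that cINF_lower[OF bdd[OF that(1)], of t] by (simp add: r_def)
  have lower: "m \<le> r x" if "x \<in> points X" "\<And>t. t \<ge> 0 \<Longrightarrow> m \<le> g x t" for x m
    using that by (auto simp: r_def intro!: cINF_greatest)
  have "sublinear r"
    unfolding sublinear_def
  proof (intro conjI ballI allI impI)
    have "r 0 \<le> g 0 0" "- q (- 0) \<le> r 0"
      using upper[OF zero_mem, of 0] lower[OF zero_mem, of "- q (- 0)"] lb[OF zero_mem] by auto
    then show "r 0 = 0"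
      by (simp add: g_def sublinearD(1)[OF q])
  next
    fix x y assume x: "x \<in> points X" and y: "y \<in> points X"
    have "r (x + y) \<le> g x s + g y t" if "s \<ge> 0" "t \<ge> 0" for s t
    proof -
      have "r (x + y) \<le> g (x + y) (s + t)"
        using that x y by (intro upper add_mem) auto
      also have "q (x + y + complex_of_real (s + t) *\<^sub>C z)
          = q ((x + complex_of_real s *\<^sub>C z) + (y + complex_of_real t *\<^sub>C z))"
        by (simp add: scaleC_add_left algebra_simps)
      then have "g (x + y) (s + t) \<le> g x s + g y t"
        using sublinearD(2)[OF q, of "x + complex_of_real s *\<^sub>C z" "y + complex_of_real t *\<^sub>C z"]
          x y z by (simp add: g_def algebra_simps add_mem scale_mem)
      finally show ?thesis .
    qed
    then have "r (x + y) - g x s \<le> r y" if "s \<ge> 0" for s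
      using that y by (intro lower) (auto simp: algebra_simps)
    then have "r (x + y) - r y \<le> r x"
      using x by (intro lower) (auto simp: algebra_simps)
    then show "r (x + y) \<le> r x + r y" by simp
  next
    fix x and c :: real assume x: "x \<in> points X" and c: "c > 0"
    have "r (complex_of_real c *\<^sub>C x) / c \<le> r x"
    proof (rule lower[OF x])
      fix t :: real assume t: "t \<ge> 0"
      have "complex_of_real c *\<^sub>C (x + complex_of_real t *\<^sub>C z)
        = complex_of_real c *\<^sub>C x + complex_of_real (c * t) *\<^sub>C z"
        by (simp add: scaleC_add_right scaleC_scaleC)
      then have "g (complex_of_real c *\<^sub>C x) (c * t) = c * g x t"
        using sublinearD(5)[OF q, of "x + complex_of_real t *\<^sub>C z" c] x z c
        by (simp add: g_def algebra_simps add_mem scale_mem)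
      then show "r (complex_of_real c *\<^sub>C x) / c \<le> g x t"
        using upper[OF scale_mem[OF x], of "c * t" "complex_of_real c"] c t by (simp add: field_simps)
    qed
    then show "r (complex_of_real c *\<^sub>C x) \<le> c * r x"
      using c by (simp add: field_simps)
  qed (simp add: r_def)
  moreover have "r \<le> q"
    unfolding le_fun_def
  proof
    fix x
    show "r x \<le> q x"
      using upper[of x 0] sublinearD(3)[OF q, of x] by (cases "x \<in> points X") (auto simp: r_def g_def)
  qed
  ultimately show ?thesis
    using upper by (intro exI[of _ r]) (auto simp: g_def)
qed

text \<open>Zorn's lemma downwards. The pointwise infimum of a chain is finite because all members
  lie above -p(-x). It is subadditive because, of two members of a chain, the smaller one may be
  used for both summands.\<close>

lemma sublinear_minimal:
  assumes p: "sublinear p"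
  shows "\<exists>q. sublinear q \<and> q \<le> p \<and> (\<forall>r. sublinear r \<longrightarrow> r \<le> q \<longrightarrow> r = q)"
proof -
  define A where "A = {q. sublinear q \<and> q \<le> p}"
  have "\<exists>m\<in>A. \<forall>a\<in>A. a \<le> m \<longrightarrow> a = m"
  proof (rule predicate_Zorn)
    show "partial_order_on A (relation_of (\<lambda>a b. b \<le> a) A)"
      by (rule partial_order_on_relation_ofI) auto
    fix C assume C: "C \<in> Chains (relation_of (\<lambda>a b. b \<le> a) A)"
    then have CA: "C \<subseteq> A" and chain: "\<And>a b. a \<in> C \<Longrightarrow> b \<in> C \<Longrightarrow> a \<le> b \<or> b \<le> a"
      by (auto simp: Chains_def relation_of_def)
    show "\<exists>u\<in>A. \<forall>a\<in>C. u \<le> a"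
    proof (cases "C = {}")
      case True
      then show ?thesis using p by (auto simp: A_def)
    next
      case False
      define u where "u x = (INF q\<in>C. q x)" for x
      have sub: "sublinear q" if "q \<in> C" for q
        using that CA by (auto simp: A_def)
      have lb: "- p (- x) \<le> q x" if "q \<in> C" "x \<in> points X" for q x
      proof -
        have "q (- x) \<le> p (- x)"
          using that CA by (auto simp: A_def le_fun_def)
        then show ?thesis
          using sublinearD(4)[OF sub[OF that(1)] that(2)] by linarith
      qed
      have bdd: "bdd_below ((\<lambda>q. q x) ` C)" for x
      proof (cases "x \<in> points X")
        case True
        then show ?thesis using lb by (intro bdd_belowI2[of _ "- p (- x)"])
      next
        case False
        then show ?thesis
          by (intro bdd_belowI2[of _ 0]) (metis sublinearD(3)[OF sub] order_refl)
      qed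
      have upper: "u x \<le> q x" if "q \<in> C" for q x
        unfolding u_def using that bdd by (intro cINF_lower)
      have lower: "m \<le> u x" if "\<And>q. q \<in> C \<Longrightarrow> m \<le> q x" for m x
        unfolding u_def using False that by (intro cINF_greatest)
      have "sublinear u"
        unfolding sublinear_def
      proof (intro conjI ballI allI impI)
        have "u 0 = (INF q\<in>C. 0)"
          unfolding u_def by (rule INF_cong[OF refl]) (rule sublinearD(1)[OF sub])
        then show "u 0 = 0"
          using False by simp
        show "u x = 0" if "x \<notin> points X" for x
        proof -
          have "u x = (INF q\<in>C. 0)"
            unfolding u_def by (rule INF_cong[OF refl]) (rule sublinearD(3)[OF sub that])
          then show ?thesis
            using False by simp
        qed
        fix x assume x: "x \<in> points X"
        show "u (complex_of_real c *\<^sub>C x) \<le> c * u x" if "c > 0" for c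
        proof -
          have "u (complex_of_real c *\<^sub>C x) / c \<le> u x"
          proof (rule lower)
            fix q assume "q \<in> C"
            then show "u (complex_of_real c *\<^sub>C x) / c \<le> q x"
              using upper[of q "complex_of_real c *\<^sub>C x"] sublinearD(5)[OF sub x, of q c] that
              by (simp add: field_simps)
          qed
          then show ?thesis using that by (simp add: field_simps)
        qed
        fix y assume y: "y \<in> points X"
        have "u (x + y) \<le> q x + q' y" if qq: "q \<in> C" "q' \<in> C" for q q'
        proof -
          consider "q \<le> q'" | "q' \<le> q" using chain[OF qq] by blast
          then show ?thesis
          proof cases
            case 1
            then show ?thesis
              using upper[OF qq(1), of "x + y"] sublinearD(2)[OF sub[OF qq(1)] x y]
                le_funD[OF 1, of y] by linarith
          next
            case 2
            then show ?thesis
              using upper[OF qq(2), of "x + y"] sublinearD(2)[OF sub[OF qq(2)] x y]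
                le_funD[OF 2, of x] by linarith
          qed
        qed
        note bound = this
        have bound': "u (x + y) - q x \<le> u y" if q: "q \<in> C" for q
        proof (rule lower)
          fix q' assume "q' \<in> C"
          from bound[OF q this] show "u (x + y) - q x \<le> q' y" by simp
        qed
        have "u (x + y) - u y \<le> u x"
        proof (rule lower)
          fix q assume "q \<in> C"
          from bound'[OF this] show "u (x + y) - u y \<le> q x" by simp
        qed
        then show "u (x + y) \<le> u x + u y" by simp
      qed
      moreover obtain q where "q \<in> C" using False by auto
      then have "u \<le> p"
        using upper[of q] CA by (force simp: A_def le_fun_def intro: order_trans)
      ultimately show ?thesis
        using upper by (auto simp: A_def le_fun_def)
    qed
  qed
  then obtain m where "m \<in> A" and min: "\<forall>a\<in>A. a \<le> m \<longrightarrow> a = m" by blast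
  then show ?thesis
    by (intro exI[of _ m]) (auto simp: A_def intro: order_trans)
qed

lemma sublinear_minimal_additive:
  assumes q: "sublinear q" and min: "\<And>r. sublinear r \<Longrightarrow> r \<le> q \<Longrightarrow> r = q"
    and x: "x \<in> points X" and z: "z \<in> points X"
  shows "q (x + z) = q x + q z"
proof -
  obtain r where "sublinear r" "r \<le> q"
    and r: "\<forall>x\<in>points X. \<forall>t\<ge>0. r x \<le> q (x + complex_of_real t *\<^sub>C z) - t * q z"
    using sublinear_reduce[OF q z] by blast
  then have "r = q" using min by blast
  then have "q x \<le> q (x + z) - q z"
    using r[rule_format, OF x, of 1] by simp
  then show ?thesis
    using sublinearD(2)[OF q x z] by simp
qed

text \<open>The reduction in the direction y is made before minimising: at -y with t = 1 it gives
  q(-y) \<le> -p(y), so that the additive minimal q attains p at y. This takes the place of an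
  extension from the line through y.\<close>

theorem Hahn_Banach:
  assumes p: "p \<in> seminorms X" and y: "y \<in> points X"
  shows "\<exists>\<phi>\<in>dual X. (\<forall>x\<in>points X. norm (\<phi> x) \<le> p x) \<and> \<phi> y = complex_of_real (p y)"
proof -
  define p0 where "p0 x = (if x \<in> points X then p x else 0)" for x
  have "sublinear p0"
    unfolding sublinear_def p0_def using p
    by (auto simp: sn_zero sn_scale sn_add add_mem scale_mem)
  then obtain p1 where p1: "sublinear p1" "p1 \<le> p0"
    and p1y: "\<forall>x\<in>points X. \<forall>t\<ge>0. p1 x \<le> p0 (x + complex_of_real t *\<^sub>C y) - t * p0 y"
    using sublinear_reduce[of p0 y] y by blast
  obtain q where q: "sublinear q" "q \<le> p1" "\<forall>r. sublinear r \<longrightarrow> r \<le> q \<longrightarrow> r = q"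
    using sublinear_minimal[OF p1(1)] by blast
  have add: "q (x + z) = q x + q z" if "x \<in> points X" "z \<in> points X" for x z
    by (rule sublinear_minimal_additive[OF q(1) _ that]) (use q(3) in blast)
  have neg: "q (- x) = - q x" if "x \<in> points X" for x
    using add[OF that minus_mem[OF that]] sublinearD(1)[OF q(1)] by simp
  have scale: "q (complex_of_real c *\<^sub>C x) = c * q x" if x: "x \<in> points X" for c x
  proof (cases "c \<ge> 0")
    case False
    then have "q (complex_of_real (- c) *\<^sub>C x) = - c * q x"
      by (intro sublinearD(5)[OF q(1) x]) auto
    then show ?thesis
      using neg[OF scale_mem[OF x], of "complex_of_real c"] by simp
  qed (rule sublinearD(5)[OF q(1) x])
  have qp: "q x \<le> p x" if "x \<in> points X" for x
    using le_funD[OF q(2), of x] le_funD[OF p1(2), of x] that by (simp add: p0_def)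
  have "q (- y) \<le> - p y"
    using le_funD[OF q(2), of "- y"] p1y[rule_format, OF minus_mem[OF y], of 1] y zero_mem p
    by (simp add: p0_def sn_zero)
  then have qy: "q y = p y"
    using neg[OF y] qp[OF y] by simp
  \<comment> \<open>The complex linear functional with real part q: its imaginary part at x must be
    -q(ix).\<close>
  define \<phi> where "\<phi> x = (if x \<in> points X then Complex (q x) (- q (\<i> *\<^sub>C x)) else 0)" for x
  have \<phi>add: "\<phi> (x + z) = \<phi> x + \<phi> z" if "x \<in> points X" "z \<in> points X" for x z
    using that by (simp add: \<phi>_def add_mem add scale_mem scaleC_add_right complex_eq_iff)
  have \<phi>scale: "\<phi> (a *\<^sub>C x) = a * \<phi> x" if x: "x \<in> points X" for a x
  proof -
    have a: "a *\<^sub>C x = complex_of_real (Re a) *\<^sub>C x + complex_of_real (Im a) *\<^sub>C \<i> *\<^sub>C x"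
      by (subst complex_eq[of a]) (simp add: scaleC_add_left scaleC_scaleC mult.commute)
    have ia: "\<i> *\<^sub>C a *\<^sub>C x = complex_of_real (Re a) *\<^sub>C \<i> *\<^sub>C x + complex_of_real (- Im a) *\<^sub>C x"
      unfolding scaleC_scaleC scaleC_add_left[symmetric]
      by (rule arg_cong[where f = "\<lambda>c. c *\<^sub>C x"]) (simp add: complex_eq_iff)
    have "q (a *\<^sub>C x) = Re a * q x + Im a * q (\<i> *\<^sub>C x)"
      unfolding a using x by (simp add: add scale scale_mem)
    moreover have "q (\<i> *\<^sub>C a *\<^sub>C x) = Re a * q (\<i> *\<^sub>C x) - Im a * q x"
      unfolding ia
      by (subst add) (simp_all add: x scale_mem scale del: of_real_minus complex_vector.scale_minus_left)
    ultimately show ?thesis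
      using x by (simp add: \<phi>_def scale_mem complex_eq_iff)
  qed
  have bound: "norm (\<phi> x) \<le> p x" if x: "x \<in> points X" for x
  proof (cases "\<phi> x = 0")
    case False
    \<comment> \<open>Multiplication by a makes \<phi>(x) real and nonnegative, so that its modulus
      is a value of q.\<close>
    define a where "a = cnj (\<phi> x) / norm (\<phi> x)"
    have na: "norm a = 1" using False by (simp add: a_def norm_divide)
    have "a * \<phi> x = norm (\<phi> x)"
      using False complex_norm_square[of "\<phi> x"]
      by (simp add: a_def divide_eq_eq power2_eq_square mult.commute)
    then have "\<phi> (a *\<^sub>C x) = norm (\<phi> x)"
      by (simp add: \<phi>scale[OF x])
    then have "norm (\<phi> x) = q (a *\<^sub>C x)"
      using scale_mem[OF x, of a] by (simp add: \<phi>_def complex_eq_iff)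
    also have "\<dots> \<le> p (a *\<^sub>C x)"
      using qp scale_mem x by blast
    also have "\<dots> = p x"
      using sn_scale[OF p x, of a] na by simp
    finally show ?thesis .
  qed (use sn_nonneg[OF p x] in simp)
  have "\<phi> \<in> dual X"
    using \<phi>add \<phi>scale bound p by (intro dualI[of \<phi> p 1]) (auto simp: \<phi>_def)
  moreover have "\<phi> y = complex_of_real (p y)"
  proof -
    have "Re (\<phi> y) = p y" using y qy by (simp add: \<phi>_def)
    \<comment> \<open>The real part already exhausts the bound p y, which leaves nothing for the
      imaginary part.\<close>
    moreover have "(Re (\<phi> y))\<^sup>2 + (Im (\<phi> y))\<^sup>2 \<le> (p y)\<^sup>2"
      using power_mono[OF bound[OF y], of 2] by (simp add: cmod_power2)
    ultimately show ?thesis by (simp add: complex_eq_iff)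
  qed
  ultimately show ?thesis using bound by blast
qed

text \<open>The passage from scalar to vector-valued estimates: only functionals dominated by p are
  tested, so scalar bounds may be used with constants that depend on p alone.\<close>

lemma sn_le_by_dual:
  assumes "p \<in> seminorms X" "y \<in> points X"
    "\<And>\<phi>. \<phi> \<in> dual X \<Longrightarrow> (\<And>x. x \<in> points X \<Longrightarrow> norm (\<phi> x) \<le> p x) \<Longrightarrow> norm (\<phi> y) \<le> B"
  shows "p y \<le> B"
proof -
  obtain \<phi> where "\<phi> \<in> dual X" "\<forall>x\<in>points X. norm (\<phi> x) \<le> p x"
    "\<phi> y = complex_of_real (p y)"
    using Hahn_Banach[OF assms(1,2)] by blast
  then show ?thesis
    using assms(3)[of \<phi>] sn_nonneg[OF assms(1,2)] by simp
qed

end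

section \<open>Hausdorff and sequentially complete spaces\<close>

locale lc_hausdorff = lc_space +
  assumes separated: "x \<in> points X \<Longrightarrow> (\<And>p. p \<in> seminorms X \<Longrightarrow> p x = 0) \<Longrightarrow> x = 0"
begin

lemma dual_separates:
  assumes "x \<in> points X" "y \<in> points X" "\<And>\<phi>. \<phi> \<in> dual X \<Longrightarrow> \<phi> x = \<phi> y"
  shows "x = y"
proof -
  have "p (x - y) = 0" if p: "p \<in> seminorms X" for p
    using sn_le_by_dual[OF p diff_mem[OF assms(1,2)], of 0] sn_nonneg[OF p diff_mem[OF assms(1,2)]]
      assms by (simp add: dual_diff)
  then show ?thesis
    using separated[OF diff_mem[OF assms(1,2)]] by simp
qed

lemma eqI_sn_diff:
  assumes "x \<in> points X" "y \<in> points X" "\<And>p. p \<in> seminorms X \<Longrightarrow> p (x - y) = 0"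
  shows "x = y"
  using separated[OF diff_mem[OF assms(1,2)]] assms(3) by simp

lemma lc_limit_unique:
  assumes "limitin (lc_topology X) f l F" "limitin (lc_topology X) f m F" "F \<noteq> bot"
  shows "l = m"
proof (rule eqI_sn_diff)
  show lm: "l \<in> points X" "m \<in> points X" using limitin_lcD assms by auto
  fix p assume p: "p \<in> seminorms X"
  have "((\<lambda>k. p (f k - l) + p (f k - m)) \<longlongrightarrow> 0 + 0) F"
    using limitin_lcD(3)[OF _ p] assms by (intro tendsto_add) auto
  moreover have "\<forall>\<^sub>F k in F. p (l - m) \<le> p (f k - l) + p (f k - m)"
    using limitin_lcD(2)[OF assms(1)]
  proof eventually_elim
    case (elim k)
    then show ?case
      using sn_triangle[OF p lm(1) elim lm(2)] sn_diff_commute[OF p lm(1) elim] by simp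
  qed
  ultimately have "p (l - m) \<le> 0"
    using tendsto_lowerbound[of _ _ F] assms(3) by fastforce
  then show "p (l - m) = 0"
    using sn_nonneg[OF p diff_mem] lm by (simp add: order_antisym)
qed

end

text \<open>A vector on which all seminorms vanish and the vector 0 are limits of the same constant
  sequence, so the Hausdorff property identifies them.\<close>

lemma lcHs_imp_lc_hausdorff:
  assumes "lcHs E"
  shows "lc_hausdorff E"
proof -
  interpret lc_space E using assms by (rule lcHs_imp_lc_space)
  show ?thesis
  proof
    fix x assume x: "x \<in> points E" and px: "\<And>p. p \<in> seminorms E \<Longrightarrow> p x = 0"
    have "limitin (lc_topology E) (\<lambda>_. x) x (sequentially :: nat filter)"
      by (rule limitin_lcI) (simp_all add: x sn_zero)
    moreover have "limitin (lc_topology E) (\<lambda>_. x) 0 (sequentially :: nat filter)"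
      by (rule limitin_lcI) (simp_all add: x px zero_mem)
    moreover have "Hausdorff_space (lc_topology E)"
      using assms by (simp add: lcHs_def)
    ultimately show "x = 0"
      using limitin_Hausdorff_unique by (metis trivial_limit_sequentially)
  qed
qed

section \<open>Local completeness and geometrically fast sequences\<close>

locale lc_complete = lc_hausdorff +
  assumes fast_Cauchy_convergent:
    "(\<And>k. u k \<in> points X) \<Longrightarrow>
     (\<And>p. p \<in> seminorms X \<Longrightarrow> \<exists>C. \<forall>k. p (u (Suc k) - u k) \<le> C * (1 / 2) ^ k) \<Longrightarrow>
     \<exists>l. limitin (lc_topology X) u l sequentially"

text \<open>The difference of powers on the right is the exact partial geometric sum, a form that
  survives the induction.\<close>

lemma (in lc_space) fast_Cauchy_diff:
  assumes u: "\<And>k. u k \<in> points X" and p: "p \<in> seminorms X"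
    and C: "\<And>k. p (u (Suc k) - u k) \<le> C * (1 / 2) ^ k"
  shows "m \<le> n \<Longrightarrow> p (u n - u m) \<le> 2 * C * ((1 / 2) ^ m - (1 / 2) ^ n)"
proof (induction n rule: dec_induct)
  case base
  then show ?case using p by (simp add: sn_zero)
next
  case (step n)
  have "p (u (Suc n) - u m) \<le> p (u (Suc n) - u n) + p (u n - u m)"
    using sn_triangle[OF p] u by blast
  with step.IH C[of n] show ?case by (simp add: algebra_simps)
qed

text \<open>The disc witnessing completeness is the polar-type set of all \<open>y\<close> with \<open>p y \<le> c p\<close> for every
  \<open>p\<close>: its gauge bounds each seminorm, and membership in a multiple of it can be read off from the
  seminorms.\<close>

lemma locally_complete_imp_lc_complete:
  assumes "lcHs E" "locally_complete E"
  shows "lc_complete E"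
proof -
  interpret lc_hausdorff E using assms(1) by (rule lcHs_imp_lc_hausdorff)
  show ?thesis
  proof
    fix u :: "nat \<Rightarrow> 'a"
    assume u: "\<And>k. u k \<in> points E"
      and fast: "\<And>p. p \<in> seminorms E \<Longrightarrow> \<exists>C. \<forall>k. p (u (Suc k) - u k) \<le> C * (1 / 2) ^ k"
    have "\<exists>c. c \<ge> 1 \<and> p (u 0) \<le> c \<and> (\<forall>k. p (u (Suc k) - u k) \<le> c * (1 / 2) ^ k)"
      if p: "p \<in> seminorms E" for p
    proof -
      obtain C where C: "\<forall>k. p (u (Suc k) - u k) \<le> C * (1 / 2) ^ k"
        using fast[OF p] by blast
      have "p (u (Suc k) - u k) \<le> max C (max 1 (p (u 0))) * (1 / 2) ^ k" for k
        using C[rule_format, of k] by (rule order_trans) (intro mult_right_mono, auto)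
      then show ?thesis
        by (intro exI[of _ "max C (max 1 (p (u 0)))"]) auto
    qed
    \<comment> \<open>The ratio 1/2 is common to all seminorms, so the constants c p alone define a
      single disc that absorbs all increments after scaling by 2^k. The lower bound 1 allows
      division by c p.\<close>
    then obtain c where c: "\<And>p. p \<in> seminorms E \<Longrightarrow> c p \<ge> 1"
      and c0: "\<And>p. p \<in> seminorms E \<Longrightarrow> p (u 0) \<le> c p"
      and ck: "\<And>p k. p \<in> seminorms E \<Longrightarrow> p (u (Suc k) - u k) \<le> c p * (1 / 2) ^ k"
      by metis
    define D where "D = {y \<in> points E. \<forall>p\<in>seminorms E. p y \<le> c p}"
    have scaled: "x \<in> (\<lambda>y. complex_of_real t *\<^sub>C y) ` D \<longleftrightarrow>
        x \<in> points E \<and> (\<forall>p\<in>seminorms E. p x \<le> t * c p)" if t: "t > 0" for t x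
    proof
      assume "x \<in> (\<lambda>y. complex_of_real t *\<^sub>C y) ` D"
      then show "x \<in> points E \<and> (\<forall>p\<in>seminorms E. p x \<le> t * c p)"
        using t by (auto simp: D_def scale_mem sn_scale)
    next
      assume x: "x \<in> points E \<and> (\<forall>p\<in>seminorms E. p x \<le> t * c p)"
      have "p (complex_of_real (1 / t) *\<^sub>C x) \<le> c p" if p: "p \<in> seminorms E" for p
      proof -
        have "p (complex_of_real (1 / t) *\<^sub>C x) = p x / t"
          using sn_scale[OF p, of x "complex_of_real (1 / t)"] x t by (simp add: norm_divide)
        also have "\<dots> \<le> c p"
          using x p t by (simp add: pos_divide_le_eq mult.commute)
        finally show ?thesis .
      qed
      then have "complex_of_real (1 / t) *\<^sub>C x \<in> D"
        using x scale_mem by (auto simp: D_def)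
      moreover have "x = complex_of_real t *\<^sub>C complex_of_real (1 / t) *\<^sub>C x"
        using t by (simp add: scaleC_scaleC flip: of_real_mult)
      ultimately show "x \<in> (\<lambda>y. complex_of_real t *\<^sub>C y) ` D" by blast
    qed
    have gauge_le: "gauge_of D x \<le> t"
      if "t > 0" "x \<in> points E" "\<And>p. p \<in> seminorms E \<Longrightarrow> p x \<le> t * c p" for x t
      unfolding gauge_of_def using that scaled
      by (intro cInf_lower) (auto intro: bdd_belowI[of _ 0])
    have span: "x \<in> disc_span D \<longleftrightarrow> (\<exists>n::nat. n > 0 \<and> x \<in> points E \<and> (\<forall>p\<in>seminorms E. p x \<le> real n * c p))" for x
    proof
      assume "x \<in> disc_span D"
      then obtain n y where x: "x = of_nat n *\<^sub>C y" "y \<in> D"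
        unfolding disc_span_def by auto
      show "\<exists>n::nat. n > 0 \<and> x \<in> points E \<and> (\<forall>p\<in>seminorms E. p x \<le> real n * c p)"
      proof (cases "n = 0")
        \<comment> \<open>The multiple by 0 is the zero vector, which lies in D itself; hence the
          witness 1.\<close>
        case True
        then show ?thesis
          using x c zero_mem by (intro exI[of _ 1]) (force simp: sn_zero)
      next
        case False
        then show ?thesis
          using x scaled[of "real n" x] by (intro exI[of _ n]) auto
      qed
    next
      assume "\<exists>n::nat. n > 0 \<and> x \<in> points E \<and> (\<forall>p\<in>seminorms E. p x \<le> real n * c p)"
      then obtain n :: nat where "n > 0" "x \<in> points E \<and> (\<forall>p\<in>seminorms E. p x \<le> real n * c p)" by blast
      then have "x \<in> (\<lambda>y. complex_of_real (real n) *\<^sub>C y) ` D"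
        using scaled[of "real n" x] by auto
      then show "x \<in> disc_span D" by (auto simp: disc_span_def)
    qed
    \<comment> \<open>Every t in the set whose infimum is the gauge satisfies p x \<le> t c p, and
      membership in the span makes this set nonempty.\<close>
    have sn_gauge: "p x \<le> c p * gauge_of D x" if x: "x \<in> disc_span D" and p: "p \<in> seminorms E" for p x
    proof -
      have "p x / c p \<le> gauge_of D x"
        unfolding gauge_of_def
      proof (rule cInf_greatest)
        show "{t. 0 < t \<and> x \<in> (\<lambda>y. complex_of_real t *\<^sub>C y) ` D} \<noteq> {}"
          using x unfolding span using scaled by (auto, metis of_nat_0_less_iff)
        fix t assume "t \<in> {t. 0 < t \<and> x \<in> (\<lambda>y. complex_of_real t *\<^sub>C y) ` D}"
        then show "p x / c p \<le> t"
          using scaled[of t x] p c[OF p] by (auto simp: field_simps)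
      qed
      then show ?thesis using c[OF p] by (simp add: field_simps)
    qed
    have D0: "0 \<in> D" using zero_mem c by (force simp: D_def sn_zero)
    have "closedin (lc_topology E) D"
    proof -
      have "openin (lc_topology E) (points E - D)"
      proof (subst openin_subopen, intro ballI)
        fix x assume "x \<in> points E - D"
        then obtain p where p: "p \<in> seminorms E" "x \<in> points E" "p x > c p"
          by (auto simp: D_def)
        let ?U = "{y \<in> points E. p (y - x) < p x - c p}"
        have "y \<notin> D" if "y \<in> ?U" for y
        proof -
          have "p x \<le> p y + p (x - y)"
            using sn_add[OF p(1), of y "x - y"] that p diff_mem by simp
          moreover have "p (x - y) < p x - c p"
            using that p sn_diff_commute[OF p(1), of x y] by simp
          ultimately have "c p < p y" by linarith
          then show ?thesis
            using p(1) by (auto simp: D_def not_le)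
        qed
        then show "\<exists>T. openin (lc_topology E) T \<and> x \<in> T \<and> T \<subseteq> points E - D"
          using p by (intro exI[of _ ?U]) (auto intro!: openin_lcI simp: sn_zero)
      qed
      then show ?thesis by (auto simp: closedin_def D_def)
    qed
    moreover have "lc_bounded E D"
      unfolding lc_bounded_def by (force simp: D_def intro: bdd_aboveI2)
    moreover have "absolutely_convex D"
      unfolding absolutely_convex_def
    proof (intro conjI ballI allI impI)
      fix x y a b assume xy: "x \<in> D" "y \<in> D" and ab: "norm (a::complex) + norm (b::complex) \<le> 1"
      have "p (a *\<^sub>C x + b *\<^sub>C y) \<le> c p" if p: "p \<in> seminorms E" for p
      proof -
        have "p (a *\<^sub>C x + b *\<^sub>C y) \<le> norm a * p x + norm b * p y"
          using sn_add[OF p, of "a *\<^sub>C x" "b *\<^sub>C y"] xy p by (simp add: D_def scale_mem sn_scale)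
        also have "\<dots> \<le> norm a * c p + norm b * c p"
          using xy p by (intro add_mono mult_left_mono) (auto simp: D_def)
        also have "\<dots> \<le> 1 * c p"
          unfolding distrib_right[symmetric] using ab c[OF p] by (intro mult_right_mono) auto
        finally show ?thesis by simp
      qed
      then show "a *\<^sub>C x + b *\<^sub>C y \<in> D"
        using xy by (simp add: D_def add_mem scale_mem)
    qed (use D0 in auto)
    ultimately have complete: "\<And>v :: nat \<Rightarrow> 'a. (\<forall>n. v n \<in> disc_span D) \<Longrightarrow>
        (\<forall>e>0. \<exists>N. \<forall>m\<ge>N. \<forall>n\<ge>N. gauge_of D (v m - v n) < e) \<Longrightarrow>
        (\<exists>l\<in>disc_span D. (\<lambda>n. gauge_of D (v n - l)) \<longlonglongrightarrow> 0)"
      using assms(2) unfolding locally_complete_def by blast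
    have diff: "p (u m - u n) \<le> 2 * (1 / 2) ^ N * c p"
      if "p \<in> seminorms E" "N \<le> m" "N \<le> n" for p m n N
    proof -
      have *: "p (u m - u n) \<le> 2 * (1 / 2) ^ N * c p" if "N \<le> n" "n \<le> m" for m n
      proof -
        have "p (u m - u n) \<le> 2 * c p * ((1 / 2) ^ n - (1 / 2) ^ m)"
          by (rule fast_Cauchy_diff[OF u]) (use that \<open>p \<in> seminorms E\<close> ck in auto)
        also have "\<dots> \<le> 2 * c p * (1 / 2) ^ N"
        proof (rule mult_left_mono)
          have "(1 / 2 :: real) ^ n \<le> (1 / 2) ^ N"
            using that by (intro power_decreasing) auto
          moreover have "(0 :: real) \<le> (1 / 2) ^ m" by simp
          ultimately show "(1 / 2 :: real) ^ n - (1 / 2) ^ m \<le> (1 / 2) ^ N" by linarith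
        qed (use c[OF \<open>p \<in> seminorms E\<close>] in simp)
        finally show ?thesis by (simp add: mult_ac)
      qed
      show ?thesis
        using *[of n m] *[of m n] that sn_diff_commute[OF that(1) u u, of m n] by (cases "n \<le> m") auto
    qed
    \<comment> \<open>The factor 3 consists of 2 from the geometric sum of the increments and 1 from
      u 0.\<close>
    have "u n \<in> disc_span D" for n
      unfolding span
    proof (intro exI[of _ 3] conjI ballI u)
      fix p assume p: "p \<in> seminorms E"
      have "p (u n) \<le> p (u n - u 0) + p (u 0)"
        using sn_add[OF p, of "u n - u 0" "u 0"] u diff_mem by simp
      also have "\<dots> \<le> 2 * c p + c p"
        using diff[OF p, of 0 n 0] c0[OF p] by simp
      finally show "p (u n) \<le> real 3 * c p" by simp
    qed simp
    moreover have "\<exists>N. \<forall>m\<ge>N. \<forall>n\<ge>N. gauge_of D (u m - u n) < e" if "e > 0" for e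
    proof -
      have "(\<lambda>N. 2 * (1 / 2) ^ N :: real) \<longlonglongrightarrow> 2 * 0"
        by (intro tendsto_mult tendsto_const LIMSEQ_power_zero) auto
      then have "\<forall>\<^sub>F N in sequentially. 2 * (1 / 2) ^ N < e"
        using that by (auto simp: order_tendsto_iff)
      then obtain N where N: "2 * (1 / 2) ^ N < e"
        by (auto simp: eventually_sequentially)
      have "gauge_of D (u m - u n) < e" if "m \<ge> N" "n \<ge> N" for m n
        using gauge_le[of "2 * (1 / 2) ^ N" "u m - u n"] diff that u diff_mem N by fastforce
      then show ?thesis by blast
    qed
    ultimately obtain l where l: "l \<in> disc_span D" "(\<lambda>n. gauge_of D (u n - l)) \<longlonglongrightarrow> 0"
      using complete[of u] by blast
    have lE: "l \<in> points E" using l span by blast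
    \<comment> \<open>\<open>sn_gauge\<close> speaks of elements of the span only. A difference of
      members of a D and b D lies in (a + b) D.\<close>
    have mem: "u n - l \<in> disc_span D" for n
    proof -
      obtain a b where ab: "a > (0::nat)" "\<forall>p\<in>seminorms E. p (u n) \<le> real a * c p"
        "\<forall>p\<in>seminorms E. p l \<le> real b * c p"
        using \<open>u n \<in> disc_span D\<close> l(1) unfolding span by blast
      have "p (u n - l) \<le> real (a + b) * c p" if p: "p \<in> seminorms E" for p
        using sn_diff[OF p u lE, of n] ab p by (force simp: distrib_right)
      then show ?thesis
        unfolding span using ab u lE by (intro exI[of _ "a + b"]) (auto intro: diff_mem)
    qed
    have "limitin (lc_topology E) u l sequentially"
    proof (rule limitin_lcI)
      fix p assume p: "p \<in> seminorms E"
      show "(\<lambda>k. p (u k - l)) \<longlonglongrightarrow> 0"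
      proof (rule tendsto_sandwich[where f = "\<lambda>_. 0" and h = "\<lambda>n. c p * gauge_of D (u n - l)"])
        show "\<forall>\<^sub>F n in sequentially. p (u n - l) \<le> c p * gauge_of D (u n - l)"
          using sn_gauge[OF mem p] by simp
        show "(\<lambda>n. c p * gauge_of D (u n - l)) \<longlonglongrightarrow> 0"
          using tendsto_mult[OF tendsto_const l(2), of "c p"] by simp
        show "\<forall>\<^sub>F n in sequentially. 0 \<le> p (u n - l)"
          by (intro always_eventually allI sn_nonneg[OF p] diff_mem u lE)
      qed simp
    qed (use lE u in auto)
    then show "\<exists>l. limitin (lc_topology E) u l sequentially" by blast
  qed
qed

text \<open>The scalar case makes all results on \<open>lc_complete\<close> available for test
  functions. The increments form a summable series, whose partial sums telescope.\<close>

lemma lc_complete_scalar: "lc_complete scalar_lcs"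
proof -
  interpret lc_space scalar_lcs by (rule lc_space_scalar)
  show ?thesis
  proof
    fix u :: "nat \<Rightarrow> complex"
    assume "\<And>p. p \<in> seminorms scalar_lcs \<Longrightarrow> \<exists>C. \<forall>k. p (u (Suc k) - u k) \<le> C * (1 / 2) ^ k"
    then obtain C where C: "\<And>k. norm (u (Suc k) - u k) \<le> C * (1 / 2) ^ k" by auto
    have "summable (\<lambda>k. C * (1 / 2) ^ k)"
      by (intro summable_mult summable_geometric) simp
    then have "summable (\<lambda>k. u (Suc k) - u k)"
      by (rule summable_comparison_test'[where N = 0]) (rule C)
    then have "convergent (\<lambda>n. \<Sum>k<n. u (Suc k) - u k)"
      by (simp add: summable_iff_convergent)
    then have "convergent (\<lambda>n. u n - u 0)"
      by (simp add: sum_lessThan_telescope)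
    then have "convergent u"
      using convergent_diff_const_right_iff by blast
    then show "\<exists>l. limitin (lc_topology scalar_lcs) u l sequentially"
      by (auto simp: convergent_def lc_topology_scalar)
  qed auto
qed

section \<open>Scalar periodic functions\<close>

definition torus_char :: "int^'d::finite \<Rightarrow> real^'d \<Rightarrow> complex" where
  "torus_char n x = exp (\<i> * complex_of_real (real_vec n \<bullet> x))"

definition cube :: "(real^'d::finite) set" where
  "cube = cbox (\<chi> i. - pi) (\<chi> i. pi)"

definition torus_mean :: "(real^'d::finite \<Rightarrow> complex) \<Rightarrow> complex" where
  "torus_mean g = complex_of_real (1 / (2 * pi) ^ CARD('d)) * integral cube g"

lemma real_vec_add: "real_vec (m + n) = real_vec m + real_vec n"
  and real_vec_minus: "real_vec (- n) = - real_vec n"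
  and real_vec_zero [simp]: "real_vec 0 = 0"
  and real_vec_nth [simp]: "real_vec n $ i = of_int (n $ i)"
  by (simp_all add: real_vec_def vec_eq_iff)

lemma real_vec_inner_axis: "real_vec n \<bullet> axis i h = of_int (n $ i) * h"
  by (simp add: inner_axis)

lemma norm_torus_char [simp]: "norm (torus_char n x) = 1"
  and torus_char_at_0 [simp]: "torus_char n 0 = 1"
  and torus_char_zero [simp]: "torus_char 0 x = 1"
  and torus_char_add: "torus_char (m + n) x = torus_char m x * torus_char n x"
  and torus_char_add_right: "torus_char n (x + y) = torus_char n x * torus_char n y"
  by (simp_all add: torus_char_def real_vec_add inner_add_left inner_add_right distrib_left exp_add)

lemma torus_char_axis: "torus_char n (axis i h) = exp (\<i> * complex_of_real (of_int (n $ i) * h))"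
  by (simp only: torus_char_def real_vec_inner_axis)

lemma torus_char_periodic: "torus_char n (x + axis i (2 * pi)) = torus_char n x"
proof -
  have "torus_char n (axis i (2 * pi)) = exp (2 * of_int (n $ i) * of_real pi * \<i>)"
    by (simp add: torus_char_axis mult_ac)
  also have "\<dots> = 1"
    by (auto simp: exp_eq_1)
  finally show ?thesis by (simp add: torus_char_add_right)
qed

lemma continuous_on_torus_char [continuous_intros]: "continuous_on S (torus_char n)"
  unfolding torus_char_def by (intro continuous_intros)

lemma torus_char_minus: "torus_char (- n) x = exp (- (\<i> * complex_of_real (real_vec n \<bullet> x)))"
  by (simp add: torus_char_def real_vec_minus)

text \<open>Division by a character reduces the difference to |exp(it) - 1| = 2 |sin(t/2)| \<le>
  |t|, with t the scalar product of n and x - y.\<close>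

lemma torus_char_lipschitz: "norm (torus_char n x - torus_char n y) \<le> norm (real_vec n) * norm (x - y)"
proof -
  have "torus_char n x - torus_char n y = torus_char n y * (torus_char n (x - y) - 1)"
    using torus_char_add_right[of n y "x - y"] by (simp add: algebra_simps)
  then have "norm (torus_char n x - torus_char n y) = norm (torus_char n (x - y) - 1)"
    by (simp add: norm_mult)
  also have "\<dots> \<le> \<bar>real_vec n \<bullet> (x - y)\<bar>"
    unfolding torus_char_def using dist_exp_i_1[of "real_vec n \<bullet> (x - y)"] abs_sin_x_le_abs_x[of "(real_vec n \<bullet> (x - y)) / 2"]
    by simp
  also have "\<dots> \<le> norm (real_vec n) * norm (x - y)"
    by (rule Cauchy_Schwarz_ineq2)
  finally show ?thesis .
qed

section \<open>Means over the cube of periods\<close>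

lemma mem_cube: "x \<in> cube \<longleftrightarrow> (\<forall>i. - pi \<le> x $ i \<and> x $ i \<le> pi)"
  by (simp add: cube_def mem_box_cart)

lemma compact_cube: "compact cube"
  by (simp add: cube_def)

lemma content_cube: "measure lborel (cube :: (real^'d) set) = (2 * pi) ^ CARD('d)"
proof -
  have "(\<chi> i. - pi) \<in> (cube :: (real^'d) set)"
    by (simp add: mem_cube)
  then show ?thesis
    unfolding cube_def by (subst content_cbox_cart) auto
qed

lemma integrable_on_cube: "continuous_on UNIV g \<Longrightarrow> g integrable_on cube"
  for g :: "real^'d \<Rightarrow> complex"
  unfolding cube_def by (intro integrable_continuous) (auto intro: continuous_on_subset)

lemma set_integrable_cube: "continuous_on UNIV g \<Longrightarrow> set_integrable lborel cube g"
  for g :: "real^'d \<Rightarrow> complex"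
  unfolding set_integrable_def cube_def
  by (intro borel_integrable_compact) (auto intro: continuous_on_subset)

lemma LINT_cube: "continuous_on UNIV g \<Longrightarrow> (LINT x : cube | lborel. g x) = integral cube g"
  for g :: "real^'d \<Rightarrow> complex"
  by (rule set_borel_integral_eq_integral(2)[OF set_integrable_cube])

lemma torus_mean_add:
  "continuous_on UNIV f \<Longrightarrow> continuous_on UNIV g \<Longrightarrow>
    torus_mean (\<lambda>x. f x + g x) = torus_mean f + torus_mean g"
  by (simp add: torus_mean_def integral_add integrable_on_cube distrib_left)

lemma torus_mean_diff:
  "continuous_on UNIV f \<Longrightarrow> continuous_on UNIV g \<Longrightarrow>
    torus_mean (\<lambda>x. f x - g x) = torus_mean f - torus_mean g"
  by (simp add: torus_mean_def integral_diff integrable_on_cube right_diff_distrib)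

lemma torus_mean_cmult: "torus_mean (\<lambda>x. c * f x) = c * torus_mean f"
  by (simp add: torus_mean_def)

lemma torus_mean_sum:
  assumes "\<And>i. i \<in> A \<Longrightarrow> continuous_on UNIV (f i)"
  shows "torus_mean (\<lambda>x. \<Sum>i\<in>A. f i x) = (\<Sum>i\<in>A. torus_mean (f i))"
  using assms
proof (induction A rule: infinite_finite_induct)
  case (insert a A)
  then show ?case
    by (simp add: torus_mean_add continuous_on_sum)
qed (simp_all add: torus_mean_def)

lemma norm_torus_mean_le:
  fixes g :: "real^'d \<Rightarrow> complex"
  assumes "continuous_on UNIV g" "\<And>x. x \<in> cube \<Longrightarrow> norm (g x) \<le> B"
  shows "norm (torus_mean g) \<le> B"
proof -
  have "(0 :: real^'d) \<in> cube" by (simp add: mem_cube)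
  then have "0 \<le> B" using assms(2) norm_ge_zero order_trans by blast
  then have "norm (integral cube g) \<le> B * measure lborel (cube :: (real^'d) set)"
    unfolding cube_def
    by (intro has_integral_bound[OF _ integrable_integral])
      (use assms integrable_on_cube in \<open>auto simp: cube_def\<close>)
  then show ?thesis
    by (simp add: torus_mean_def norm_mult norm_divide norm_power content_cube field_simps)
qed

text \<open>Only the edge in direction i moves. The slab that leaves the cube beyond pi is brought
  back by one period; h between 0 and 2 pi keeps the cutting points in order.\<close>

lemma integral_cube_shift:
  fixes g :: "real^'d \<Rightarrow> complex"
  assumes cont: "continuous_on UNIV g" and per: "\<And>x. g (x + axis i (2 * pi)) = g x"
    and h: "0 \<le> h" "h \<le> 2 * pi"
  shows "integral cube (\<lambda>x. g (x + axis i h)) = integral cube g"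
proof -
  define box where "box s t = cbox (\<chi> j. if j = i then s else - pi) (\<chi> j. if j = i then t else pi)"
    for s t :: real
  have int: "g integrable_on box s t" for s t
    unfolding box_def using cont by (intro integrable_continuous) (auto intro: continuous_on_subset)
  have split: "integral (box s t) g = integral (box s c) g + integral (box c t) g"
    if "s \<le> c" "c \<le> t" for s c t
  proof (rule integral_unique, unfold box_def, rule has_integral_split[of _ _ _ _ "axis i 1" c])
    have mem: "x \<in> box s t \<longleftrightarrow> s \<le> x $ i \<and> x $ i \<le> t \<and> (\<forall>j. j \<noteq> i \<longrightarrow> - pi \<le> x $ j \<and> x $ j \<le> pi)"
      for x s t by (auto simp: box_def mem_box_cart)
    have "box s t \<inter> {x. x \<bullet> axis i 1 \<le> c} = box s c"
      using that by (auto simp: mem inner_axis)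
    moreover have "box s t \<inter> {x. x \<bullet> axis i 1 \<ge> c} = box c t"
      using that by (auto simp: mem inner_axis)
    ultimately show "(g has_integral integral (cbox (\<chi> j. if j = i then s else - pi) (\<chi> j. if j = i then c else pi)) g)
        (cbox (\<chi> j. if j = i then s else - pi) (\<chi> j. if j = i then t else pi) \<inter> {x. x \<bullet> axis i 1 \<le> c})"
      "(g has_integral integral (cbox (\<chi> j. if j = i then c else - pi) (\<chi> j. if j = i then t else pi)) g)
        (cbox (\<chi> j. if j = i then s else - pi) (\<chi> j. if j = i then t else pi) \<inter> {x. x \<bullet> axis i 1 \<ge> c})"
      using int unfolding box_def by (metis integrable_integral)+
  qed (simp add: axis_in_Basis_iff)
  have shift: "integral (box s t) (\<lambda>x. g (x + axis i r)) = integral (box (s + r) (t + r)) g" for s t r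
  proof -
    have "cbox ((\<chi> j. if j = i then s else - pi) + axis i r) ((\<chi> j. if j = i then t else pi) + axis i r)
        = box (s + r) (t + r)"
      unfolding box_def by (rule arg_cong2[where f = cbox]) (auto simp: vec_eq_iff axis_def)
    moreover have "(g has_integral integral (box (s + r) (t + r)) g) (box (s + r) (t + r))"
      using int by blast
    ultimately have "((g \<circ> ((+) (axis i r))) has_integral integral (box (s + r) (t + r)) g) (box s t)"
      unfolding box_def by (subst has_integral_shift_cbox_iff) simp
    then show ?thesis
      by (auto simp: o_def add.commute dest: integral_unique)
  qed
  have cube: "cube = box (- pi) pi"
    unfolding box_def cube_def by (rule arg_cong2[where f = cbox]) (auto simp: vec_eq_iff)
  have "integral cube (\<lambda>x. g (x + axis i h)) = integral (box (- pi + h) (pi + h)) g"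
    unfolding cube by (rule shift)
  also have "\<dots> = integral (box (- pi + h) pi) g + integral (box pi (pi + h)) g"
    using h by (intro split) auto
  also have "integral (box pi (pi + h)) g = integral (box (- pi) (- pi + h)) g"
  proof -
    have "- pi + 2 * pi = pi" "- pi + h + 2 * pi = pi + h" by simp_all
    then show ?thesis
      using shift[of "- pi" "- pi + h" "2 * pi"] by (simp only: per)
  qed
  also have "integral (box (- pi + h) pi) g + \<dots> = integral cube g"
    unfolding cube using h split[of "- pi" "- pi + h" pi] by simp
  finally show ?thesis .
qed

text \<open>With v the vector of length h along axis i, e_(-n)(x) = e_n(v) e_(-n)(x + v). The
  integrand is therefore the phase e_n(v) times a translate of f e_(-n).\<close>

lemma torus_mean_char_shift:
  assumes cont: "continuous_on UNIV f" and per: "\<And>x. f (x + axis i (2 * pi)) = f x"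
    and h: "0 \<le> h" "h \<le> 2 * pi"
  shows "torus_mean (\<lambda>x. f (x + axis i h) * torus_char (- n) x)
    = exp (\<i> * complex_of_real (of_int (n $ i) * h)) * torus_mean (\<lambda>x. f x * torus_char (- n) x)"
proof -
  let ?g = "\<lambda>x. f x * torus_char (- n) x"
  have "torus_char n (axis i h) * torus_char (- n) (axis i h) = 1"
    by (simp flip: torus_char_add)
  then have "f (x + axis i h) * torus_char (- n) x = torus_char n (axis i h) * ?g (x + axis i h)" for x
    by (simp add: torus_char_add_right mult_ac)
  then have "integral cube (\<lambda>x. f (x + axis i h) * torus_char (- n) x)
      = torus_char n (axis i h) * integral cube (\<lambda>x. ?g (x + axis i h))"
    by (simp only: integral_mult_right)
  also have "integral cube (\<lambda>x. ?g (x + axis i h)) = integral cube ?g"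
    by (rule integral_cube_shift) (auto intro!: continuous_intros cont simp: per torus_char_periodic h)
  finally show ?thesis
    by (simp add: torus_mean_def torus_char_axis)
qed

lemma torus_mean_char: "torus_mean (torus_char n) = (if n = 0 then 1 else 0)"
proof (cases "n = 0")
  case True
  then have "torus_char n = (\<lambda>_. 1)" by auto
  moreover have "integral (cube :: (real^'a) set) (\<lambda>_. 1 :: complex) = (2 * pi) ^ CARD('a)"
    using content_cube[where 'd='a] unfolding cube_def by (subst integral_const) (simp add: scaleR_conv_of_real)
  ultimately show ?thesis
    using True by (simp add: torus_mean_def)
next
  case False
  then obtain i where i: "n $ i \<noteq> 0" by (auto simp: vec_eq_iff)
  \<comment> \<open>Half a period of the character in direction i: the phase becomes -1, and the
    mean equals its own negative.\<close>
  define h where "h = pi / \<bar>of_int (n $ i)\<bar>"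
  have "1 \<le> \<bar>real_of_int (n $ i)\<bar>" using i by linarith
  then have h: "0 \<le> h" "h \<le> 2 * pi"
    by (auto simp: h_def divide_le_eq intro: order_trans[of _ "2 * pi * 1"])
  have "exp (\<i> * complex_of_real (of_int (- n $ i) * h)) = - 1"
  proof -
    have "of_int (- n $ i) * h = pi \<or> of_int (- n $ i) * h = - pi"
      using i by (auto simp: h_def abs_if)
    then show ?thesis
    proof (elim disjE)
      assume eq: "of_int (- n $ i) * h = pi"
      show ?thesis unfolding eq by simp
    next
      assume eq: "of_int (- n $ i) * h = - pi"
      show ?thesis unfolding eq by (simp add: exp_minus)
    qed
  qed
  \<comment> \<open>The constant function and the index -n turn the shift rule into a statement on
    e_n itself.\<close>
  moreover have "torus_mean (\<lambda>x. 1 * torus_char (- (- n)) x)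
      = exp (\<i> * complex_of_real (of_int (- n $ i) * h)) * torus_mean (\<lambda>x. 1 * torus_char (- (- n)) x)"
    using torus_mean_char_shift[of "\<lambda>_. 1" i h "- n"] h by simp
  ultimately have "torus_mean (torus_char n) = - torus_mean (torus_char n)"
    by simp
  then show ?thesis using False by simp
qed

subsection \<open>Partial derivatives and Lipschitz bounds\<close>

text \<open>Connects the difference quotients to vector derivatives along a coordinate line, where
  the mean value inequality is available.\<close>

lemma has_partial_scalar:
  "has_partial scalar_lcs i f x y \<longleftrightarrow>
    ((\<lambda>h. f (x + h *\<^sub>R axis i 1)) has_vector_derivative y) (at 0)"
proof -
  have "has_partial scalar_lcs i f x y \<longleftrightarrow>
      ((\<lambda>h. norm ((f (x + h *\<^sub>R axis i 1) - f x) / complex_of_real h - y)) \<longlongrightarrow> 0) (at 0)"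
    unfolding has_partial_def lc_topology_scalar
    by (simp add: scaleC_complex_def tendsto_norm_zero_iff LIM_zero_iff)
  also have "\<dots> \<longleftrightarrow>
      ((\<lambda>h. norm (f (x + h *\<^sub>R axis i 1) - f x - h *\<^sub>R y) / norm h) \<longlongrightarrow> 0) (at 0)"
  proof (rule tendsto_cong)
    have "norm ((f (x + h *\<^sub>R axis i 1) - f x) / complex_of_real h - y)
        = norm (f (x + h *\<^sub>R axis i 1) - f x - h *\<^sub>R y) / norm h" if "h \<noteq> 0" for h
    proof -
      have "(f (x + h *\<^sub>R axis i 1) - f x) / complex_of_real h - y
          = (f (x + h *\<^sub>R axis i 1) - f x - h *\<^sub>R y) / complex_of_real h"
        using that by (simp add: field_simps scaleR_conv_of_real)
      then show ?thesis by (simp add: norm_divide)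
    qed
    then show "\<forall>\<^sub>F h in at 0. norm ((f (x + h *\<^sub>R axis i 1) - f x) / complex_of_real h - y)
        = norm (f (x + h *\<^sub>R axis i 1) - f x - h *\<^sub>R y) / norm h"
      by (simp add: eventually_at_filter)
  qed
  finally show ?thesis
    by (simp add: has_vector_derivative_def has_derivative_at bounded_linear_scaleR_left)
qed

lemma has_partial_scalarD:
  assumes "has_partial scalar_lcs i f (x + t *\<^sub>R axis i 1) y"
  shows "((\<lambda>h. f (x + h *\<^sub>R axis i 1)) has_vector_derivative y) (at t)"
proof -
  have *: "((\<lambda>h. f (x + (t + h) *\<^sub>R axis i 1)) has_vector_derivative y) (at 0)"
    using assms unfolding has_partial_scalar by (simp add: algebra_simps)
  have "((\<lambda>s. s - t) has_real_derivative 1) (at t)"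
    by (auto intro!: derivative_eq_intros)
  then have "((\<lambda>h. f (x + (t + h) *\<^sub>R axis i 1)) \<circ> (\<lambda>s. s - t) has_vector_derivative 1 *\<^sub>R y) (at t)"
    by (intro vector_diff_chain_at) (use * in \<open>auto simp: has_real_derivative_iff_has_vector_derivative\<close>)
  then show ?thesis by (simp add: o_def)
qed

lemma has_partial_torus_char:
  "has_partial scalar_lcs i (torus_char n) x (\<i> * of_int (n $ i) * torus_char n x)"
proof -
  let ?a = "\<i> * of_int (n $ i) :: complex"
  have "torus_char n (x + h *\<^sub>R axis i 1) = torus_char n x * exp (h *\<^sub>R ?a)" for h
  proof -
    have "real_vec n \<bullet> (x + h *\<^sub>R axis i 1) = real_vec n \<bullet> x + h * of_int (n $ i)"
      by (simp add: inner_add_right real_vec_inner_axis)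
    then show ?thesis
      by (simp add: torus_char_def scaleR_conv_of_real distrib_left exp_add mult_ac)
  qed
  moreover have "((\<lambda>h. torus_char n x * exp (h *\<^sub>R ?a)) has_vector_derivative
      torus_char n x * (exp (0 *\<^sub>R ?a) * ?a)) (at 0)"
    by (intro has_vector_derivative_mult_right exp_scaleR_has_vector_derivative_right)
  ultimately show ?thesis
    unfolding has_partial_scalar by (simp add: mult_ac)
qed

lemma axis_difference_bound:
  assumes "\<And>t. t \<in> closed_segment 0 h \<Longrightarrow> has_partial scalar_lcs i f (x + t *\<^sub>R axis i 1) (g t)"
    "\<And>t. t \<in> closed_segment 0 h \<Longrightarrow> norm (g t) \<le> B"
  shows "norm (f (x + h *\<^sub>R axis i 1) - f x) \<le> B * \<bar>h\<bar>"
proof -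
  have "norm ((\<lambda>t. f (x + t *\<^sub>R axis i 1)) h - (\<lambda>t. f (x + t *\<^sub>R axis i 1)) 0) \<le> B * norm (h - 0)"
  proof (rule differentiable_bound[OF convex_closed_segment[of 0 h], where f' = "\<lambda>t s. s *\<^sub>R g t"])
    fix t assume t: "t \<in> closed_segment 0 h"
    show "((\<lambda>t. f (x + t *\<^sub>R axis i 1)) has_derivative (\<lambda>s. s *\<^sub>R g t)) (at t within closed_segment 0 h)"
      using has_partial_scalarD[OF assms(1)[OF t]] unfolding has_vector_derivative_def
      by (rule has_derivative_at_withinI)
    have "onorm (\<lambda>s :: real. s *\<^sub>R g t) = norm (g t)"
      using onorm_scaleR_left[of "\<lambda>x :: real. x" "g t"] bounded_linear_ident by (simp add: onorm_id id_def)
    then show "onorm (\<lambda>s. s *\<^sub>R g t) \<le> B"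
      using assms(2)[OF t] by simp
  qed auto
  then show ?thesis by simp
qed

text \<open>Moving one coordinate at a time keeps the path inside the box.\<close>

lemma box_lipschitz:
  fixes f :: "real^'d \<Rightarrow> complex"
  assumes part: "\<And>i z. z \<in> cbox a b \<Longrightarrow> has_partial scalar_lcs i f z (g i z)"
    and bound: "\<And>i z. z \<in> cbox a b \<Longrightarrow> norm (g i z) \<le> B"
    and x: "x \<in> cbox a b" and y: "y \<in> cbox a b"
  shows "norm (f x - f y) \<le> B * (\<Sum>i\<in>UNIV. \<bar>x $ i - y $ i\<bar>)"
proof -
  define z where "z S = (\<chi> i. if i \<in> S then x $ i else y $ i)" for S
  have "norm (f (z S) - f y) \<le> B * (\<Sum>i\<in>S. \<bar>x $ i - y $ i\<bar>)" for S
  proof (induction S rule: infinite_finite_induct)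
    case (infinite A)
    then show ?case by simp
  next
    case empty
    then show ?case by (simp add: z_def)
  next
    case (insert i S)
    have zi: "z (insert i S) = z S + (x $ i - y $ i) *\<^sub>R axis i 1"
      using insert.hyps by (auto simp: z_def vec_eq_iff axis_def)
    have seg: "z S + t *\<^sub>R axis i 1 \<in> cbox a b" if t: "t \<in> closed_segment 0 (x $ i - y $ i)" for t
    proof -
      have "(z S + t *\<^sub>R axis i 1) $ j \<in> {a $ j..b $ j}" for j
      proof (cases "j = i")
        case True
        have "y $ i + t \<in> {a $ i..b $ i}"
          using t x y by (auto simp: closed_segment_eq_real_ivl mem_box_cart split: if_splits)
            (smt (verit))+
        then show ?thesis using True insert.hyps by (simp add: z_def)
      next
        case False
        then show ?thesis using x y by (auto simp: z_def mem_box_cart axis_def)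
      qed
      then show ?thesis by (simp add: mem_box_cart)
    qed
    have "norm (f (z (insert i S)) - f (z S)) \<le> B * \<bar>x $ i - y $ i\<bar>"
      unfolding zi by (rule axis_difference_bound[OF part bound]) (use seg in auto)
    moreover have "norm (f (z (insert i S)) - f y)
        \<le> norm (f (z (insert i S)) - f (z S)) + norm (f (z S) - f y)"
      using norm_triangle_ineq[of "f (z (insert i S)) - f (z S)" "f (z S) - f y"] by simp
    ultimately show ?case
      using insert by (simp add: distrib_left)
  qed
  from this[of UNIV] show ?thesis by (simp add: z_def)
qed

text \<open>Integration by parts through difference quotients: their means are computed from
  translation invariance, the limit of these means by dominated convergence.\<close>

lemma torus_mean_partial:
  fixes f :: "real^'d \<Rightarrow> complex"
  assumes f: "continuous_on UNIV f" and g: "continuous_on UNIV g"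
    and per: "\<And>x. f (x + axis i (2 * pi)) = f x"
    and part: "\<And>x. has_partial scalar_lcs i f x (g x)"
  shows "torus_mean (\<lambda>x. g x * torus_char (- n) x)
    = \<i> * of_int (n $ i) * torus_mean (\<lambda>x. f x * torus_char (- n) x)"
proof -
  let ?A = "torus_mean (\<lambda>x. f x * torus_char (- n) x)"
  let ?e = "axis i 1 :: real^'d"
  \<comment> \<open>All steps are at most 1, hence admissible shifts, and x + t e_i stays in the box
    ?K below for x in the cube and 0 \<le> t \<le> h k.\<close>
  define h where "h k = 1 / real (Suc k)" for k
  have h: "0 < h k" "h k \<le> 1" for k by (auto simp: h_def)
  have h0: "filterlim h (at 0) sequentially"
    unfolding filterlim_at
  proof
    show "\<forall>\<^sub>F k in sequentially. h k \<in> UNIV \<and> h k \<noteq> 0"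
      using h(1) by (auto simp: less_le)
    show "h \<longlonglongrightarrow> 0"
      unfolding h_def using LIMSEQ_inverse_real_of_nat by (simp only: inverse_eq_divide)
  qed
  define q where "q k x = (f (x + axis i (h k)) - f x) / h k * torus_char (- n) x" for k x
  have ax: "axis i c = c *\<^sub>R ?e" for c :: real
    by (auto simp: vec_eq_iff axis_def)
  have cont_q: "continuous_on UNIV (q k)" for k
    unfolding q_def using h(1)[of k] less_imp_neq[OF h(1)]
    by (intro continuous_intros continuous_on_compose2[OF f]) auto
  have "torus_mean (q k) = (exp (\<i> * of_real (of_int (n $ i) * h k)) - 1) / h k * ?A" for k
  proof -
    have "torus_mean (q k) = torus_mean (\<lambda>x. (1 / h k) *
        (f (x + axis i (h k)) * torus_char (- n) x - f x * torus_char (- n) x))"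
      unfolding q_def by (simp add: algebra_simps diff_divide_distrib)
    also have "\<dots> = (1 / h k) * (torus_mean (\<lambda>x. f (x + axis i (h k)) * torus_char (- n) x) - ?A)"
      by (subst torus_mean_cmult, subst torus_mean_diff)
        (auto intro!: continuous_intros continuous_on_compose2[OF f] f)
    also have "torus_mean (\<lambda>x. f (x + axis i (h k)) * torus_char (- n) x)
        = exp (\<i> * of_real (of_int (n $ i) * h k)) * ?A"
      using h[of k] pi_gt3 by (intro torus_mean_char_shift f per) auto
    finally show ?thesis by (simp add: algebra_simps diff_divide_distrib)
  qed
  moreover have "(\<lambda>k. (exp (\<i> * of_real (of_int (n $ i) * h k)) - 1) / h k * ?A)
      \<longlonglongrightarrow> \<i> * of_int (n $ i) * ?A"
  proof (intro tendsto_mult tendsto_const)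
    \<comment> \<open>The factor is the difference quotient of e_n at 0 in direction i.\<close>
    have "((\<lambda>t. (torus_char n (t *\<^sub>R ?e) - 1) / complex_of_real t) \<longlongrightarrow> \<i> * of_int (n $ i)) (at (0::real))"
      using has_partial_torus_char[of i n 0] unfolding has_partial_def lc_topology_scalar
      by (simp add: scaleC_complex_def)
    from filterlim_compose[OF this h0]
    show "(\<lambda>k. (exp (\<i> * of_real (of_int (n $ i) * h k)) - 1) / h k) \<longlonglongrightarrow> \<i> * of_int (n $ i)"
      unfolding ax[symmetric] torus_char_axis .
  qed
  ultimately have lim1: "(\<lambda>k. torus_mean (q k)) \<longlonglongrightarrow> \<i> * of_int (n $ i) * ?A"
    by simp
  let ?K = "cbox (\<chi> i. - pi) (\<chi> i. pi + 1) :: (real^'d) set"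
  have "compact (g ` ?K)"
    by (intro compact_continuous_image continuous_on_subset[OF g]) auto
  then obtain B where B: "\<And>x. x \<in> ?K \<Longrightarrow> norm (g x) \<le> B"
    using compact_imp_bounded bounded_iff by (metis imageI)
  have "(\<lambda>k. integral cube (q k)) \<longlonglongrightarrow> integral cube (\<lambda>x. g x * torus_char (- n) x)"
  proof (rule dominated_convergence(2))
    show "q k integrable_on cube" for k by (rule integrable_on_cube[OF cont_q])
    show "(\<lambda>_. B) integrable_on (cube :: (real^'d) set)" unfolding cube_def by (rule integrable_const)
    fix x :: "real^'d" assume x: "x \<in> cube"
    show "norm (q k x) \<le> B" for k
    proof -
      have "norm (f (x + h k *\<^sub>R ?e) - f x) \<le> B * \<bar>h k\<bar>"
      proof (rule axis_difference_bound[OF part B])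
        fix t assume "t \<in> closed_segment 0 (h k)"
        then have "0 \<le> t" "t \<le> 1" using h[of k] by (auto simp: closed_segment_eq_real_ivl)
        then show "x + t *\<^sub>R ?e \<in> ?K"
          using x by (auto simp: mem_cube mem_box_cart axis_def intro: order_trans add_increasing2 add_mono)
      qed
      then show ?thesis
        using h[of k] by (simp add: q_def norm_mult norm_divide ax[of "h k"] divide_le_eq)
    qed
    have "((\<lambda>t. (f (x + t *\<^sub>R ?e) - f x) / complex_of_real t) \<longlongrightarrow> g x) (at (0::real))"
      using part[of x] unfolding has_partial_def lc_topology_scalar by (simp add: scaleC_complex_def)
    from filterlim_compose[OF this h0]
    show "(\<lambda>k. q k x) \<longlonglongrightarrow> g x * torus_char (- n) x"
      unfolding q_def ax[of "h _"] by (intro tendsto_mult tendsto_const)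
  qed
  then have "(\<lambda>k. torus_mean (q k)) \<longlonglongrightarrow> torus_mean (\<lambda>x. g x * torus_char (- n) x)"
    unfolding torus_mean_def by (intro tendsto_mult tendsto_const)
  then show ?thesis
    using lim1 LIMSEQ_unique by blast
qed

subsection \<open>Dyadic Riemann sums\<close>

definition dyadic :: "nat \<Rightarrow> real^'d::finite \<Rightarrow> real^'d" where
  "dyadic k x = (\<chi> i. of_int \<lfloor>2 ^ k * x $ i\<rfloor> / 2 ^ k)"

definition grid :: "nat \<Rightarrow> (real^'d::finite) set" where
  "grid k = dyadic k ` cube"

text \<open>Cells that stick out of the cube are cut down to it. Hence the Riemann sum is exactly
  the mean of the step function g (dyadic k x), although the side 2 pi is not a multiple of the
  mesh.\<close>

definition weight :: "nat \<Rightarrow> real^'d::finite \<Rightarrow> real" where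
  "weight k v = measure lborel (cube \<inter> dyadic k -` {v}) / (2 * pi) ^ CARD('d)"

text \<open>Rounding down leaves the cube by at most the mesh, which never exceeds 1. Bounds on
  functions and derivatives are therefore taken on this box.\<close>

definition wide_cube :: "(real^'d::finite) set" where
  "wide_cube = cbox (\<chi> i. - pi - 1) (\<chi> i. pi + 1)"

lemma dyadic_close: "\<bar>x $ i - dyadic k x $ i\<bar> \<le> (1 / 2) ^ k"
proof -
  have "2 ^ k * \<bar>x $ i - dyadic k x $ i\<bar> = \<bar>2 ^ k * x $ i - of_int \<lfloor>2 ^ k * x $ i\<rfloor>\<bar>"
  proof -
    have "2 ^ k * (x $ i - dyadic k x $ i) = 2 ^ k * x $ i - of_int \<lfloor>2 ^ k * x $ i\<rfloor>"
      by (simp add: dyadic_def right_diff_distrib)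
    then show ?thesis
      using abs_mult[of "2 ^ k" "x $ i - dyadic k x $ i"] by simp
  qed
  also have "\<dots> \<le> 1"
    by linarith
  finally show ?thesis
    by (simp add: power_one_over pos_le_divide_eq mult.commute)
qed

lemma dyadic_in_wide_cube: "x \<in> cube \<Longrightarrow> dyadic k x \<in> wide_cube"
  unfolding wide_cube_def mem_box_cart mem_cube
proof (intro allI, simp)
  fix i assume "\<forall>i. - pi \<le> x $ i \<and> x $ i \<le> pi"
  then have "- pi \<le> x $ i" "x $ i \<le> pi" by auto
  moreover have "(1 / 2 :: real) ^ k \<le> 1" by (simp add: power_le_one)
  ultimately show "- pi - 1 \<le> dyadic k x $ i \<and> dyadic k x $ i \<le> pi + 1"
    using dyadic_close[of x i k] by linarith
qed

lemma cube_subset_wide: "cube \<subseteq> wide_cube"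
  unfolding wide_cube_def subset_iff mem_box_cart mem_cube by (auto simp: add_increasing2 intro: order_trans[of "- pi - 1" "- pi"])

lemma compact_wide_cube: "compact wide_cube"
  by (simp add: wide_cube_def)

lemma finite_grid: "finite (grid k :: (real^'d) set)"
proof -
  define A where "A = (\<lambda>m :: int. of_int m / 2 ^ k :: real) ` {\<lfloor>- (2 ^ k * pi)\<rfloor>..\<lfloor>2 ^ k * pi\<rfloor>}"
  have "finite ((\<lambda>f. (\<chi> i. f i) :: real^'d) ` (Pi\<^sub>E UNIV (\<lambda>_. A)))"
    by (intro finite_imageI finite_PiE) (auto simp: A_def)
  moreover have "grid k \<subseteq> (\<lambda>f. (\<chi> i. f i) :: real^'d) ` (Pi\<^sub>E UNIV (\<lambda>_. A))"
  proof
    fix v :: "real^'d" assume "v \<in> grid k"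
    then obtain x :: "real^'d" where x: "x \<in> cube" "v = dyadic k x" by (auto simp: grid_def)
    have "of_int \<lfloor>2 ^ k * x $ i\<rfloor> / 2 ^ k \<in> A" for i
    proof -
      have "- pi \<le> x $ i" "x $ i \<le> pi"
        using x by (auto simp: mem_cube)
      then have "- (2 ^ k * pi) \<le> 2 ^ k * x $ i" "2 ^ k * x $ i \<le> 2 ^ k * pi"
        using mult_left_mono[of "- pi" "x $ i" "2 ^ k"] mult_left_mono[of "x $ i" pi "2 ^ k"] by auto
      then show ?thesis
        unfolding A_def by (intro imageI) (auto intro: floor_mono)
    qed
    then show "v \<in> (\<lambda>f. (\<chi> i. f i) :: real^'d) ` (Pi\<^sub>E UNIV (\<lambda>_. A))"
      by (intro image_eqI[of _ _ "\<lambda>i. of_int \<lfloor>2 ^ k * x $ i\<rfloor> / 2 ^ k"]) (auto simp: x dyadic_def)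
  qed
  ultimately show ?thesis by (rule finite_subset[rotated])
qed

lemma dyadic_measurable: "(dyadic k :: real^'d::finite \<Rightarrow> real^'d) \<in> borel_measurable borel"
proof -
  have c: "(\<lambda>x :: real^'d. x $ i) \<in> borel_measurable borel" for i
    by (intro borel_measurable_continuous_onI continuous_intros)
  have "(\<lambda>x :: real^'d. dyadic k x \<bullet> b) \<in> borel_measurable borel" if basis: "b \<in> Basis" for b
  proof -
    obtain i where b: "b = axis i 1" using basis by (auto simp: Basis_vec_def)
    have "(\<lambda>x :: real^'d. of_int \<lfloor>2 ^ k * x $ i\<rfloor> / 2 ^ k :: real) \<in> borel_measurable borel"
      using c[of i] by measurable
    then show ?thesis by (simp add: b inner_axis dyadic_def)
  qed
  then show ?thesis
    by (subst borel_measurable_euclidean_space) blast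
qed

text \<open>The weighted sum is itself the mean of a step function, so the error is the mean of a
  difference that c bounds at every point.\<close>

lemma riemann_sum_error:
  fixes g :: "real^'d \<Rightarrow> complex"
  assumes cont: "continuous_on UNIV g"
    and c: "\<And>x. x \<in> cube \<Longrightarrow> norm (g x - g (dyadic k x)) \<le> c"
  shows "norm (torus_mean g - (\<Sum>v\<in>grid k. of_real (weight k v) * g v)) \<le> c"
proof -
  let ?N = "(2 * pi) ^ CARD('d)"
  define A where "A v = cube \<inter> dyadic k -` {v}" for v :: "real^'d"
  have cube_sets: "cube \<in> sets (lborel :: (real^'d) measure)"
    by (simp add: cube_def)
  have A: "A v \<in> sets lborel" for v
    unfolding A_def using cube_sets measurable_sets[OF dyadic_measurable, of "{v}" k]
    by (intro sets.Int) auto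
  have fin_cube: "emeasure lborel (cube :: (real^'d) set) < \<infinity>"
    unfolding cube_def by (rule emeasure_lborel_cbox_finite)
  have fin: "emeasure lborel (A v) < \<infinity>" for v
    using emeasure_mono[of "A v" cube lborel] fin_cube cube_sets by (auto simp: A_def intro: le_less_trans)
  let ?s = "\<lambda>x. \<Sum>v\<in>grid k. indicator (A v) x *\<^sub>R g v"
  let ?c = "\<lambda>x. indicator cube x *\<^sub>R g x"
  have int_A: "integrable lborel (\<lambda>x. indicator (A v) x *\<^sub>R g v)" for v
    using A fin by (intro integrable_scaleR_left) (auto intro: integrable_real_indicator)
  have int_s: "integrable lborel ?s"
    by (intro Bochner_Integration.integrable_sum int_A)
  have int_c: "integrable lborel ?c"
    using set_integrable_cube[OF cont] by (simp add: set_integrable_def)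
  have int_ind: "integrable lborel (\<lambda>x. c * indicator (cube :: (real^'d) set) x)"
    using cube_sets fin_cube by (intro integrable_mult_right) (auto intro: integrable_real_indicator)
  have "(\<integral>x. ?s x \<partial>lborel) = (\<Sum>v\<in>grid k. of_real (measure lborel (A v)) * g v)"
    using A fin int_A by (subst Bochner_Integration.integral_sum) (auto simp: scaleR_conv_of_real)
  then have sum: "(\<Sum>v\<in>grid k. of_real (weight k v) * g v) = complex_of_real (1 / ?N) * (\<integral>x. ?s x \<partial>lborel)"
    by (simp add: weight_def A_def sum_distrib_left mult_ac)
  have mean: "torus_mean g = complex_of_real (1 / ?N) * (\<integral>x. ?c x \<partial>lborel)"
    unfolding torus_mean_def LINT_cube[OF cont, symmetric] set_lebesgue_integral_def ..
  have s_eq: "?s x = indicator cube x *\<^sub>R g (dyadic k x)" for x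
  proof (cases "x \<in> cube")
    case True
    then have "dyadic k x \<in> grid k" by (simp add: grid_def)
    have "?s x = (\<Sum>v\<in>{dyadic k x}. indicator (A v) x *\<^sub>R g v)"
      using \<open>dyadic k x \<in> grid k\<close> by (intro sum.mono_neutral_right finite_grid) (auto simp: A_def)
    then show ?thesis using True by (simp add: A_def)
  qed (simp add: A_def)
  have "norm (\<integral>x. ?c x - ?s x \<partial>lborel) \<le> (\<integral>x. c * indicator (cube :: (real^'d) set) x \<partial>lborel)"
  proof (rule Bochner_Integration.integral_norm_bound_integral)
    show "integrable lborel (\<lambda>x. ?c x - ?s x)"
      by (intro Bochner_Integration.integrable_diff int_c int_s)
    show "integrable lborel (\<lambda>x. c * indicator (cube :: (real^'d) set) x)" by fact
    fix x :: "real^'d"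
    show "norm (?c x - ?s x) \<le> c * indicator cube x"
      unfolding s_eq using c[of x] by (auto simp: indicator_def)
  qed
  also have "\<dots> = c * ?N"
    using cube_sets by (simp add: content_cube)
  also have "(\<integral>x. ?c x - ?s x \<partial>lborel) = (\<integral>x. ?c x \<partial>lborel) - (\<integral>x. ?s x \<partial>lborel)"
    by (intro Bochner_Integration.integral_diff int_c int_s)
  finally have "norm (complex_of_real (1 / ?N) * ((\<integral>x. ?c x \<partial>lborel) - (\<integral>x. ?s x \<partial>lborel))) \<le> c"
    by (simp add: norm_mult norm_divide norm_power field_simps)
  then show ?thesis
    unfolding sum mean by (simp add: right_diff_distrib)
qed

subsection \<open>Uniqueness of Fourier coefficients\<close>

lemma periodic_shift:
  assumes per: "\<And>i x. f (x + axis i (2 * pi)) = f x"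
  shows "f (x + (\<chi> i. 2 * pi * of_int (n $ i))) = f (x :: real^'d)"
proof -
  have nat: "f (x + axis i (2 * pi * real m)) = f x" for i m x
  proof (induction m)
    case (Suc m)
    have "x + axis i (2 * pi * real (Suc m)) = (x + axis i (2 * pi * real m)) + axis i (2 * pi)"
      by (auto simp: vec_eq_iff axis_def algebra_simps)
    then show ?case using Suc by (simp only: per)
  next
    case 0
    then show ?case by (simp add: axis_def zero_vec_def[symmetric])
  qed
  have int: "f (x + axis i (2 * pi * of_int m)) = f x" for i m x
  proof (cases "m \<ge> 0")
    case True
    then show ?thesis using nat[of x i "nat m"] by simp
  next
    case False
    have eq: "(x + axis i (2 * pi * of_int m)) + axis i (2 * pi * real (nat (- m))) = x"
      using False by (auto simp: vec_eq_iff axis_def)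
    show ?thesis using nat[of "x + axis i (2 * pi * of_int m)" i "nat (- m)"] unfolding eq by simp
  qed
  have "f (x + (\<Sum>i\<in>S. axis i (2 * pi * of_int (n $ i)))) = f x" if "finite S" for S
    using that
  proof induction
    case (insert i S)
    then show ?case
      using int[of "x + (\<Sum>i\<in>S. axis i (2 * pi * of_int (n $ i)))" i "n $ i"]
      by (simp add: algebra_simps)
  qed simp
  moreover have "(\<Sum>i\<in>UNIV. axis i (2 * pi * of_int (n $ i))) = (\<chi> i. 2 * pi * of_int (n $ i))"
    by (simp add: vec_eq_iff sum_component axis_def)
  ultimately show ?thesis by (metis finite)
qed

lemma shift_into_cube: "\<exists>n. x + (\<chi> i. 2 * pi * of_int (n $ i)) \<in> cube" for x :: "real^'d"
proof
  let ?n = "(\<chi> i. - \<lfloor>(x $ i + pi) / (2 * pi)\<rfloor>) :: int^'d"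
  show "x + (\<chi> i. 2 * pi * of_int (?n $ i)) \<in> cube"
    unfolding mem_cube
  proof (intro allI)
    fix i
    define m where "m = \<lfloor>(x $ i + pi) / (2 * pi)\<rfloor>"
    have "of_int m \<le> (x $ i + pi) / (2 * pi)" "(x $ i + pi) / (2 * pi) \<le> of_int m + 1"
      unfolding m_def by linarith+
    then have "2 * pi * of_int m \<le> x $ i + pi" "x $ i + pi \<le> 2 * pi * of_int m + 2 * pi"
      by (simp_all add: field_simps)
    then show "- pi \<le> (x + (\<chi> i. 2 * pi * of_int (?n $ i))) $ i \<and>
        (x + (\<chi> i. 2 * pi * of_int (?n $ i))) $ i \<le> pi"
      by (simp flip: m_def)
  qed
qed

text \<open>If \<open>f\<close> annihilates all characters, then it annihilates the powers of the trigonometric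
  polynomial below, which concentrate near \<open>z\<close>.\<close>

definition peak :: "real^'d::finite \<Rightarrow> real^'d \<Rightarrow> real" where
  "peak z x = (\<Sum>i\<in>UNIV. (1 + cos (x $ i - z $ i)) / 2) / CARD('d)"

lemma continuous_on_peak: "continuous_on S (peak z)"
  unfolding peak_def by (intro continuous_intros) auto

lemma peak_bounds: "0 \<le> peak z x" "peak z x \<le> 1"
proof -
  have c: "0 \<le> (1 + cos t) / 2 \<and> (1 + cos t) / 2 \<le> 1" for t :: real
  proof -
    have a: "- 1 \<le> cos t" "cos t \<le> 1" by simp_all
    then have "0 \<le> 1 + cos t" by linarith
    with a show ?thesis by simp
  qed
  show "0 \<le> peak z x" unfolding peak_def using c by (intro divide_nonneg_nonneg sum_nonneg) auto
  have "(\<Sum>i\<in>UNIV. (1 + cos (x $ i - z $ i)) / 2) \<le> of_nat (card (UNIV :: 'a set)) * 1"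
    by (intro sum_bounded_above conjunct2[OF c])
  then show "peak z x \<le> 1" by (simp add: peak_def divide_le_eq)
qed

lemma peak_self [simp]: "peak z z = 1"
  by (simp add: peak_def)

text \<open>An average of numbers at most 1 equals 1 only if each of them does. Away from the
  translates of z by periods the peak thus stays below 1, on which the comparison of powers
  relies.\<close>

lemma peak_eq_1:
  fixes x z :: "real^'d"
  assumes "peak z x = 1"
  obtains n where "x = z + (\<chi> i. 2 * pi * of_int (n $ i))"
proof -
  have "(\<Sum>i\<in>(UNIV :: 'd set). 1 - (1 + cos (x $ i - z $ i)) / 2) = 0"
    using assms by (simp only: sum_subtractf) (simp add: peak_def divide_eq_eq)
  then have "\<forall>i\<in>(UNIV :: 'd set). 1 - (1 + cos (x $ i - z $ i)) / 2 = 0"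
    by (subst (asm) sum_nonneg_eq_0_iff) auto
  then have "cos (x $ i - z $ i) = 1" for i by (auto simp: field_simps)
  then have "\<exists>n :: int. x $ i - z $ i = of_int n * 2 * pi" for i
    by (simp add: cos_one_2pi_int)
  then obtain n :: "'d \<Rightarrow> int" where "\<And>i. x $ i - z $ i = of_int (n i) * 2 * pi" by metis
  then have "x = z + (\<chi> i. 2 * pi * of_int ((\<chi> i. n i) $ i))"
    by (simp add: vec_eq_iff algebra_simps)
  then show ?thesis using that by blast
qed

lemma peak_char:
  fixes z :: "real^'d"
  defines "e \<equiv> \<lambda>i. axis i 1 :: int^'d"
  shows "complex_of_real (peak z x) = (1 / of_nat CARD('d)) *
    (\<Sum>i\<in>UNIV. 1 / 2 + (torus_char (- e i) z / 4) * torus_char (e i) x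
      + (torus_char (e i) z / 4) * torus_char (- e i) x)"
proof -
  have "complex_of_real (cos (x $ i - z $ i))
      = (torus_char (- e i) z * torus_char (e i) x + torus_char (e i) z * torus_char (- e i) x) / 2" for i
  proof -
    have r: "real_vec (e i) = axis i 1"
      by (auto simp: e_def vec_eq_iff axis_def)
    have "complex_of_real (cos (x $ i - z $ i))
        = (exp (\<i> * of_real (x $ i - z $ i)) + exp (- (\<i> * of_real (x $ i - z $ i)))) / 2"
      by (simp add: cos_exp_eq flip: cos_of_real)
    also have "exp (\<i> * of_real (x $ i - z $ i)) = torus_char (- e i) z * torus_char (e i) x"
      unfolding torus_char_def real_vec_minus r
      by (simp add: inner_axis' algebra_simps flip: exp_add)
    also have "exp (- (\<i> * of_real (x $ i - z $ i))) = torus_char (e i) z * torus_char (- e i) x"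
      unfolding torus_char_def real_vec_minus r
      by (simp add: inner_axis' algebra_simps flip: exp_add)
    finally show ?thesis .
  qed
  then show ?thesis
    by (simp add: peak_def add_divide_distrib mult_ac add.assoc)
qed

text \<open>By \<open>peak_char\<close> the peak is a combination of characters whose indices are 0
  and plus or minus the unit vectors. One more factor therefore shifts n, and the induction has to
  run over all n at once.\<close>

lemma torus_mean_peak_power:
  fixes f :: "real^'d \<Rightarrow> complex"
  assumes cont: "continuous_on UNIV f" and zero: "\<And>n. torus_mean (\<lambda>x. f x * torus_char n x) = 0"
  shows "torus_mean (\<lambda>x. f x * complex_of_real (peak z x ^ N) * torus_char n x) = 0"
proof (induction N arbitrary: n)
  case 0
  then show ?case using zero by simp
next
  case (Suc N)
  define g where "g n x = f x * complex_of_real (peak z x ^ N) * torus_char n x" for n x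
  let ?e = "\<lambda>i. axis i 1 :: int^'d"
  have cg: "continuous_on UNIV (\<lambda>x. c * g n x)" for n c
    unfolding g_def by (intro continuous_intros continuous_on_of_real cont continuous_on_peak)
  have g0: "torus_mean (g n) = 0" for n
    unfolding g_def by (rule Suc.IH)
  have "f x * complex_of_real (peak z x ^ Suc N) * torus_char n x = (1 / of_nat CARD('d)) *
    (\<Sum>i\<in>UNIV. 1 / 2 * g n x + (torus_char (- ?e i) z / 4) * g (n + ?e i) x
      + (torus_char (?e i) z / 4) * g (n - ?e i) x)" for x
  proof -
    have "f x * complex_of_real (peak z x ^ Suc N) * torus_char n x
        = g n x * complex_of_real (peak z x)" by (simp add: g_def)
    also have "\<dots> = (1 / of_nat CARD('d)) * (\<Sum>i\<in>UNIV. g n x * (1 / 2 + (torus_char (- ?e i) z / 4) * torus_char (?e i) x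
      + (torus_char (?e i) z / 4) * torus_char (- ?e i) x))"
      unfolding peak_char by (simp only: sum_distrib_left mult_ac)
    finally show ?thesis
      by (simp only: g_def torus_char_add diff_conv_add_uminus distrib_left mult_ac)
  qed
  then have "torus_mean (\<lambda>x. f x * complex_of_real (peak z x ^ Suc N) * torus_char n x)
    = torus_mean (\<lambda>x. (1 / of_nat CARD('d)) *
    (\<Sum>i\<in>UNIV. 1 / 2 * g n x + (torus_char (- ?e i) z / 4) * g (n + ?e i) x
      + (torus_char (?e i) z / 4) * g (n - ?e i) x))"
    by simp
  also have "\<dots> = (1 / of_nat CARD('d)) *
    (\<Sum>i\<in>UNIV. torus_mean (\<lambda>x. 1 / 2 * g n x + (torus_char (- ?e i) z / 4) * g (n + ?e i) x
      + (torus_char (?e i) z / 4) * g (n - ?e i) x))"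
    unfolding torus_mean_cmult by (subst torus_mean_sum) (intro continuous_on_add cg, rule refl)
  also have "\<dots> = 0"
    by (simp only: torus_mean_add continuous_on_add cg torus_mean_cmult g0) simp
  finally show ?case .
qed

text \<open>If f does not vanish at z, a rotation gives a real F with F(z) = e > 0 and vanishing
  integrals against all powers of \<open>peak z\<close>. Where F \<le> e/2 the peak is at most q <
  1; on a small box near z it exceeds r > q while F > e/2. The box contributes at least a multiple
  of r^N and the negative part at most a multiple of q^N, which cannot cancel for large N.\<close>

lemma torus_char_complete:
  fixes f :: "real^'d \<Rightarrow> complex"
  assumes cont: "continuous_on UNIV f" and per: "\<And>i x. f (x + axis i (2 * pi)) = f x"
    and zero: "\<And>n. torus_mean (\<lambda>x. f x * torus_char n x) = 0"
  shows "f y = 0"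
proof (rule ccontr)
  assume "f y \<noteq> 0"
  obtain n where "y + (\<chi> i. 2 * pi * of_int (n $ i)) \<in> cube"
    using shift_into_cube by blast
  then obtain z where z: "z \<in> cube" "f z \<noteq> 0"
    using periodic_shift[of f y n, OF per] \<open>f y \<noteq> 0\<close> by metis
  define F where "F x = Re (cnj (f z) * f x)" for x
  define e where "e = F z"
  have e: "e > 0"
    using z(2) by (simp add: e_def F_def complex_eq_iff flip: power2_eq_square)
      (metis add_nonneg_eq_0_iff less_le sum_power2_gt_zero_iff zero_le_power2)
  have contF: "continuous_on S F" for S
    unfolding F_def by (intro continuous_intros continuous_on_subset[OF cont]) auto
  obtain M where M: "\<And>x. x \<in> cube \<Longrightarrow> \<bar>F x\<bar> \<le> M"
  proof -
    have "compact (F ` cube)" by (intro compact_continuous_image contF compact_cube)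
    then show thesis using that compact_imp_bounded bounded_iff by (metis imageI real_norm_def)
  qed
  define S where "S = {x \<in> cube. F x \<le> e / 2}"
  have "compact S"
  proof -
    have "closed {x. F x \<le> e / 2}"
      by (intro closed_Collect_le contF continuous_on_const)
    moreover have "S = cube \<inter> {x. F x \<le> e / 2}" by (auto simp: S_def)
    ultimately show ?thesis using compact_Int_closed[OF compact_cube] by metis
  qed
  \<comment> \<open>A maximum 1 on S would be attained at a translate of z by periods, where F = e.
    An empty S admits q = 0.\<close>
  have "\<exists>q\<ge>0. q < 1 \<and> (\<forall>x\<in>S. peak z x \<le> q)"
  proof (cases "S = {}")
    case False
    obtain x where x: "x \<in> S" "\<forall>y\<in>S. peak z y \<le> peak z x"
      using continuous_attains_sup[OF \<open>compact S\<close> False continuous_on_peak] by blast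
    have "peak z x \<noteq> 1"
    proof
      assume "peak z x = 1"
      then obtain n where "x = z + (\<chi> i. 2 * pi * of_int (n $ i))" by (rule peak_eq_1)
      then have "f x = f z" using periodic_shift[of f z n, OF per] by simp
      then show False using x(1) e by (simp add: S_def e_def F_def)
    qed
    then show ?thesis
      using x peak_bounds[of z x] by (intro exI[of _ "peak z x"]) auto
  next
    case True
    then show ?thesis by (intro exI[of _ 0]) simp
  qed
  then obtain q where q: "0 \<le> q" "q < 1" "\<And>x. x \<in> S \<Longrightarrow> peak z x \<le> q" by blast
  define r where "r = (q + 1) / 2"
  have r: "q < r" "r < 1" "0 < r" using q by (auto simp: r_def)
  \<comment> \<open>The point z may lie on the boundary of the cube, so the small box is sought in
    the interior; V is nonempty because z belongs to the closure of that interior.\<close>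
  define V where "V = {x. r < peak z x} \<inter> box (\<chi> i. - pi) (\<chi> i. pi)"
  have opn: "open {x. r < peak z x}"
    by (intro open_Collect_less continuous_on_peak continuous_on_const)
  have "open V" unfolding V_def using opn by (intro open_Int open_box)
  have "(0 :: real^'d) \<in> box (\<chi> i. - pi) (\<chi> i. pi)"
    by (simp add: mem_box_cart)
  then have "box (\<chi> i. - pi) (\<chi> i. pi) \<noteq> ({} :: (real^'d) set)"
    by blast
  then have "closure (box (\<chi> i. - pi) (\<chi> i. pi)) = (cube :: (real^'d) set)"
    by (simp add: cube_def closure_box)
  moreover have "z \<in> {x. r < peak z x}" using r by simp
  ultimately have "V \<noteq> {}"
    unfolding V_def using open_Int_closure_eq_empty[OF opn, of "box (\<chi> i. - pi) (\<chi> i. pi)"] z by blast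
  then obtain w where "w \<in> V" by blast
  obtain a b where ab: "cbox a b \<subseteq> V" "w \<in> box a b" "\<forall>i\<in>Basis. a \<bullet> i < b \<bullet> i"
    using open_contains_cbox[OF \<open>open V\<close> \<open>w \<in> V\<close>] by metis
  let ?W = "cbox a b"
  let ?\<mu> = "measure lborel ?W" and ?N = "measure lborel (cube :: (real^'d) set)"
  have \<mu>: "?\<mu> > 0" using ab(3) content_pos_lt_eq by blast
  have W_cube: "?W \<subseteq> cube"
    using ab(1) box_subset_cbox unfolding V_def cube_def by fast
  have main: "(e / 2) * r ^ N * ?\<mu> \<le> M * q ^ N * ?N" for N
  proof -
    let ?G = "\<lambda>x. F x * peak z x ^ N"
    \<comment> \<open>?H lies below the integrand: on W because F > e/2 and peak > r, on S because
      |F| \<le> M and peak \<le> q, and on the rest of the cube because F is positive there.\<close>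
    let ?H = "\<lambda>x. (e / 2) * r ^ N * indicator ?W x - M * q ^ N * indicator (cube :: (real^'d) set) x"
    have cG: "continuous_on S ?G" for S by (intro continuous_intros contF continuous_on_peak)
    have "integral cube ?G = Re (integral cube (\<lambda>x. cnj (f z) * (f x * complex_of_real (peak z x ^ N) * torus_char 0 x)))"
    proof -
      have "(\<lambda>x. cnj (f z) * (f x * complex_of_real (peak z x ^ N) * torus_char 0 x)) integrable_on cube"
        by (intro integrable_on_cube continuous_intros continuous_on_of_real cont continuous_on_peak)
      from integral_linear[OF this bounded_linear_Re] show ?thesis
        by (simp add: o_def F_def algebra_simps)
    qed
    also have "\<dots> = 0"
      using torus_mean_peak_power[OF cont zero, of z N 0] by (simp add: torus_mean_def)
    finally have G0: "integral cube ?G = 0" .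
    have intG: "set_integrable lborel cube ?G"
      unfolding set_integrable_def cube_def using cG by (intro borel_integrable_compact) auto
    have fin: "emeasure lborel ?W < \<infinity>" "emeasure lborel (cube :: (real^'d) set) < \<infinity>"
      unfolding cube_def by (rule emeasure_lborel_cbox_finite)+
    have sets: "?W \<in> sets lborel" "(cube :: (real^'d) set) \<in> sets lborel" by (simp_all add: cube_def)
    have intW: "integrable lborel (\<lambda>x. (e / 2) * r ^ N * indicator ?W x :: real)"
      and intC: "integrable lborel (\<lambda>x. M * q ^ N * indicator (cube :: (real^'d) set) x :: real)"
      using sets fin by (auto intro!: integrable_mult_right integrable_real_indicator)
    have "(\<integral>x. ?H x \<partial>lborel) \<le> (\<integral>x. indicator cube x *\<^sub>R ?G x \<partial>lborel)"
    proof (rule integral_mono)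
      show "integrable lborel ?H" by (intro Bochner_Integration.integrable_diff intW intC)
      show "integrable lborel (\<lambda>x. indicator cube x *\<^sub>R ?G x)" using intG by (simp add: set_integrable_def)
      fix x :: "real^'d"
      show "?H x \<le> indicator cube x *\<^sub>R ?G x"
      proof (cases "x \<in> cube")
        case False
        then show ?thesis using W_cube by (auto simp: indicator_def)
      next
        case True
        have "M \<ge> 0" using M[OF True] by linarith
        show ?thesis
        proof (cases "x \<in> S")
          case xS: True
          then have "x \<notin> ?W" using q(3)[OF xS] ab(1) r by (auto simp: V_def)
          have "- (M * q ^ N) \<le> - (\<bar>F x\<bar> * peak z x ^ N)"
            using M[OF True] q(3)[OF xS] peak_bounds[of z x] \<open>M \<ge> 0\<close>
            by (simp add: mult_mono power_mono)
          also have "\<dots> \<le> ?G x"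
            using mult_right_mono[of "- \<bar>F x\<bar>" "F x" "peak z x ^ N"] peak_bounds[of z x] by simp
          finally show ?thesis using True \<open>x \<notin> ?W\<close> by simp
        next
          case xS: False
          then have F: "F x > e / 2" using True by (simp add: S_def)
          have Mq: "M * q ^ N \<ge> 0" using \<open>M \<ge> 0\<close> q by simp
          have G: "?G x \<ge> 0" using F e peak_bounds[of z x] by simp
          have "(e / 2) * r ^ N \<le> ?G x" if "x \<in> ?W"
          proof -
            have "r \<le> peak z x" using that ab(1) by (auto simp: V_def)
            then show ?thesis using F e r by (intro mult_mono power_mono) auto
          qed
          then show ?thesis using True Mq G by (auto simp: indicator_def)
        qed
      qed
    qed
    also have "(\<integral>x. indicator cube x *\<^sub>R ?G x \<partial>lborel) = 0"
      using set_borel_integral_eq_integral(2)[OF intG] G0 by (simp add: set_lebesgue_integral_def)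
    also have "(\<integral>x. ?H x \<partial>lborel) = (e / 2) * r ^ N * ?\<mu> - M * q ^ N * ?N"
      using sets fin by (subst Bochner_Integration.integral_diff[OF intW intC]) simp
    finally show ?thesis by simp
  qed
  have "(e / 2) * ?\<mu> \<le> M * ?N * (q / r) ^ N" for N
    using main[of N] r by (simp add: power_divide field_simps)
  moreover have "(\<lambda>N. M * ?N * (q / r) ^ N) \<longlonglongrightarrow> M * ?N * 0"
    using q r by (intro tendsto_mult tendsto_const LIMSEQ_power_zero) auto
  ultimately have "(e / 2) * ?\<mu> \<le> 0"
    using LIMSEQ_le_const[of _ _ "(e / 2) * ?\<mu>"] by fastforce
  then show False using e \<mu> by (simp add: mult_le_0_iff)
qed

section \<open>Absolutely convergent series over the integer lattice\<close>

lemma summable_on_le: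
  fixes f g :: "'i \<Rightarrow> real"
  assumes "g summable_on UNIV" "\<And>x. 0 \<le> f x" "\<And>x. f x \<le> g x"
  shows "f summable_on UNIV"
proof (rule nonneg_bdd_above_summable_on)
  have "sum f F \<le> infsum g UNIV" if "finite F" for F
  proof -
    have "sum f F \<le> sum g F" by (intro sum_mono assms)
    also have "\<dots> \<le> infsum g UNIV"
      using assms that order_trans[OF assms(2,3)] by (intro finite_sum_le_infsum) auto
    finally show ?thesis .
  qed
  then show "bdd_above (sum f ` {F. F \<subseteq> UNIV \<and> finite F})"
    by (intro bdd_aboveI2[of _ _ "infsum g UNIV"]) auto
qed (use assms in auto)

text \<open>For summable f this is the sum off N. Written as a difference, it inherits its limit 0
  directly from the convergence of the finite sums.\<close>

definition tail_sum :: "('i \<Rightarrow> real) \<Rightarrow> 'i set \<Rightarrow> real" where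
  "tail_sum f N = infsum f UNIV - sum f N"

lemma tail_sum_tendsto:
  assumes "f summable_on UNIV"
  shows "(tail_sum f \<longlongrightarrow> 0) (finite_subsets_at_top UNIV)"
proof -
  have "(sum f \<longlongrightarrow> infsum f UNIV) (finite_subsets_at_top UNIV)"
    using has_sum_infsum[OF assms] by (simp add: has_sum_def)
  from tendsto_diff[OF tendsto_const this, of "infsum f UNIV"] show ?thesis
    by (simp add: tail_sum_def[abs_def])
qed

lemma tail_sum_bound:
  assumes "f summable_on UNIV" "\<And>x. 0 \<le> f x" "finite N" "finite M" "M \<inter> N = {}"
  shows "sum f M \<le> tail_sum f N"
proof -
  have "sum f M + sum f N = sum f (M \<union> N)"
    using assms by (simp add: sum.union_disjoint)
  also have "\<dots> \<le> infsum f UNIV"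
    using assms by (intro finite_sum_le_infsum) auto
  finally show ?thesis by (simp add: tail_sum_def)
qed

text \<open>The square of the usual bracket, so that all later estimates can be made with integer
  powers.\<close>

definition bracket :: "int^'d::finite \<Rightarrow> real" where
  "bracket n = 1 + (norm (real_vec n))\<^sup>2"

lemma bracket_ge_1: "1 \<le> bracket n"
  by (simp add: bracket_def)

lemma bracket_pos: "0 < bracket n"
  using bracket_ge_1[of n] by linarith

lemma bracket_nonneg [simp]: "0 \<le> bracket n"
  using bracket_ge_1[of n] by linarith

lemma bracket_power_mono: "m \<le> k \<Longrightarrow> bracket n ^ m \<le> bracket n ^ k"
  by (intro power_increasing bracket_ge_1)

lemma norm_le_bracket: "norm (real_vec n) \<le> bracket n"
proof -
  have "0 \<le> (norm (real_vec n) - 1)\<^sup>2" by simp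
  then have "2 * norm (real_vec n) \<le> bracket n"
    by (simp add: bracket_def power2_eq_square algebra_simps)
  then show ?thesis using norm_ge_zero[of "real_vec n"] by linarith
qed

lemma component_le_bracket: "\<bar>real_of_int (n $ i)\<bar> \<le> bracket n"
  using component_le_norm_cart[of "real_vec n" i] norm_le_bracket[of n] by simp

lemma component_square_le_bracket: "1 + (real_of_int (n $ i))\<^sup>2 \<le> bracket n"
  using power_mono[OF component_le_norm_cart[of "real_vec n" i], of 2] by (simp add: bracket_def)

lemma finite_bounded_lattice: "finite {n :: int^'d. \<forall>i. \<bar>n $ i\<bar> \<le> M}"
proof -
  have "finite ((\<lambda>f. (\<chi> i. f i) :: int^'d) ` (Pi\<^sub>E UNIV (\<lambda>_. {- M..M})))"
    by (intro finite_imageI finite_PiE) auto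
  moreover have "{n :: int^'d. \<forall>i. \<bar>n $ i\<bar> \<le> M} \<subseteq> (\<lambda>f. (\<chi> i. f i) :: int^'d) ` (Pi\<^sub>E UNIV (\<lambda>_. {- M..M}))"
  proof
    fix n :: "int^'d" assume "n \<in> {n. \<forall>i. \<bar>n $ i\<bar> \<le> M}"
    then show "n \<in> (\<lambda>f. (\<chi> i. f i) :: int^'d) ` (Pi\<^sub>E UNIV (\<lambda>_. {- M..M}))"
      by (intro image_eqI[of _ _ "\<lambda>i. n $ i"]) (auto simp: abs_le_iff, smt (verit))
  qed
  ultimately show ?thesis by (rule finite_subset[rotated])
qed

lemma finite_bracket_le: "finite {n :: int^'d. bracket n \<le> c}"
proof (rule finite_subset[OF _ finite_bounded_lattice[of "\<lceil>c\<rceil>"]], safe)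
  fix n :: "int^'d" and i assume "bracket n \<le> c"
  then have "\<bar>real_of_int (n $ i)\<bar> \<le> c" using component_le_bracket[of n i] by linarith
  then show "\<bar>n $ i\<bar> \<le> \<lceil>c\<rceil>" by linarith
qed

lemma finite_lattice_ball: "finite {n :: int^'d. norm (real_vec n) \<le> r}"
proof (rule finite_subset[OF _ finite_bracket_le[of "1 + r\<^sup>2"]], safe)
  fix n :: "int^'d" assume "norm (real_vec n) \<le> r"
  then show "bracket n \<le> 1 + r\<^sup>2" by (simp add: bracket_def power_mono)
qed

text \<open>The bound telescopes: the two new terms together are at most 4/(M+1) - 4/(M+2) =
  4/((M+1)(M+2)). The constant 5 is fitted to equality at M = 0.\<close>

lemma sum_inverse_squares_le: "(\<Sum>k\<in>{- int M..int M}. 1 / (1 + (real_of_int k)\<^sup>2)) \<le> 5 - 4 / (real M + 1)"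
proof (induction M)
  case (Suc M)
  have "{- int (Suc M)..int (Suc M)} = insert (- int (Suc M)) (insert (int (Suc M)) {- int M..int M})"
    by auto
  then have "(\<Sum>k\<in>{- int (Suc M)..int (Suc M)}. 1 / (1 + (real_of_int k)\<^sup>2))
      = 2 / (1 + (real M + 1)\<^sup>2) + (\<Sum>k\<in>{- int M..int M}. 1 / (1 + (real_of_int k)\<^sup>2))"
    by (simp add: power2_eq_square algebra_simps)
  moreover have "2 / (1 + (real M + 1)\<^sup>2) \<le> 4 / (real M + 1) - 4 / (real (Suc M) + 1)"
  proof -
    have "4 / (real M + 1) - 4 / (real (Suc M) + 1) = 4 / ((real M + 1) * (real M + 2))"
      by (simp add: field_simps)
    moreover have "2 / (1 + (real M + 1)\<^sup>2) \<le> 4 / ((real M + 1) * (real M + 2))"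
    proof -
      have frac: "2 / A \<le> 4 / B" if "A > 0" "B > 0" "2 * B \<le> 4 * A" for A B :: real
        using that by (simp add: field_simps)
      show ?thesis
        by (rule frac) (auto simp: power2_eq_square algebra_simps add_pos_nonneg)
    qed
    ultimately show ?thesis by simp
  qed
  ultimately show ?case using Suc.IH by linarith
qed simp

text \<open>Each 1 + n_i^2 is at most the bracket, so the inverse d-th power is dominated by a
  product of one-variable terms. Its sum over a box is a product of sums, each bounded by 5.\<close>

lemma summable_bracket: "(\<lambda>n :: int^'d. 1 / bracket n ^ CARD('d)) summable_on UNIV"
proof (rule nonneg_bdd_above_summable_on)
  show "0 \<le> 1 / bracket n ^ CARD('d)" for n :: "int^'d"
    using bracket_pos[of n] by simp
  have "(\<Sum>n\<in>F. 1 / bracket n ^ CARD('d)) \<le> 5 ^ CARD('d)" if F: "finite F" for F :: "(int^'d) set"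
  proof -
    define g where "g k = 1 / (1 + (real_of_int k)\<^sup>2)" for k
    have g: "0 \<le> g k" for k by (simp add: g_def)
    define M where "M = nat (Max (insert 0 ((\<lambda>(n, i). \<bar>n $ i\<bar>) ` (F \<times> UNIV))))"
    have M: "\<bar>n $ i\<bar> \<le> int M" if "n \<in> F" for n i
    proof -
      have "\<bar>n $ i\<bar> \<le> Max (insert 0 ((\<lambda>(n, i). \<bar>n $ i\<bar>) ` (F \<times> UNIV)))"
        using F that by (intro Max_ge) auto
      then show ?thesis unfolding M_def by linarith
    qed
    have le: "1 / bracket n ^ CARD('d) \<le> (\<Prod>i\<in>UNIV. g (n $ i))" for n :: "int^'d"
    proof -
      have "(\<Prod>i\<in>(UNIV :: 'd set). 1 / bracket n) \<le> (\<Prod>i\<in>UNIV. g (n $ i))"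
        unfolding g_def using component_square_le_bracket[of n] bracket_pos[of n]
        by (intro prod_mono) (auto intro!: divide_left_mono mult_pos_pos add_pos_nonneg)
      then show ?thesis by (simp add: power_one_over)
    qed
    have "(\<Sum>n\<in>F. 1 / bracket n ^ CARD('d)) \<le> (\<Sum>n\<in>F. \<Prod>i\<in>UNIV. g (n $ i))"
      by (intro sum_mono le)
    also have "\<dots> = (\<Sum>f\<in>($) ` F. \<Prod>i\<in>UNIV. g (f i))"
      by (subst sum.reindex) (auto simp: inj_on_def vec_eq_iff fun_eq_iff)
    also have "\<dots> \<le> (\<Sum>f\<in>Pi\<^sub>E (UNIV :: 'd set) (\<lambda>_. {- int M..int M}). \<Prod>i\<in>UNIV. g (f i))"
    proof (rule sum_mono2)
      show "finite (Pi\<^sub>E (UNIV :: 'd set) (\<lambda>_. {- int M..int M}))" by (intro finite_PiE) auto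
      show "($) ` F \<subseteq> Pi\<^sub>E (UNIV :: 'd set) (\<lambda>_. {- int M..int M})"
        using M by (auto simp: abs_le_iff, smt (verit))
    qed (use g in \<open>auto intro: prod_nonneg\<close>)
    also have "\<dots> = (\<Prod>i\<in>(UNIV :: 'd set). \<Sum>k\<in>{- int M..int M}. g k)"
      by (subst prod_sum_PiE) auto
    also have "\<dots> \<le> (\<Prod>i\<in>(UNIV :: 'd set). 5)"
    proof (rule prod_mono, intro conjI)
      show "(\<Sum>k\<in>{- int M..int M}. g k) \<le> 5"
        using sum_inverse_squares_le[of M] unfolding g_def
        by (rule order_trans) simp
    qed (use g in \<open>auto intro: sum_nonneg\<close>)
    finally show ?thesis by simp
  qed
  then show "bdd_above (sum (\<lambda>n :: int^'d. 1 / bracket n ^ CARD('d)) ` {F. F \<subseteq> UNIV \<and> finite F})"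
    by (intro bdd_aboveI2[of _ _ "5 ^ CARD('d)"]) auto
qed

definition bracket_sum :: "'d::finite itself \<Rightarrow> real" where
  "bracket_sum _ = infsum (\<lambda>n :: int^'d. 1 / bracket n ^ CARD('d)) UNIV"

section \<open>Rapidly decreasing families and their unordered sums\<close>

context lc_space
begin

text \<open>Integer powers of the bracket replace the real exponents in
  \<open>rapidly_decreasing\<close>; \<open>points_rapidly_decreasing\<close> shows that both
  describe the same families.\<close>

definition rapid :: "(int^'d::finite \<Rightarrow> 'a) \<Rightarrow> bool" where
  "rapid a \<longleftrightarrow> (\<forall>n. a n \<in> points X) \<and> (\<forall>m. \<forall>p\<in>seminorms X. \<exists>C. \<forall>n. p (a n) * bracket n ^ m \<le> C)"

lemma rapid_mem: "rapid a \<Longrightarrow> a n \<in> points X"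
  by (simp add: rapid_def)

lemma rapid_summable:
  fixes a :: "int^'d \<Rightarrow> 'a"
  assumes a: "rapid a" and p: "p \<in> seminorms X"
  shows "(\<lambda>n. p (a n) * bracket n ^ m) summable_on UNIV"
proof -
  obtain C where C: "\<And>n. p (a n) * bracket n ^ (m + CARD('d)) \<le> C"
    using a p unfolding rapid_def by blast
  show ?thesis
  proof (rule summable_on_le)
    show "(\<lambda>n :: int^'d. C * (1 / bracket n ^ CARD('d))) summable_on UNIV"
      by (intro summable_on_cmult_right summable_bracket)
    fix n
    show "0 \<le> p (a n) * bracket n ^ m"
      using sn_nonneg[OF p rapid_mem[OF a]] bracket_pos[of n] by simp
    show "p (a n) * bracket n ^ m \<le> C * (1 / bracket n ^ CARD('d))"
      using C[of n] bracket_pos[of n] by (simp add: power_add field_simps)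
  qed
qed

lemma rapid_summable0: "rapid a \<Longrightarrow> p \<in> seminorms X \<Longrightarrow> (\<lambda>n. p (a n)) summable_on UNIV"
  using rapid_summable[of a p 0] by simp

text \<open>Characters, derivative symbols, truncations and the values \<phi>(e_n) of a functional
  all act on families in this way.\<close>

lemma rapid_multiplier:
  assumes a: "rapid a" and c: "\<And>n. norm (c n) \<le> B * bracket n ^ k"
  shows "rapid (\<lambda>n. c n *\<^sub>C a n)"
  unfolding rapid_def
proof (intro conjI allI ballI)
  show "c n *\<^sub>C a n \<in> points X" for n by (intro scale_mem rapid_mem a)
  fix m p assume p: "p \<in> seminorms X"
  obtain C where C: "\<And>n. p (a n) * bracket n ^ (k + m) \<le> C"
    using a p unfolding rapid_def by blast
  have B: "0 \<le> B" using c[of 0] norm_ge_zero[of "c 0"] bracket_pos[of 0]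
    by (metis order_trans zero_le_mult_iff zero_less_power not_le)
  have "p (c n *\<^sub>C a n) * bracket n ^ m \<le> B * C" for n
  proof -
    have "p (c n *\<^sub>C a n) * bracket n ^ m = norm (c n) * (p (a n) * bracket n ^ m)"
      using sn_scale[OF p rapid_mem[OF a]] by simp
    also have "\<dots> \<le> (B * bracket n ^ k) * (p (a n) * bracket n ^ m)"
      using sn_nonneg[OF p rapid_mem[OF a]] bracket_pos[of n] by (intro mult_right_mono c) simp
    also have "\<dots> = B * (p (a n) * bracket n ^ (k + m))" by (simp add: power_add mult_ac)
    also have "\<dots> \<le> B * C" by (intro mult_left_mono C B)
    finally show ?thesis .
  qed
  then show "\<exists>C. \<forall>n. p (c n *\<^sub>C a n) * bracket n ^ m \<le> C" by blast
qed

lemma rapid_add: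
  assumes a: "rapid a" and b: "rapid b"
  shows "rapid (\<lambda>n. a n + b n)"
  unfolding rapid_def
proof (intro conjI allI ballI)
  show "a n + b n \<in> points X" for n by (intro add_mem rapid_mem a b)
  fix m p assume p: "p \<in> seminorms X"
  obtain C D where C: "\<And>n. p (a n) * bracket n ^ m \<le> C" and D: "\<And>n. p (b n) * bracket n ^ m \<le> D"
    using a b p unfolding rapid_def by meson
  have "p (a n + b n) * bracket n ^ m \<le> C + D" for n
  proof -
    have "p (a n + b n) * bracket n ^ m \<le> (p (a n) + p (b n)) * bracket n ^ m"
      using bracket_pos[of n] by (intro mult_right_mono sn_add p rapid_mem a b) simp
    then show ?thesis using C[of n] D[of n] by (simp add: distrib_right)
  qed
  then show "\<exists>C. \<forall>n. p (a n + b n) * bracket n ^ m \<le> C" by blast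
qed

lemma rapid_finite:
  assumes "finite N" "\<And>n. n \<in> N \<Longrightarrow> a n \<in> points X"
  shows "rapid (\<lambda>n. if n \<in> N then a n else 0)"
  unfolding rapid_def
proof (intro conjI allI ballI)
  show "(if n \<in> N then a n else 0) \<in> points X" for n using assms zero_mem by simp
  fix m p assume p: "p \<in> seminorms X"
  have "p (if n \<in> N then a n else 0) * bracket n ^ m \<le> (\<Sum>n\<in>N. p (a n) * bracket n ^ m)" for n
    using assms p bracket_pos sn_nonneg[OF p]
    by (auto simp: sn_zero intro!: member_le_sum sum_nonneg mult_nonneg_nonneg zero_le_power less_imp_le[OF bracket_pos])
  then show "\<exists>C. \<forall>n. p (if n \<in> N then a n else 0) * bracket n ^ m \<le> C" by blast
qed

lemma rapid_if:
  assumes "rapid a"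
  shows "rapid (\<lambda>n. if n \<in> N then a n else 0)"
proof -
  have "rapid (\<lambda>n. (if n \<in> N then 1 else 0) *\<^sub>C a n)"
    by (rule rapid_multiplier[OF assms, of _ 1 0]) auto
  moreover have "(\<lambda>n. (if n \<in> N then 1 else 0) *\<^sub>C a n) = (\<lambda>n. if n \<in> N then a n else 0)"
    by auto
  ultimately show ?thesis by simp
qed

definition series_limit :: "('i \<Rightarrow> 'a) \<Rightarrow> 'a" where
  "series_limit a = (THE s. limitin (lc_topology X) (sum a) s (finite_subsets_at_top UNIV))"

end

context lc_hausdorff
begin

lemma series_limitI:
  "limitin (lc_topology X) (sum a) s (finite_subsets_at_top UNIV) \<Longrightarrow> series_limit a = s"
  unfolding series_limit_def
  by (rule the_equality) (auto intro: lc_limit_unique finite_subsets_at_top_neq_bot)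

lemma series_limit_bound:
  assumes lim: "limitin (lc_topology X) (sum a) s (finite_subsets_at_top UNIV)"
    and a: "\<And>n. a n \<in> points X" and p: "p \<in> seminorms X" and sm: "(\<lambda>n. p (a n)) summable_on UNIV"
  shows "p s \<le> infsum (\<lambda>n. p (a n)) UNIV"
proof (rule tendsto_lowerbound)
  have s: "s \<in> points X" using limitin_lcD(1)[OF lim] .
  show "((\<lambda>N. p (sum a N - s) + infsum (\<lambda>n. p (a n)) UNIV) \<longlongrightarrow> infsum (\<lambda>n. p (a n)) UNIV) (finite_subsets_at_top UNIV)"
    using tendsto_add[OF limitin_lcD(3)[OF lim p] tendsto_const] by simp
  show "\<forall>\<^sub>F N in finite_subsets_at_top UNIV. p s \<le> p (sum a N - s) + infsum (\<lambda>n. p (a n)) UNIV"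
    unfolding eventually_finite_subsets_at_top
  proof (intro exI[of _ "{}"] conjI allI impI)
    fix N :: "'b set" assume "finite N \<and> {} \<subseteq> N \<and> N \<subseteq> UNIV"
    then have N: "finite N" by simp
    have m: "sum a N \<in> points X" by (intro sum_mem a)
    have "p s \<le> p (s - sum a N) + p (sum a N)"
      using sn_add[OF p diff_mem[OF s m] m] by simp
    also have "p (s - sum a N) = p (sum a N - s)" by (rule sn_diff_commute[OF p s m])
    also have "p (sum a N) \<le> (\<Sum>n\<in>N. p (a n))" by (intro sn_sum p a)
    also have "\<dots> \<le> infsum (\<lambda>n. p (a n)) UNIV"
      using N sm sn_nonneg[OF p a] by (intro finite_sum_le_infsum) auto
    finally show "p s \<le> p (sum a N - s) + infsum (\<lambda>n. p (a n)) UNIV" by simp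
  qed auto
qed (rule finite_subsets_at_top_neq_bot)

lemma limitin_add:
  assumes "limitin (lc_topology X) f l F" "limitin (lc_topology X) g m F"
  shows "limitin (lc_topology X) (\<lambda>k. f k + g k) (l + m) F"
proof (rule limitin_lcI)
  note D = limitin_lcD[OF assms(1)] limitin_lcD[OF assms(2)]
  show "l + m \<in> points X" using D by (intro add_mem)
  show ev: "\<forall>\<^sub>F k in F. f k + g k \<in> points X"
    using D(2,5) by eventually_elim (rule add_mem)
  fix p assume p: "p \<in> seminorms X"
  show "((\<lambda>k. p (f k + g k - (l + m))) \<longlongrightarrow> 0) F"
  proof (rule tendsto_sandwich[of "\<lambda>_. 0" _ _ "\<lambda>k. p (f k - l) + p (g k - m)"])
    show "\<forall>\<^sub>F k in F. 0 \<le> p (f k + g k - (l + m))"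
      using ev by eventually_elim (rule sn_nonneg[OF p diff_mem[OF _ add_mem[OF D(1,4)]]])
    show "\<forall>\<^sub>F k in F. p (f k + g k - (l + m)) \<le> p (f k - l) + p (g k - m)"
      using D(2,5)
    proof eventually_elim
      case (elim k)
      then show ?case
        using sn_add[OF p diff_mem[OF elim(1) D(1)] diff_mem[OF elim(2) D(4)]] by (simp add: algebra_simps)
    qed
    show "((\<lambda>k. p (f k - l) + p (g k - m)) \<longlongrightarrow> 0) F"
      using tendsto_add[OF D(3)[OF p] D(6)[OF p]] by simp
  qed simp
qed

lemma limitin_scale:
  assumes "limitin (lc_topology X) f l F"
  shows "limitin (lc_topology X) (\<lambda>k. c *\<^sub>C f k) (c *\<^sub>C l) F"
proof (rule limitin_lcI)
  note D = limitin_lcD[OF assms(1)]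
  show "c *\<^sub>C l \<in> points X" using D by (intro scale_mem)
  show "\<forall>\<^sub>F k in F. c *\<^sub>C f k \<in> points X"
    using D(2) by eventually_elim (rule scale_mem)
  fix p assume p: "p \<in> seminorms X"
  have ev: "\<forall>\<^sub>F k in F. norm c * p (f k - l) = p (c *\<^sub>C f k - c *\<^sub>C l)"
    using D(2)
    by eventually_elim (use sn_scale[OF p diff_mem[OF _ D(1)]] in \<open>simp add: complex_vector.scale_right_diff_distrib\<close>)
  have "((\<lambda>k. norm c * p (f k - l)) \<longlongrightarrow> norm c * 0) F"
    by (intro tendsto_mult tendsto_const D(3) p)
  from Lim_transform_eventually[OF this ev]
  show "((\<lambda>k. p (c *\<^sub>C f k - c *\<^sub>C l)) \<longlongrightarrow> 0) F"
    by simp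
qed

end

context lc_complete
begin

text \<open>The limit is produced along the sequence N k. Finite sums off N k are of order 2^-k, and
  this bound, uniform in the finite set, carries the limit over to the net of all finite
  sets.\<close>

lemma rapid_series_converges:
  fixes a :: "int^'d \<Rightarrow> 'a"
  assumes a: "rapid a"
  shows "limitin (lc_topology X) (sum a) (series_limit a) (finite_subsets_at_top UNIV)"
proof -
  define N where "N k = {n :: int^'d. bracket n \<le> 2 ^ k}" for k :: nat
  have finN: "finite (N k)" for k unfolding N_def by (rule finite_bracket_le)
  define S where "S = bracket_sum TYPE('d)"
  note mem = rapid_mem[OF a]
  have "\<exists>C. \<forall>k M. finite M \<longrightarrow> M \<inter> N k = {} \<longrightarrow> p (sum a M) \<le> C * (1 / 2) ^ k"
    if p: "p \<in> seminorms X" for p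
  proof -
    \<comment> \<open>One power of the bracket yields 2^-k off N k, the others make the series
      converge.\<close>
    obtain C where C: "\<And>n. p (a n) * bracket n ^ (1 + CARD('d)) \<le> C"
      using a p unfolding rapid_def by blast
    have C0: "0 \<le> C"
      using C[of 0] sn_nonneg[OF p mem[of 0]] by (simp add: bracket_def)
    have "p (sum a M) \<le> C * S * (1 / 2) ^ k" if "finite M" "M \<inter> N k = {}" for M k
    proof -
      have "p (sum a M) \<le> (\<Sum>n\<in>M. p (a n))" by (intro sn_sum p mem)
      also have "\<dots> \<le> (\<Sum>n\<in>M. C * (1 / 2) ^ k * (1 / bracket n ^ CARD('d)))"
      proof (rule sum_mono)
        fix n assume "n \<in> M"
        then have "2 ^ k \<le> bracket n" using that by (auto simp: N_def)
        then have "p (a n) * bracket n ^ CARD('d) * 2 ^ k \<le> p (a n) * bracket n ^ CARD('d) * bracket n"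
          using sn_nonneg[OF p mem[of n]] bracket_pos[of n] by (intro mult_left_mono) auto
        also have "\<dots> \<le> C" using C[of n] by (simp add: mult_ac)
        finally show "p (a n) \<le> C * (1 / 2) ^ k * (1 / bracket n ^ CARD('d))"
          using bracket_pos[of n] by (simp add: field_simps)
      qed
      also have "\<dots> = C * (1 / 2) ^ k * (\<Sum>n\<in>M. 1 / bracket n ^ CARD('d))"
        by (simp only: sum_distrib_left)
      also have "\<dots> \<le> C * (1 / 2) ^ k * S"
        unfolding S_def bracket_sum_def
        using that C0 bracket_pos
        by (intro mult_left_mono finite_sum_le_infsum summable_bracket) (auto simp: less_imp_le)
      finally show ?thesis by (simp add: mult_ac)
    qed
    then show ?thesis by blast
  qed
  then obtain C where C: "\<And>p k M. p \<in> seminorms X \<Longrightarrow> finite M \<Longrightarrow> M \<inter> N k = {} \<Longrightarrow>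
      p (sum a M) \<le> C p * (1 / 2) ^ k"
    by metis
  have diff: "p (sum a M - sum a (N k)) \<le> C p * (1 / 2) ^ k"
    if "p \<in> seminorms X" "finite M" "N k \<subseteq> M" for p M k
  proof -
    have "sum a M - sum a (N k) = sum a (M - N k)"
      using that by (subst sum_diff) auto
    then show ?thesis using C[OF that(1), of "M - N k" k] that by auto
  qed
  have "\<exists>l. limitin (lc_topology X) (\<lambda>k. sum a (N k)) l sequentially"
  proof (rule fast_Cauchy_convergent)
    show "sum a (N k) \<in> points X" for k by (intro sum_mem mem)
    fix p assume p: "p \<in> seminorms X"
    have "N k \<subseteq> N (Suc k)" for k
      unfolding N_def by (auto elim: order_trans)
    then show "\<exists>C. \<forall>k. p (sum a (N (Suc k)) - sum a (N k)) \<le> C * (1 / 2) ^ k"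
      using diff[OF p finN] by blast
  qed
  then obtain l where l: "limitin (lc_topology X) (\<lambda>k. sum a (N k)) l sequentially" ..
  have "limitin (lc_topology X) (sum a) l (finite_subsets_at_top UNIV)"
  proof (rule limitin_lcI)
    show lX: "l \<in> points X" using limitin_lcD(1)[OF l] .
    show "\<forall>\<^sub>F M in finite_subsets_at_top UNIV. sum a M \<in> points X"
      by (intro always_eventually allI sum_mem mem)
    fix p assume p: "p \<in> seminorms X"
    show "((\<lambda>M. p (sum a M - l)) \<longlongrightarrow> 0) (finite_subsets_at_top UNIV)"
    proof (rule order_tendstoI)
      fix e :: real assume "e < 0"
      then show "\<forall>\<^sub>F M in finite_subsets_at_top UNIV. e < p (sum a M - l)"
        by (intro always_eventually allI less_le_trans[OF _ sn_nonneg[OF p diff_mem[OF sum_mem[OF mem] lX]]])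
    next
      fix e :: real assume e: "e > 0"
      have "(\<lambda>k. C p * (1 / 2) ^ k + p (sum a (N k) - l)) \<longlonglongrightarrow> C p * 0 + 0"
        by (intro tendsto_add tendsto_mult tendsto_const LIMSEQ_power_zero limitin_lcD(3)[OF l p]) auto
      then have "\<forall>\<^sub>F k in sequentially. C p * (1 / 2) ^ k + p (sum a (N k) - l) < e"
        using e by (simp add: order_tendsto_iff)
      then obtain k where k: "C p * (1 / 2) ^ k + p (sum a (N k) - l) < e"
        by (auto simp: eventually_sequentially)
      show "\<forall>\<^sub>F M in finite_subsets_at_top UNIV. p (sum a M - l) < e"
        unfolding eventually_finite_subsets_at_top
      proof (intro exI[of _ "N k"] conjI allI impI finN subset_UNIV)
        fix M assume "finite M \<and> N k \<subseteq> M \<and> M \<subseteq> UNIV"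
        then have "p (sum a M - sum a (N k)) \<le> C p * (1 / 2) ^ k" using diff[OF p] by blast
        moreover have "p (sum a M - l) \<le> p (sum a M - sum a (N k)) + p (sum a (N k) - l)"
          by (intro sn_triangle p sum_mem mem lX)
        ultimately show "p (sum a M - l) < e" using k by linarith
      qed
    qed
  qed
  then show ?thesis using series_limitI by metis
qed

lemma series_limit_mem: "rapid a \<Longrightarrow> series_limit a \<in> points X"
  using limitin_lcD(1)[OF rapid_series_converges] .

lemma sn_series_limit:
  assumes a: "rapid a" and p: "p \<in> seminorms X"
  shows "p (series_limit a) \<le> infsum (\<lambda>n. p (a n)) UNIV"
  by (rule series_limit_bound[OF rapid_series_converges[OF a] rapid_mem[OF a] p rapid_summable0[OF a p]])

lemma series_limit_add:
  assumes a: "rapid a" and b: "rapid b"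
  shows "series_limit (\<lambda>n. a n + b n) = series_limit a + series_limit b"
proof (rule series_limitI)
  have "sum (\<lambda>n. a n + b n) = (\<lambda>N. sum a N + sum b N)"
    by (simp add: fun_eq_iff sum.distrib)
  then show "limitin (lc_topology X) (sum (\<lambda>n. a n + b n)) (series_limit a + series_limit b)
      (finite_subsets_at_top UNIV)"
    using limitin_add[OF rapid_series_converges[OF a] rapid_series_converges[OF b]] by simp
qed

lemma series_limit_scale:
  assumes a: "rapid a"
  shows "series_limit (\<lambda>n. c *\<^sub>C a n) = c *\<^sub>C series_limit a"
proof (rule series_limitI)
  have "sum (\<lambda>n. c *\<^sub>C a n) = (\<lambda>N. c *\<^sub>C sum a N)"
    by (simp add: fun_eq_iff complex_vector.scale_sum_right)
  then show "limitin (lc_topology X) (sum (\<lambda>n. c *\<^sub>C a n)) (c *\<^sub>C series_limit a)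
      (finite_subsets_at_top UNIV)"
    using limitin_scale[OF rapid_series_converges[OF a], of c] by simp
qed

lemma series_limit_finite:
  assumes N: "finite N" and a: "\<And>n. n \<in> N \<Longrightarrow> a n \<in> points X" and z: "\<And>n. n \<notin> N \<Longrightarrow> a n = 0"
  shows "series_limit a = sum a N"
proof (rule series_limitI, rule limitin_lcI)
  have mem: "a n \<in> points X" for n using a[of n] z[of n] zero_mem by (cases "n \<in> N") auto
  show "sum a N \<in> points X" by (intro sum_mem mem)
  show "\<forall>\<^sub>F M in finite_subsets_at_top UNIV. sum a M \<in> points X"
    by (intro always_eventually allI sum_mem mem)
  fix p assume p: "p \<in> seminorms X"
  have "\<forall>\<^sub>F M in finite_subsets_at_top UNIV. 0 = p (sum a M - sum a N)"
    unfolding eventually_finite_subsets_at_top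
  proof (intro exI[of _ N] conjI allI impI N subset_UNIV)
    fix M assume "finite M \<and> N \<subseteq> M \<and> M \<subseteq> UNIV"
    then have "sum a M = sum a N" using z by (intro sum.mono_neutral_right) auto
    then show "0 = p (sum a M - sum a N)" by (simp add: sn_zero[OF p])
  qed
  then show "((\<lambda>M. p (sum a M - sum a N)) \<longlongrightarrow> 0) (finite_subsets_at_top UNIV)"
    using tendsto_const tendsto_cong by fast
qed

lemma dual_series_limit:
  assumes a: "rapid a" and \<phi>: "\<phi> \<in> dual X"
  shows "((\<lambda>n. \<phi> (a n)) has_sum \<phi> (series_limit a)) UNIV"
proof -
  have "((\<lambda>N. \<phi> (sum a N)) \<longlongrightarrow> \<phi> (series_limit a)) (finite_subsets_at_top UNIV)"
    by (rule dual_limit[OF \<phi> rapid_series_converges[OF a]])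
  then show ?thesis
    by (simp add: has_sum_def dual_sum[OF \<phi> rapid_mem[OF a]])
qed

end

section \<open>Smooth functions and Fourier synthesis\<close>

text \<open>Taylor's formula gives |exp z - 1 - z| \<le> |z|^2 for imaginary z. The error is uniform
  in x, and its growth in n is absorbed by one power of the bracket.\<close>

lemma torus_char_linear_approx:
  "norm (torus_char n (x + h *\<^sub>R axis i 1) - torus_char n x - of_real h * (\<i> * of_int (n $ i) * torus_char n x))
    \<le> (real_of_int (n $ i))\<^sup>2 * h\<^sup>2"
proof -
  define z where "z = \<i> * complex_of_real (of_int (n $ i) * h)"
  have ax: "h *\<^sub>R axis i 1 = (axis i h :: real^'a)" by (auto simp: vec_eq_iff axis_def)
  have "torus_char n (x + h *\<^sub>R axis i 1) - torus_char n x - of_real h * (\<i> * of_int (n $ i) * torus_char n x)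
      = torus_char n x * (exp z - (1 + z))"
    unfolding ax torus_char_add_right torus_char_axis z_def by (simp add: algebra_simps)
  then have "norm (torus_char n (x + h *\<^sub>R axis i 1) - torus_char n x - of_real h * (\<i> * of_int (n $ i) * torus_char n x))
      = norm (exp z - (1 + z))"
    by (simp add: norm_mult)
  also have "\<dots> \<le> (norm z)\<^sup>2"
    using Taylor_exp[of z 1] by (simp add: z_def numeral_2_eq_2)
  also have "\<dots> = (real_of_int (n $ i))\<^sup>2 * h\<^sup>2"
    by (simp add: z_def norm_mult power_mult_distrib)
  finally show ?thesis .
qed

lemma has_sum_tail_bound:
  fixes h :: "'i \<Rightarrow> complex"
  assumes h: "(h has_sum s) UNIV" and b: "\<And>x. norm (h x) \<le> b x" "b summable_on UNIV" and N: "finite N"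
  shows "norm (s - sum h N) \<le> tail_sum b N"
proof (rule tendsto_upperbound)
  show "((\<lambda>M. norm (sum h M - sum h N)) \<longlongrightarrow> norm (s - sum h N)) (finite_subsets_at_top UNIV)"
    using h unfolding has_sum_def by (intro tendsto_intros)
  show "\<forall>\<^sub>F M in finite_subsets_at_top UNIV. norm (sum h M - sum h N) \<le> tail_sum b N"
    unfolding eventually_finite_subsets_at_top
  proof (intro exI[of _ N] conjI allI impI N subset_UNIV)
    fix M assume M: "finite M \<and> N \<subseteq> M \<and> M \<subseteq> UNIV"
    then have "sum h M - sum h N = sum h (M - N)" by (subst sum_diff) auto
    then have "norm (sum h M - sum h N) \<le> (\<Sum>x\<in>M - N. b x)"
      using b(1) by (simp add: sum_norm_le)
    also have "\<dots> \<le> tail_sum b N"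
      using M N b order_trans[OF norm_ge_zero b(1)] by (intro tail_sum_bound) auto
    finally show "norm (sum h M - sum h N) \<le> tail_sum b N" .
  qed
qed (rule finite_subsets_at_top_neq_bot)

section \<open>Partial derivatives in a Hausdorff space\<close>

context lc_hausdorff
begin

lemma partial_eqI: "has_partial X i f x y \<Longrightarrow> partial X i f x = y"
  unfolding partial_def has_partial_def
  by (rule the_equality) (auto intro: lc_limit_unique trivial_limit_at)

lemma dual_has_partial:
  assumes \<phi>: "\<phi> \<in> dual X" and f: "\<And>x. f x \<in> points X" and part: "has_partial X i f x y"
  shows "has_partial scalar_lcs i (\<lambda>x. \<phi> (f x)) x (\<phi> y)"
proof -
  have "((\<lambda>h. \<phi> (complex_of_real (1 / h) *\<^sub>C (f (x + h *\<^sub>R axis i 1) - f x))) \<longlongrightarrow> \<phi> y) (at 0)"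
    using part unfolding has_partial_def by (rule dual_limit[OF \<phi>])
  then show ?thesis
    unfolding has_partial_def lc_topology_scalar
    by (simp add: dual_scale[OF \<phi> diff_mem[OF f f]] dual_diff[OF \<phi> f f] scaleC_complex_def)
qed

lemma dual_continuous_on:
  assumes "\<phi> \<in> dual X" "continuous_map euclidean (lc_topology X) f"
  shows "continuous_on UNIV (\<lambda>x. \<phi> (f x))"
  using continuous_map_compose[OF assms(2) dual_continuous_map[OF assms(1)]] by (simp add: o_def)

lemma C_infinity_continuous: "C_infinity X f \<Longrightarrow> continuous_map euclidean (lc_topology X) f"
  unfolding C_infinity_def by (drule spec[of _ 0]) simp

lemma C_infinity_mem: "C_infinity X f \<Longrightarrow> f x \<in> points X"
  by (rule continuous_map_euclideanD(1)[OF C_infinity_continuous])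

lemma C_infinity_has_partial:
  assumes "C_infinity X f"
  shows "has_partial X i f x (partial X i f x)"
proof -
  have "C_k X (Suc 0) f" using assms unfolding C_infinity_def by blast
  then obtain y where "has_partial X i f x y" unfolding C_k.simps by blast
  then show ?thesis using partial_eqI by metis
qed

lemma C_infinity_partial: "C_infinity X f \<Longrightarrow> C_infinity X (partial X i f)"
  unfolding C_infinity_def
proof
  fix k assume "\<forall>k. C_k X k f"
  then have "C_k X (Suc k) f" by blast
  then show "C_k X k (partial X i f)" unfolding C_k.simps by blast
qed

lemma periodic_partial:
  assumes "\<And>j x. f (x + axis j (2 * pi)) = f x"
  shows "partial X i f (x + axis j (2 * pi)) = partial X i f x"
proof -
  have "f (x + axis j (2 * pi) + h *\<^sub>R axis i 1) = f (x + h *\<^sub>R axis i 1)" for h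
    using assms[of "x + h *\<^sub>R axis i 1" j] by (simp add: algebra_simps)
  then show ?thesis unfolding partial_def has_partial_def by (simp add: assms)
qed

end

section \<open>Fourier synthesis and its derivatives\<close>

context lc_complete
begin

definition synth :: "(int^'d::finite \<Rightarrow> 'a) \<Rightarrow> real^'d \<Rightarrow> 'a" where
  "synth a x = series_limit (\<lambda>n. torus_char n x *\<^sub>C a n)"

lemma rapid_char: "rapid a \<Longrightarrow> rapid (\<lambda>n. torus_char n x *\<^sub>C a n)"
  by (rule rapid_multiplier[of _ _ 1 0]) auto

lemma rapid_derivative: "rapid a \<Longrightarrow> rapid (\<lambda>n. (\<i> * of_int (n $ i)) *\<^sub>C a n)"
  by (rule rapid_multiplier[of _ _ 1 1]) (auto simp: norm_mult component_le_bracket)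

lemma synth_mem: "rapid a \<Longrightarrow> synth a x \<in> points X"
  unfolding synth_def by (intro series_limit_mem rapid_char)

lemma synth_add: "rapid a \<Longrightarrow> rapid b \<Longrightarrow> synth (\<lambda>n. a n + b n) x = synth a x + synth b x"
  unfolding synth_def
  by (simp add: scaleC_add_right series_limit_add[OF rapid_char rapid_char])

lemma synth_scale: "rapid a \<Longrightarrow> synth (\<lambda>n. c *\<^sub>C a n) x = c *\<^sub>C synth a x"
  unfolding synth_def
  by (subst series_limit_scale[OF rapid_char, symmetric]) (simp_all add: scaleC_scaleC mult.commute)

text \<open>Continuity, differentiability and the seminorm bounds of syntheses are instances of this
  estimate, with c a difference of characters, a Taylor remainder, or a character times a derivative
  symbol.\<close>

lemma series_limit_multiplier_bound:
  assumes a: "rapid a" and c: "\<And>n. norm (c n) \<le> B * bracket n ^ k" and p: "p \<in> seminorms X"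
  shows "p (series_limit (\<lambda>n. c n *\<^sub>C a n)) \<le> B * infsum (\<lambda>n. p (a n) * bracket n ^ k) UNIV"
proof -
  have r: "rapid (\<lambda>n. c n *\<^sub>C a n)" by (rule rapid_multiplier[OF a c])
  have "p (series_limit (\<lambda>n. c n *\<^sub>C a n)) \<le> infsum (\<lambda>n. p (c n *\<^sub>C a n)) UNIV"
    by (rule sn_series_limit[OF r p])
  also have "\<dots> \<le> infsum (\<lambda>n. B * (p (a n) * bracket n ^ k)) UNIV"
  proof (rule infsum_mono)
    show "(\<lambda>n. p (c n *\<^sub>C a n)) summable_on UNIV" by (rule rapid_summable0[OF r p])
    show "(\<lambda>n. B * (p (a n) * bracket n ^ k)) summable_on UNIV"
      by (intro summable_on_cmult_right rapid_summable a p)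
    show "p (c n *\<^sub>C a n) \<le> B * (p (a n) * bracket n ^ k)" for n
      using mult_right_mono[OF c[of n] sn_nonneg[OF p rapid_mem[OF a, of n]]]
      by (simp add: sn_scale[OF p rapid_mem[OF a]] mult_ac)
  qed
  also have "\<dots> = B * infsum (\<lambda>n. p (a n) * bracket n ^ k) UNIV"
    by (rule infsum_cmult_right')
  finally show ?thesis .
qed

lemma series_limit_multiplier_add:
  assumes a: "rapid a" and c: "\<And>n. norm (c n) \<le> B * bracket n ^ k"
    and c': "\<And>n. norm (c' n) \<le> B' * bracket n ^ k'"
  shows "series_limit (\<lambda>n. (c n + r * c' n) *\<^sub>C a n)
    = series_limit (\<lambda>n. c n *\<^sub>C a n) + r *\<^sub>C series_limit (\<lambda>n. c' n *\<^sub>C a n)"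
proof -
  have r: "rapid (\<lambda>n. c n *\<^sub>C a n)" "rapid (\<lambda>n. c' n *\<^sub>C a n)"
    by (rule rapid_multiplier[OF a c], rule rapid_multiplier[OF a c'])
  have r2: "rapid (\<lambda>n. r *\<^sub>C c' n *\<^sub>C a n)"
    by (rule rapid_multiplier[OF r(2), of _ "norm r" 0]) simp
  show ?thesis
    by (simp add: scaleC_add_left series_limit_add[OF r(1) r2] series_limit_scale[OF r(2)]
        flip: scaleC_scaleC)
qed

lemma synth_continuous:
  assumes a: "rapid a"
  shows "continuous_map euclidean (lc_topology X) (synth a)"
proof (rule continuous_map_euclideanI)
  show "synth a x \<in> points X" for x by (rule synth_mem[OF a])
  fix p x assume p: "p \<in> seminorms X"
  define C where "C = infsum (\<lambda>n. p (a n) * bracket n ^ 1) UNIV"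
  have le: "p (synth a y - synth a x) \<le> norm (y - x) * C" for y
  proof -
    have "synth a y - synth a x = series_limit (\<lambda>n. (torus_char n y + (- 1) * torus_char n x) *\<^sub>C a n)"
      unfolding synth_def by (subst series_limit_multiplier_add[OF a, of _ 1 0 _ 1 0]) auto
    also have "p \<dots> \<le> norm (y - x) * C"
      unfolding C_def
    proof (rule series_limit_multiplier_bound[OF a _ p])
      fix n
      have "norm (torus_char n y + (- 1) * torus_char n x) \<le> norm (real_vec n) * norm (y - x)"
        using torus_char_lipschitz[of n y x] by simp
      also have "\<dots> \<le> bracket n * norm (y - x)" by (intro mult_right_mono norm_le_bracket) simp
      finally show "norm (torus_char n y + (- 1) * torus_char n x) \<le> norm (y - x) * bracket n ^ 1"
        by (simp add: mult.commute)
    qed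
    finally show ?thesis .
  qed
  show "((\<lambda>y. p (synth a y - synth a x)) \<longlongrightarrow> 0) (at x)"
  proof (rule tendsto_sandwich[of "\<lambda>_. 0" _ _ "\<lambda>y. norm (y - x) * C"])
    have "((\<lambda>y. norm (y - x) * C) \<longlongrightarrow> norm (x - x) * C) (at x)" by (intro tendsto_intros)
    then show "((\<lambda>y. norm (y - x) * C) \<longlongrightarrow> 0) (at x)" by simp
    show "\<forall>\<^sub>F y in at x. 0 \<le> p (synth a y - synth a x)"
      by (intro always_eventually allI sn_nonneg p diff_mem synth_mem a)
  qed (auto intro: always_eventually le)
qed

lemma synth_has_partial:
  assumes a: "rapid a"
  shows "has_partial X i (synth a) x (synth (\<lambda>n. (\<i> * of_int (n $ i)) *\<^sub>C a n) x)"
  unfolding has_partial_def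
proof (rule limitin_lcI)
  let ?a' = "\<lambda>n. (\<i> * of_int (n $ i)) *\<^sub>C a n"
  have a': "rapid ?a'" by (rule rapid_derivative[OF a])
  show m1: "synth ?a' x \<in> points X" by (rule synth_mem[OF a'])
  show "\<forall>\<^sub>F h in at 0. complex_of_real (1 / h) *\<^sub>C (synth a (x + h *\<^sub>R axis i 1) - synth a x) \<in> points X"
    by (intro always_eventually allI scale_mem diff_mem synth_mem a)
  fix p assume p: "p \<in> seminorms X"
  define C where "C = infsum (\<lambda>n. p (a n) * bracket n ^ 1) UNIV"
  have le: "p (complex_of_real (1 / h) *\<^sub>C (synth a (x + h *\<^sub>R axis i 1) - synth a x) - synth ?a' x) \<le> \<bar>h\<bar> * C"
    if h: "h \<noteq> 0" for h
  proof -
    let ?y = "x + h *\<^sub>R axis i 1"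
    let ?d = "\<lambda>n. torus_char n ?y + (- 1) * torus_char n x"
    \<comment> \<open>The first order Taylor remainder of e_n at x. It is at most h^2 times the
      bracket, so division by h still leaves a factor |h|.\<close>
    let ?e = "\<lambda>n. ?d n + (- of_real h) * (\<i> * of_int (n $ i) * torus_char n x)"
    have d: "norm (?d n) \<le> 2 * bracket n ^ 0" for n
      using norm_triangle_ineq4[of "torus_char n ?y" "torus_char n x"] by simp
    have e': "norm (\<i> * of_int (n $ i) * torus_char n x) \<le> 1 * bracket n ^ 1" for n
      using component_le_bracket[of n i] by (simp add: norm_mult)
    have e: "norm (?e n) \<le> h\<^sup>2 * bracket n ^ 1" for n
    proof -
      have "norm (?e n) \<le> (real_of_int (n $ i))\<^sup>2 * h\<^sup>2"
        using torus_char_linear_approx[of n x h i] by simp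
      also have "\<dots> \<le> bracket n * h\<^sup>2"
        using component_square_le_bracket[of n i] by (intro mult_right_mono) auto
      finally show ?thesis by (simp add: mult.commute)
    qed
    have s': "synth ?a' x = series_limit (\<lambda>n. (\<i> * of_int (n $ i) * torus_char n x) *\<^sub>C a n)"
      unfolding synth_def by (simp add: scaleC_scaleC mult_ac)
    have "synth a ?y - synth a x = series_limit (\<lambda>n. ?d n *\<^sub>C a n)"
      unfolding synth_def by (subst series_limit_multiplier_add[OF a, of _ 1 0 _ 1 0]) auto
    moreover have "series_limit (\<lambda>n. ?e n *\<^sub>C a n)
        = series_limit (\<lambda>n. ?d n *\<^sub>C a n) + (- of_real h) *\<^sub>C synth ?a' x"
      unfolding s' by (rule series_limit_multiplier_add[OF a d e'])
    ultimately have "complex_of_real (1 / h) *\<^sub>C (synth a ?y - synth a x) - synth ?a' x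
        = complex_of_real (1 / h) *\<^sub>C series_limit (\<lambda>n. ?e n *\<^sub>C a n)"
      using h by (simp add: scaleC_add_right scaleC_scaleC complex_vector.scale_right_diff_distrib
          del: of_real_divide flip: of_real_mult)
    then have "p (complex_of_real (1 / h) *\<^sub>C (synth a ?y - synth a x) - synth ?a' x)
        = p (series_limit (\<lambda>n. ?e n *\<^sub>C a n)) / \<bar>h\<bar>"
      using sn_scale[OF p series_limit_mem[OF rapid_multiplier[OF a e]], of "complex_of_real (1 / h)"]
      by (simp add: norm_divide)
    also have "\<dots> \<le> (h\<^sup>2 * C) / \<bar>h\<bar>"
      unfolding C_def by (intro divide_right_mono series_limit_multiplier_bound[OF a e p]) simp
    also have "\<dots> = \<bar>h\<bar> * C"
      using h by (simp add: power2_eq_square field_simps abs_if)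
    finally show ?thesis .
  qed
  show "((\<lambda>h. p (complex_of_real (1 / h) *\<^sub>C (synth a (x + h *\<^sub>R axis i 1) - synth a x) - synth ?a' x)) \<longlongrightarrow> 0) (at 0)"
  proof (rule tendsto_sandwich[of "\<lambda>_. 0" _ _ "\<lambda>h. \<bar>h\<bar> * C"])
    have "((\<lambda>h. \<bar>h\<bar> * C) \<longlongrightarrow> \<bar>0\<bar> * C) (at 0)" by (intro tendsto_intros)
    then show "((\<lambda>h. \<bar>h\<bar> * C) \<longlongrightarrow> 0) (at 0)" by simp
    show "\<forall>\<^sub>F h in at 0. 0 \<le> p (complex_of_real (1 / h) *\<^sub>C (synth a (x + h *\<^sub>R axis i 1) - synth a x) - synth ?a' x)"
      by (intro always_eventually allI sn_nonneg p diff_mem scale_mem synth_mem a a')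
    show "\<forall>\<^sub>F h in at 0. p (complex_of_real (1 / h) *\<^sub>C (synth a (x + h *\<^sub>R axis i 1) - synth a x) - synth ?a' x) \<le> \<bar>h\<bar> * C"
      using le by (simp add: eventually_at_filter)
  qed simp
qed

lemma partial_synth:
  "rapid a \<Longrightarrow> partial X i (synth a) = synth (\<lambda>n. (\<i> * of_int (n $ i)) *\<^sub>C a n)"
  by (intro ext partial_eqI synth_has_partial)

lemma synth_C_infinity:
  assumes "rapid a"
  shows "C_infinity X (synth a)"
proof -
  have "C_k X k (synth a)" if "rapid a" for k and a :: "int^'b \<Rightarrow> 'a"
    using that
  proof (induction k arbitrary: a)
    case 0
    then show ?case by (simp add: synth_continuous)
  next
    case (Suc k)
    then show ?case
      using synth_has_partial[OF Suc.prems] Suc.IH[OF rapid_derivative[OF Suc.prems]]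
      by (auto simp: partial_synth)
  qed
  then show ?thesis using assms by (simp add: C_infinity_def)
qed

lemma synth_periodic: "synth a (x + axis i (2 * pi)) = synth a x"
  by (simp add: synth_def torus_char_periodic)

lemma synth_smooth_periodic: "rapid a \<Longrightarrow> synth a \<in> points (smooth_periodic X)"
  by (simp add: smooth_periodic_def synth_C_infinity synth_periodic)

definition derivative_symbol :: "('d::{finite,linorder} \<Rightarrow> nat) \<Rightarrow> int^'d::{finite,linorder} \<Rightarrow> complex" where
  "derivative_symbol \<beta> n = (\<Prod>i\<in>UNIV. (\<i> * of_int (n $ i)) ^ \<beta> i)"

lemma norm_derivative_symbol:
  assumes "(\<Sum>i\<in>UNIV. \<beta> i) \<le> m"
  shows "norm (derivative_symbol \<beta> n) \<le> 1 * bracket n ^ m"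
proof -
  have "norm (derivative_symbol \<beta> n) \<le> (\<Prod>i\<in>UNIV. bracket n ^ \<beta> i)"
    unfolding derivative_symbol_def prod_norm[symmetric]
    by (intro prod_mono) (auto simp: norm_power norm_mult intro!: power_mono component_le_bracket)
  also have "\<dots> = bracket n ^ (\<Sum>i\<in>UNIV. \<beta> i)" by (simp add: power_sum)
  also have "\<dots> \<le> bracket n ^ m" by (rule bracket_power_mono[OF assms])
  finally show ?thesis by simp
qed

text \<open>Each derivative multiplies the coefficients by its symbol. The order of coordinates
  fixed in \<open>multi_partial\<close> thus survives only as the order of factors in a commutative
  product.\<close>

lemma multi_partial_synth:
  fixes a :: "int^'d::{finite,linorder} \<Rightarrow> 'a"
  assumes a: "rapid a"
  shows "multi_partial X \<beta> (synth a) = synth (\<lambda>n. derivative_symbol \<beta> n *\<^sub>C a n)"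
proof -
  define s where "s L n = (\<Prod>i\<leftarrow>L. (\<i> * of_int (n $ i)) ^ \<beta> i)" for L and n :: "int^'d::{finite,linorder}"
  have pow: "rapid (\<lambda>n. (\<i> * of_int (n $ i)) ^ k *\<^sub>C b n) \<and>
      (partial X i ^^ k) (synth b) = synth (\<lambda>n. (\<i> * of_int (n $ i)) ^ k *\<^sub>C b n)"
    if b: "rapid b" for k i and b :: "int^'d::{finite,linorder} \<Rightarrow> 'a"
  proof (induction k)
    case 0
    then show ?case using b by simp
  next
    case (Suc k)
    then show ?case
      using partial_synth[of "\<lambda>n. (\<i> * of_int (n $ i)) ^ k *\<^sub>C b n" i]
        rapid_derivative[of "\<lambda>n. (\<i> * of_int (n $ i)) ^ k *\<^sub>C b n" i]
      by (simp add: scaleC_scaleC)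
  qed
  have "rapid (\<lambda>n. s L n *\<^sub>C a n) \<and>
      foldr (\<lambda>i. partial X i ^^ \<beta> i) L (synth a) = synth (\<lambda>n. s L n *\<^sub>C a n)" for L
  proof (induction L)
    case Nil
    then show ?case using a by (simp add: s_def)
  next
    case (Cons i L)
    then show ?case
      using pow[of "\<lambda>n. s L n *\<^sub>C a n" i "\<beta> i"] by (simp add: s_def scaleC_scaleC)
  qed
  moreover have "s (sorted_list_of_set UNIV) n = derivative_symbol \<beta> n" for n
    unfolding s_def derivative_symbol_def by (subst prod.distinct_set_conv_list[symmetric]) simp_all
  ultimately show ?thesis by (simp add: multi_partial_def)
qed

end

section \<open>Fourier coefficients\<close>

text \<open>The constants are explicit because two uniform statements rest on them: over all
  functionals dominated by one seminorm, and over a compact set of test functions. The factor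
  CARD('d) stems from the sum of the coordinate distances to the rounded point, each at most
  2^-k.\<close>

lemma riemann_char_error:
  fixes g :: "real^'d \<Rightarrow> complex"
  assumes cont: "continuous_on UNIV g"
    and part: "\<And>i x. x \<in> wide_cube \<Longrightarrow> has_partial scalar_lcs i g x (g' i x)"
    and B': "\<And>i x. x \<in> wide_cube \<Longrightarrow> norm (g' i x) \<le> B'"
    and B: "\<And>x. x \<in> wide_cube \<Longrightarrow> norm (g x) \<le> B"
  shows "norm (torus_mean (\<lambda>x. g x * torus_char (- n) x)
      - (\<Sum>v\<in>grid k. of_real (weight k v) * (g v * torus_char (- n) v)))
    \<le> (B' + B * norm (real_vec n)) * real CARD('d) * (1 / 2) ^ k"
proof (rule riemann_sum_error)
  show "continuous_on UNIV (\<lambda>x. g x * torus_char (- n) x)"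
    by (intro continuous_intros cont)
  fix x :: "real^'d" assume x: "x \<in> cube"
  define y where "y = dyadic k x"
  have xw: "x \<in> wide_cube" and yw: "y \<in> wide_cube"
    using x cube_subset_wide dyadic_in_wide_cube by (auto simp: y_def)
  have "0 \<le> B'" "0 \<le> B"
    using B'[OF xw] B[OF xw] norm_ge_zero order_trans by blast+
  define s where "s = (\<Sum>i\<in>UNIV. \<bar>x $ i - y $ i\<bar>)"
  have "s \<le> (\<Sum>i\<in>(UNIV :: 'd set). (1 / 2) ^ k)"
    unfolding s_def y_def by (intro sum_mono dyadic_close)
  then have s: "s \<le> real CARD('d) * (1 / 2) ^ k" by simp
  have 1: "norm (g x - g y) \<le> B' * s"
    unfolding s_def
    by (rule box_lipschitz[of "\<chi> i. - pi - 1" "\<chi> i. pi + 1" g g' B'])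
      (use part B' xw yw in \<open>simp_all add: wide_cube_def\<close>)
  have "norm (torus_char (- n) x - torus_char (- n) y) \<le> norm (real_vec n) * norm (x - y)"
    using torus_char_lipschitz[of "- n" x y] by (simp add: real_vec_minus)
  also have "\<dots> \<le> norm (real_vec n) * s"
    using norm_le_l1_cart[of "x - y"] by (intro mult_left_mono) (auto simp: s_def)
  finally have 2: "norm (torus_char (- n) x - torus_char (- n) y) \<le> norm (real_vec n) * s" .
  have "g x * torus_char (- n) x - g y * torus_char (- n) y
      = (g x - g y) * torus_char (- n) x + g y * (torus_char (- n) x - torus_char (- n) y)"
    by (simp add: algebra_simps)
  then have "norm (g x * torus_char (- n) x - g y * torus_char (- n) y)
      \<le> norm (g x - g y) + norm (g y) * norm (torus_char (- n) x - torus_char (- n) y)"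
    using norm_triangle_ineq[of "(g x - g y) * torus_char (- n) x" "g y * (torus_char (- n) x - torus_char (- n) y)"]
    by (simp add: norm_mult)
  also have "\<dots> \<le> B' * s + B * (norm (real_vec n) * s)"
    using 1 2 B[OF yw] \<open>0 \<le> B\<close> by (intro add_mono mult_mono) auto
  also have "\<dots> = (B' + B * norm (real_vec n)) * s" by (simp add: algebra_simps)
  also have "\<dots> \<le> (B' + B * norm (real_vec n)) * (real CARD('d) * (1 / 2) ^ k)"
    using s \<open>0 \<le> B'\<close> \<open>0 \<le> B\<close> by (intro mult_left_mono) auto
  finally show "norm (g x * torus_char (- n) x - g (dyadic k x) * torus_char (- n) (dyadic k x))
      \<le> (B' + B * norm (real_vec n)) * real CARD('d) * (1 / 2) ^ k"
    by (simp add: y_def mult.assoc)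
qed

text \<open>Repeated differentiation in one direction yields powers of one component of n. The
  bracket is therefore dominated by the component of largest modulus: the squared norm is at most d
  times its square.\<close>

lemma bracket_power_le_component:
  fixes n :: "int^'d"
  obtains i where "bracket n ^ m \<le> (1 + real CARD('d)) ^ m * (1 + \<bar>real_of_int (n $ i)\<bar> ^ (2 * m))"
proof -
  let ?A = "range (\<lambda>i. (real_of_int (n $ i))\<^sup>2)"
  have "Max ?A \<in> ?A" by (intro Max_in) auto
  then obtain i where i: "Max ?A = (real_of_int (n $ i))\<^sup>2" unfolding image_iff by blast
  define t where "t = (real_of_int (n $ i))\<^sup>2"
  have t: "0 \<le> t" by (simp add: t_def)
  have le: "(real_of_int (n $ j))\<^sup>2 \<le> t" for j
    unfolding t_def i[symmetric] by (intro Max_ge) auto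
  have "(norm (real_vec n))\<^sup>2 = (\<Sum>j\<in>UNIV. (real_of_int (n $ j))\<^sup>2)"
    by (simp add: norm_vec_def L2_set_def sum_nonneg)
  also have "\<dots> \<le> real CARD('d) * t"
    by (intro sum_bounded_above le)
  finally have "bracket n \<le> 1 + real CARD('d) * t"
    by (simp add: bracket_def)
  also have "\<dots> \<le> max 1 t + real CARD('d) * max 1 t"
    by (intro add_mono mult_left_mono) auto
  finally have "bracket n \<le> (1 + real CARD('d)) * max 1 t"
    by (simp add: distrib_right)
  then have "bracket n ^ m \<le> ((1 + real CARD('d)) * max 1 t) ^ m"
    by (intro power_mono) auto
  also have "\<dots> = (1 + real CARD('d)) ^ m * max 1 t ^ m" by (simp add: power_mult_distrib)
  also have "max 1 t ^ m \<le> 1 + t ^ m"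
    using t by (cases "t \<le> 1") (auto simp: max_def)
  finally have "bracket n ^ m \<le> (1 + real CARD('d)) ^ m * (1 + t ^ m)"
    by (simp add: mult_left_mono)
  then show ?thesis
    using that[of i] by (simp add: t_def power_mult)
qed

text \<open>The case j = 0, with any i, is later used to find f itself among its
  derivatives.\<close>

lemma multi_partial_single:
  "multi_partial X (\<lambda>l. if l = i then j else 0) f = (partial X i ^^ j) f"
proof -
  have *: "foldr (\<lambda>l. partial X l ^^ (if l = i then j else 0)) L f = (if i \<in> set L then (partial X i ^^ j) f else f)"
    if "distinct L" for L
    using that by (induction L) auto
  show ?thesis unfolding multi_partial_def by (subst *) auto
qed

lemma finite_multi_indices: "finite {\<beta> :: 'd::finite \<Rightarrow> nat. (\<Sum>i\<in>UNIV. \<beta> i) \<le> m}"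
proof (rule finite_subset)
  show "{\<beta> :: 'd \<Rightarrow> nat. (\<Sum>i\<in>UNIV. \<beta> i) \<le> m} \<subseteq> Pi\<^sub>E UNIV (\<lambda>_. {..m})"
  proof safe
    fix \<beta> :: "'d \<Rightarrow> nat" and i assume "(\<Sum>i\<in>UNIV. \<beta> i) \<le> m"
    moreover have "\<beta> i \<le> (\<Sum>i\<in>UNIV. \<beta> i)" by (intro member_le_sum) auto
    ultimately show "\<beta> i \<le> m" by linarith
  qed auto
qed (intro finite_PiE, auto)

section \<open>Vector-valued Fourier coefficients as limits of Riemann sums\<close>

context lc_complete
begin

lemma smooth_periodicD:
  assumes "f \<in> points (smooth_periodic X)"
  shows "C_infinity X f" "f (x + axis i (2 * pi)) = f x"
  using assms by (auto simp: smooth_periodic_def)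

lemma smooth_periodic_partial:
  assumes "f \<in> points (smooth_periodic X)"
  shows "partial X i f \<in> points (smooth_periodic X)"
  using C_infinity_partial[OF smooth_periodicD(1)[OF assms]]
    periodic_partial[OF smooth_periodicD(2)[OF assms]]
  by (simp add: smooth_periodic_def)

lemma smooth_periodic_mem: "f \<in> points (smooth_periodic X) \<Longrightarrow> f x \<in> points X"
  by (rule C_infinity_mem[OF smooth_periodicD(1)])

lemma smooth_periodic_bound:
  assumes f: "f \<in> points (smooth_periodic X)" and p: "p \<in> seminorms X" and K: "compact K"
  obtains B where "\<And>x. x \<in> K \<Longrightarrow> p (f x) \<le> B"
proof -
  have "continuous_on UNIV (\<lambda>x. p (f x))"
    by (rule continuous_map_euclideanD(2)[OF C_infinity_continuous[OF smooth_periodicD(1)[OF f]] p])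
  then have "compact ((\<lambda>x. p (f x)) ` K)"
    by (intro compact_continuous_image K) (auto intro: continuous_on_subset)
  then have "bdd_above ((\<lambda>x. p (f x)) ` K)"
    by (intro bounded_imp_bdd_above compact_imp_bounded)
  then show thesis using that by (auto simp: bdd_above_def)
qed

lemma dual_smooth:
  assumes f: "f \<in> points (smooth_periodic X)" and \<phi>: "\<phi> \<in> dual X"
  shows "continuous_on UNIV (\<lambda>x. \<phi> (f x))"
    "has_partial scalar_lcs i (\<lambda>x. \<phi> (f x)) x (\<phi> (partial X i f x))"
  using dual_continuous_on[OF \<phi> C_infinity_continuous[OF smooth_periodicD(1)[OF f]]]
    dual_has_partial[OF \<phi> smooth_periodic_mem[OF f] C_infinity_has_partial[OF smooth_periodicD(1)[OF f]]]
  by auto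

definition riemann :: "nat \<Rightarrow> int^'d::{finite,linorder} \<Rightarrow> (real^'d::{finite,linorder} \<Rightarrow> 'a) \<Rightarrow> 'a" where
  "riemann k n f = (\<Sum>v\<in>grid k. complex_of_real (weight k v) *\<^sub>C torus_char (- n) v *\<^sub>C f v)"

lemma riemann_mem: "f \<in> points (smooth_periodic X) \<Longrightarrow> riemann k n f \<in> points X"
  unfolding riemann_def by (intro sum_mem scale_mem smooth_periodic_mem)

lemma dual_riemann:
  assumes f: "f \<in> points (smooth_periodic X)" and \<phi>: "\<phi> \<in> dual X"
  shows "\<phi> (riemann k n f) = (\<Sum>v\<in>grid k. of_real (weight k v) * (\<phi> (f v) * torus_char (- n) v))"
  unfolding riemann_def
  using smooth_periodic_mem[OF f]
  by (subst dual_sum[OF \<phi>]) (auto simp: scale_mem dual_scale[OF \<phi>] mult_ac)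

text \<open>A general functional is dominated only by a finite sum of seminorms. The case S = {p}, C
  = 1 serves for estimates in the seminorm p itself.\<close>

lemma dual_riemann_error:
  fixes f :: "real^'d::{finite,linorder} \<Rightarrow> 'a"
  assumes f: "f \<in> points (smooth_periodic X)" and \<phi>: "\<phi> \<in> dual X"
    and S: "finite S" "S \<subseteq> seminorms X"
    and le: "\<And>x. x \<in> points X \<Longrightarrow> norm (\<phi> x) \<le> C * (\<Sum>p\<in>S. p x)"
    and C: "C \<ge> 0"
    and B': "\<And>i x p. p \<in> S \<Longrightarrow> x \<in> wide_cube \<Longrightarrow> p (partial X i f x) \<le> B' p"
    and B: "\<And>x p. p \<in> S \<Longrightarrow> x \<in> wide_cube \<Longrightarrow> p (f x) \<le> B p"
  shows "norm (torus_mean (\<lambda>x. \<phi> (f x) * torus_char (- n) x) - \<phi> (riemann k n f))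
    \<le> (C * (\<Sum>p\<in>S. B' p) + C * (\<Sum>p\<in>S. B p) * norm (real_vec n)) * real CARD('d) * (1 / 2) ^ k"
  unfolding dual_riemann[OF f \<phi>]
proof (rule riemann_char_error)
  show "continuous_on UNIV (\<lambda>x. \<phi> (f x))" by (rule dual_smooth(1)[OF f \<phi>])
  show "has_partial scalar_lcs i (\<lambda>x. \<phi> (f x)) x (\<phi> (partial X i f x))" for i x
    by (rule dual_smooth(2)[OF f \<phi>])
  fix x :: "real^'d::{finite,linorder}" assume x: "x \<in> wide_cube"
  show "norm (\<phi> (f x)) \<le> C * (\<Sum>p\<in>S. B p)"
    by (rule order_trans[OF le[OF smooth_periodic_mem[OF f]]]) (intro mult_left_mono sum_mono B x C)
  show "norm (\<phi> (partial X i f x)) \<le> C * (\<Sum>p\<in>S. B' p)" for i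
    by (rule order_trans[OF le[OF smooth_periodic_mem[OF smooth_periodic_partial[OF f]]]])
      (intro mult_left_mono sum_mono B' x C)
qed

lemma smooth_periodic_wide_bounds:
  assumes f: "f \<in> points (smooth_periodic X)" and p: "p \<in> seminorms X"
  shows "\<exists>B. (\<forall>x\<in>wide_cube. p (f x) \<le> B) \<and> (\<forall>i. \<forall>x\<in>wide_cube. p (partial X i f x) \<le> B)"
proof -
  obtain B0 where B0: "\<And>x. x \<in> wide_cube \<Longrightarrow> p (f x) \<le> B0"
    using smooth_periodic_bound[OF f p compact_wide_cube] by blast
  have "\<exists>B. \<forall>x\<in>wide_cube. p (partial X i f x) \<le> B" for i
    using smooth_periodic_bound[OF smooth_periodic_partial[OF f] p compact_wide_cube] by metis
  then obtain B1 where B1: "\<And>i x. x \<in> wide_cube \<Longrightarrow> p (partial X i f x) \<le> B1 i" by metis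
  have le: "c \<le> Max (insert B0 (range B1))" if "c \<in> insert B0 (range B1)" for c
    using that by (intro Max_ge) auto
  show ?thesis
  proof (intro exI[of _ "Max (insert B0 (range B1))"] conjI allI ballI)
    show "p (f x) \<le> Max (insert B0 (range B1))" if "x \<in> wide_cube" for x
      using B0[OF that] le[of B0] by simp
    show "p (partial X i f x) \<le> Max (insert B0 (range B1))" if "x \<in> wide_cube" for x i
      by (rule order_trans[OF B1[OF that, of i] le]) simp
  qed
qed

text \<open>No integral in the space is at hand yet. Two Riemann sums are compared after applying a
  functional dominated by p, by way of the scalar mean; the constant L depends on p but not on the
  functional.\<close>

lemma riemann_converges:
  fixes f :: "real^'d::{finite,linorder} \<Rightarrow> 'a"
  assumes f: "f \<in> points (smooth_periodic X)"
  shows "\<exists>y. limitin (lc_topology X) (\<lambda>k. riemann k n f) y sequentially"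
proof (rule fast_Cauchy_convergent)
  show "riemann k n f \<in> points X" for k by (rule riemann_mem[OF f])
  fix p assume p: "p \<in> seminorms X"
  obtain B where B: "\<And>x. x \<in> wide_cube \<Longrightarrow> p (f x) \<le> B"
    "\<And>i x. x \<in> wide_cube \<Longrightarrow> p (partial X i f x) \<le> B"
    using smooth_periodic_wide_bounds[OF f p] by blast
  define L where "L = (B + B * norm (real_vec n)) * real CARD('d)"
  have "p (riemann (Suc k) n f - riemann k n f) \<le> 2 * L * (1 / 2) ^ k" for k
  proof (rule sn_le_by_dual[OF p diff_mem[OF riemann_mem[OF f] riemann_mem[OF f]]])
    fix \<phi> assume \<phi>: "\<phi> \<in> dual X" "\<And>x. x \<in> points X \<Longrightarrow> norm (\<phi> x) \<le> p x"
    let ?m = "torus_mean (\<lambda>x. \<phi> (f x) * torus_char (- n) x)"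
    have err: "norm (?m - \<phi> (riemann k n f)) \<le> L * (1 / 2) ^ k" for k
      using dual_riemann_error[OF f \<phi>(1), of "{p}" 1 "\<lambda>_. B" "\<lambda>_. B" n k] \<phi>(2) p B
      by (simp add: L_def)
    have "norm (\<phi> (riemann (Suc k) n f - riemann k n f))
        = norm ((?m - \<phi> (riemann k n f)) - (?m - \<phi> (riemann (Suc k) n f)))"
      by (simp add: dual_diff[OF \<phi>(1) riemann_mem[OF f] riemann_mem[OF f]])
    also have "\<dots> \<le> L * (1 / 2) ^ k + L * (1 / 2) ^ Suc k"
      by (intro order_trans[OF norm_triangle_ineq4] add_mono err)
    also have "\<dots> \<le> 2 * L * (1 / 2) ^ k"
      using order_trans[OF norm_ge_zero err[of k]] by simp
    finally show "norm (\<phi> (riemann (Suc k) n f - riemann k n f)) \<le> 2 * L * (1 / 2) ^ k" .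
  qed
  then show "\<exists>C. \<forall>k. p (riemann (Suc k) n f - riemann k n f) \<le> C * (1 / 2) ^ k" by blast
qed

text \<open>Evaluates the \<open>THE\<close> of the Pettis integral: functionals separate points,
  and for continuous integrands the set integral is the scalar mean.\<close>

lemma fourier_coeffI:
  fixes f :: "real^'d::{finite,linorder} \<Rightarrow> 'a"
  assumes f: "f \<in> points (smooth_periodic X)" and y: "y \<in> points X"
    and eq: "\<And>\<phi>. \<phi> \<in> dual X \<Longrightarrow> \<phi> y = torus_mean (\<lambda>x. \<phi> (f x) * torus_char (- n) x)"
  shows "fourier_coeff X f n = y"
proof -
  have *: "complex_of_real (1 / (2 * pi) ^ CARD('d)) *
      (LINT x : cbox (\<chi> i. - pi) (\<chi> i. pi) | lborel.
        \<phi> (f x) * exp (- (\<i> * complex_of_real (real_vec n \<bullet> x))))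
      = torus_mean (\<lambda>x. \<phi> (f x) * torus_char (- n) x)" if "\<phi> \<in> dual X" for \<phi>
  proof -
    have "continuous_on UNIV (\<lambda>x. \<phi> (f x) * torus_char (- n) x)"
      by (intro continuous_intros dual_smooth(1)[OF f that])
    from LINT_cube[OF this] show ?thesis
      unfolding torus_mean_def cube_def torus_char_minus by simp
  qed
  show ?thesis
    unfolding fourier_coeff_def
  proof (rule the_equality)
    fix z assume z: "z \<in> points X \<and> (\<forall>e'\<in>dual X. e' z = complex_of_real (1 / (2 * pi) ^ CARD('d)) *
      (LINT x : cbox (\<chi> i. - pi) (\<chi> i. pi) | lborel.
        e' (f x) * exp (- (\<i> * complex_of_real (real_vec n \<bullet> x)))))"
    show "z = y"
      by (rule dual_separates) (use z y eq * in auto)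
  qed (use y eq * in auto)
qed

lemma dual_riemann_limit:
  fixes f :: "real^'d::{finite,linorder} \<Rightarrow> 'a"
  assumes f: "f \<in> points (smooth_periodic X)" and \<phi>: "\<phi> \<in> dual X"
  shows "(\<lambda>k. \<phi> (riemann k n f)) \<longlonglongrightarrow> torus_mean (\<lambda>x. \<phi> (f x) * torus_char (- n) x)"
proof -
  obtain S C where S: "finite S" "S \<subseteq> seminorms X" "C \<ge> 0"
    "\<forall>x\<in>points X. norm (\<phi> x) \<le> C * (\<Sum>p\<in>S. p x)"
    using dual_bound[OF \<phi>] by metis
  have "\<forall>p\<in>S. \<exists>B. (\<forall>x\<in>wide_cube. p (f x) \<le> B) \<and> (\<forall>i. \<forall>x\<in>wide_cube. p (partial X i f x) \<le> B)"
    using smooth_periodic_wide_bounds[OF f] S(2) by blast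
  then obtain B where B: "\<And>p. p \<in> S \<Longrightarrow> (\<forall>x\<in>wide_cube. p (f x) \<le> B p) \<and> (\<forall>i. \<forall>x\<in>wide_cube. p (partial X i f x) \<le> B p)"
    by metis
  let ?m = "torus_mean (\<lambda>x. \<phi> (f x) * torus_char (- n) x)"
  define L where "L = (C * (\<Sum>p\<in>S. B p) + C * (\<Sum>p\<in>S. B p) * norm (real_vec n)) * real CARD('d)"
  have le: "norm (?m - \<phi> (riemann k n f)) \<le> L * (1 / 2) ^ k" for k
    unfolding L_def by (rule dual_riemann_error[OF f \<phi> S(1,2) _ S(3)]) (use S(4) B in auto)
  have "(\<lambda>k. L * (1 / 2) ^ k) \<longlonglongrightarrow> L * 0"
    by (intro tendsto_mult tendsto_const LIMSEQ_power_zero) simp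
  then have "(\<lambda>k. L * (1 / 2) ^ k) \<longlonglongrightarrow> 0" by simp
  then have "(\<lambda>k. ?m - \<phi> (riemann k n f)) \<longlonglongrightarrow> 0"
    by (rule Lim_null_comparison[rotated]) (simp add: le)
  from tendsto_diff[OF tendsto_const[of ?m] this] show ?thesis by simp
qed

text \<open>The limit of the Riemann sums takes the required value under every functional; this is
  the existence of the Pettis integral.\<close>

lemma fourier_coeff_riemann:
  assumes f: "f \<in> points (smooth_periodic X)"
  shows "limitin (lc_topology X) (\<lambda>k. riemann k n f) (fourier_coeff X f n) sequentially"
proof -
  obtain y where y: "limitin (lc_topology X) (\<lambda>k. riemann k n f) y sequentially"
    using riemann_converges[OF f] by blast
  have "fourier_coeff X f n = y"
    by (rule fourier_coeffI[OF f limitin_lcD(1)[OF y]])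
      (rule LIMSEQ_unique[OF dual_limit[OF _ y] dual_riemann_limit[OF f]])
  then show ?thesis using y by simp
qed

lemma fourier_coeff_mem: "f \<in> points (smooth_periodic X) \<Longrightarrow> fourier_coeff X f n \<in> points X"
  using limitin_lcD(1)[OF fourier_coeff_riemann] .

lemma dual_fourier_coeff:
  assumes f: "f \<in> points (smooth_periodic X)" and \<phi>: "\<phi> \<in> dual X"
  shows "\<phi> (fourier_coeff X f n) = torus_mean (\<lambda>x. \<phi> (f x) * torus_char (- n) x)"
  by (rule LIMSEQ_unique[OF dual_limit[OF \<phi> fourier_coeff_riemann[OF f]] dual_riemann_limit[OF f \<phi>]])

lemma fourier_coeff_bound:
  assumes f: "f \<in> points (smooth_periodic X)" and p: "p \<in> seminorms X"
    and B: "\<And>x. x \<in> cube \<Longrightarrow> p (f x) \<le> B"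
  shows "p (fourier_coeff X f n) \<le> B"
proof (rule sn_le_by_dual[OF p fourier_coeff_mem[OF f]])
  fix \<phi> assume \<phi>: "\<phi> \<in> dual X" "\<And>x. x \<in> points X \<Longrightarrow> norm (\<phi> x) \<le> p x"
  show "norm (\<phi> (fourier_coeff X f n)) \<le> B"
    unfolding dual_fourier_coeff[OF f \<phi>(1)]
  proof (rule norm_torus_mean_le)
    show "continuous_on UNIV (\<lambda>x. \<phi> (f x) * torus_char (- n) x)"
      by (intro continuous_intros dual_smooth(1)[OF f \<phi>(1)])
    show "norm (\<phi> (f x) * torus_char (- n) x) \<le> B" if "x \<in> cube" for x
      using \<phi>(2)[OF smooth_periodic_mem[OF f, of x]] B[OF that] by (simp add: norm_mult)
  qed
qed

lemma fourier_coeff_partial: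
  assumes f: "f \<in> points (smooth_periodic X)"
  shows "fourier_coeff X (partial X i f) n = (\<i> * of_int (n $ i)) *\<^sub>C fourier_coeff X f n"
proof (rule fourier_coeffI[OF smooth_periodic_partial[OF f]])
  show "(\<i> * of_int (n $ i)) *\<^sub>C fourier_coeff X f n \<in> points X"
    by (intro scale_mem fourier_coeff_mem f)
  fix \<phi> assume \<phi>: "\<phi> \<in> dual X"
  have "torus_mean (\<lambda>x. \<phi> (partial X i f x) * torus_char (- n) x)
      = \<i> * of_int (n $ i) * torus_mean (\<lambda>x. \<phi> (f x) * torus_char (- n) x)"
    by (rule torus_mean_partial)
      (use dual_smooth[OF f \<phi>] dual_smooth(1)[OF smooth_periodic_partial[OF f] \<phi>] smooth_periodicD(2)[OF f] in auto)
  then show "\<phi> ((\<i> * of_int (n $ i)) *\<^sub>C fourier_coeff X f n)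
      = torus_mean (\<lambda>x. \<phi> (partial X i f x) * torus_char (- n) x)"
    by (simp add: dual_scale[OF \<phi> fourier_coeff_mem[OF f]] dual_fourier_coeff[OF f \<phi>])
qed

lemma fourier_coeff_iterated_partial:
  assumes f: "f \<in> points (smooth_periodic X)"
  shows "(partial X i ^^ j) f \<in> points (smooth_periodic X) \<and>
    fourier_coeff X ((partial X i ^^ j) f) n = (\<i> * of_int (n $ i)) ^ j *\<^sub>C fourier_coeff X f n"
proof (induction j)
  case (Suc j)
  then have g: "(partial X i ^^ j) f \<in> points (smooth_periodic X)"
    "fourier_coeff X ((partial X i ^^ j) f) n = (\<i> * of_int (n $ i)) ^ j *\<^sub>C fourier_coeff X f n"
    by blast+
  show ?case
    using smooth_periodic_partial[OF g(1), of i] fourier_coeff_partial[OF g(1), of i n]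
    by (simp add: g(2) scaleC_scaleC)
qed (use f in simp)

section \<open>Seminorms of smooth functions and decay of coefficients\<close>

definition smooth_sn :: "(real^'d::{finite,linorder}) set \<Rightarrow> nat \<Rightarrow> ('a \<Rightarrow> real) \<Rightarrow> (real^'d::{finite,linorder} \<Rightarrow> 'a) \<Rightarrow> real" where
  "smooth_sn K m p f = (SUP (x, \<beta>) \<in> K \<times> {\<beta>. (\<Sum>i\<in>UNIV. \<beta> i) \<le> m}. p (multi_partial X \<beta> f x))"

lemma seminorms_smooth_periodic:
  "seminorms (smooth_periodic X) = {smooth_sn K m p | K m p. compact K \<and> K \<noteq> {} \<and> p \<in> seminorms X}"
  unfolding smooth_periodic_def smooth_sn_def[abs_def] by simp

lemma multi_partial_smooth:
  assumes f: "f \<in> points (smooth_periodic X)"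
  shows "multi_partial X \<beta> f \<in> points (smooth_periodic X)"
proof -
  have pow: "(partial X i ^^ k) g \<in> points (smooth_periodic X)" if "g \<in> points (smooth_periodic X)" for g i k
    using that by (induction k) (auto intro: smooth_periodic_partial)
  have "foldr (\<lambda>i. partial X i ^^ \<beta> i) L f \<in> points (smooth_periodic X)" for L
    by (induction L) (auto intro: pow f)
  then show ?thesis by (simp add: multi_partial_def)
qed

text \<open>A real supremum is informative only over a bounded set. Boundedness comes from the
  compactness of K for each derivative and from the finite number of multi-indices.\<close>

lemma smooth_sn_upper:
  fixes f :: "real^'d::{finite,linorder} \<Rightarrow> 'a"
  assumes f: "f \<in> points (smooth_periodic X)" and p: "p \<in> seminorms X" and K: "compact K"
    and x: "x \<in> K" and \<beta>: "(\<Sum>i\<in>UNIV. \<beta> i) \<le> m"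
  shows "p (multi_partial X \<beta> f x) \<le> smooth_sn K m p f"
proof -
  have "\<exists>B. \<forall>x\<in>K. p (multi_partial X \<gamma> f x) \<le> B" for \<gamma>
    using smooth_periodic_bound[OF multi_partial_smooth[OF f] p K] by metis
  then obtain B where B: "\<And>\<gamma> x. x \<in> K \<Longrightarrow> p (multi_partial X \<gamma> f x) \<le> B \<gamma>" by metis
  let ?I = "{\<beta> :: 'd \<Rightarrow> nat. (\<Sum>i\<in>UNIV. \<beta> i) \<le> m}"
  have "bdd_above ((\<lambda>(x, \<beta>). p (multi_partial X \<beta> f x)) ` (K \<times> ?I))"
  proof (rule bdd_aboveI2)
    fix z assume "z \<in> K \<times> ?I"
    then obtain y \<gamma> where z: "z = (y, \<gamma>)" "y \<in> K" "\<gamma> \<in> ?I" by auto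
    have "B \<gamma> \<le> Max (B ` ?I)" using finite_multi_indices[of m] z(3) by (intro Max_ge) auto
    then show "(case z of (x, \<beta>) \<Rightarrow> p (multi_partial X \<beta> f x)) \<le> Max (B ` ?I)"
      using B[OF z(2), of \<gamma>] z(1) by simp
  qed
  from cSUP_upper[OF _ this, of "(x, \<beta>)"] show ?thesis
    using x \<beta> by (simp add: smooth_sn_def)
qed

lemma smooth_sn_least:
  fixes f :: "real^'d::{finite,linorder} \<Rightarrow> 'a"
  assumes "K \<noteq> {}" "\<And>x \<beta>. x \<in> K \<Longrightarrow> (\<Sum>i\<in>UNIV. \<beta> i) \<le> m \<Longrightarrow> p (multi_partial X \<beta> f x) \<le> B"
  shows "smooth_sn K m p f \<le> B"
proof -
  have "(\<lambda>_. 0) \<in> {\<beta> :: 'd \<Rightarrow> nat. (\<Sum>i\<in>UNIV. \<beta> i) \<le> m}" by simp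
  then have "K \<times> {\<beta> :: 'd \<Rightarrow> nat. (\<Sum>i\<in>UNIV. \<beta> i) \<le> m} \<noteq> {}"
    using assms(1) by blast
  then show ?thesis
    unfolding smooth_sn_def
    by (rule cSUP_least) (use assms(2) in auto)
qed

text \<open>The direction i is chosen for the given n. Derivatives of order 0 and 2m in that
  direction supply the two summands of \<open>bracket_power_le_component\<close>, whence the factor
  2.\<close>

lemma fourier_coeff_decay:
  fixes f :: "real^'d::{finite,linorder} \<Rightarrow> 'a"
  assumes f: "f \<in> points (smooth_periodic X)" and p: "p \<in> seminorms X"
  shows "p (fourier_coeff X f n) * bracket n ^ m \<le> 2 * (1 + real CARD('d)) ^ m * smooth_sn cube (2 * m) p f"
proof -
  obtain i where i: "bracket n ^ m \<le> (1 + real CARD('d)) ^ m * (1 + \<bar>real_of_int (n $ i)\<bar> ^ (2 * m))"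
    by (rule bracket_power_le_component)
  let ?q = "smooth_sn cube (2 * m) p f"
  have mem: "fourier_coeff X f n \<in> points X" by (rule fourier_coeff_mem[OF f])
  have "\<bar>real_of_int (n $ i)\<bar> ^ j * p (fourier_coeff X f n) \<le> ?q" if "j \<le> 2 * m" for j
  proof -
    have g: "(partial X i ^^ j) f \<in> points (smooth_periodic X)"
      "fourier_coeff X ((partial X i ^^ j) f) n = (\<i> * of_int (n $ i)) ^ j *\<^sub>C fourier_coeff X f n"
      using fourier_coeff_iterated_partial[OF f] by blast+
    have "p (fourier_coeff X ((partial X i ^^ j) f) n) \<le> ?q"
    proof (rule fourier_coeff_bound[OF g(1) p])
      fix x :: "real^'d::{finite,linorder}" assume x: "x \<in> cube"
      show "p ((partial X i ^^ j) f x) \<le> ?q"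
        using smooth_sn_upper[OF f p compact_cube x, of "\<lambda>l. if l = i then j else 0" "2 * m"] that
        by (simp add: multi_partial_single)
    qed
    then show ?thesis
      by (simp add: g(2) sn_scale[OF p mem] norm_power norm_mult)
  qed
  from this[of 0] this[of "2 * m"]
  have le: "(1 + \<bar>real_of_int (n $ i)\<bar> ^ (2 * m)) * p (fourier_coeff X f n) \<le> 2 * ?q"
    by (simp add: distrib_right)
  have "p (fourier_coeff X f n) * bracket n ^ m
      \<le> p (fourier_coeff X f n) * ((1 + real CARD('d)) ^ m * (1 + \<bar>real_of_int (n $ i)\<bar> ^ (2 * m)))"
    by (intro mult_left_mono i sn_nonneg p mem)
  also have "\<dots> = (1 + real CARD('d)) ^ m * ((1 + \<bar>real_of_int (n $ i)\<bar> ^ (2 * m)) * p (fourier_coeff X f n))"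
    by (simp add: mult_ac)
  also have "\<dots> \<le> (1 + real CARD('d)) ^ m * (2 * ?q)"
    by (intro mult_left_mono le) simp
  finally show ?thesis by (simp add: mult_ac)
qed

lemma rapid_fourier_coeff: "f \<in> points (smooth_periodic X) \<Longrightarrow> rapid (fourier_coeff X f)"
  unfolding rapid_def using fourier_coeff_mem fourier_coeff_decay by blast

text \<open>Mean and series are interchanged by uniform convergence: for N containing n the finite
  sum has mean \<phi>(a_n) by orthogonality, and the remainder is at most
  \<open>tail_sum b N\<close> at every point.\<close>

lemma torus_mean_dual_synth:
  fixes a :: "int^'d::{finite,linorder} \<Rightarrow> 'a"
  assumes a: "rapid a" and \<phi>: "\<phi> \<in> dual X"
  shows "torus_mean (\<lambda>x. \<phi> (synth a x) * torus_char (- n) x) = \<phi> (a n)"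
proof -
  obtain S C where S: "finite S" "S \<subseteq> seminorms X" "C \<ge> 0"
    "\<forall>x\<in>points X. norm (\<phi> x) \<le> C * (\<Sum>p\<in>S. p x)"
    using dual_bound[OF \<phi>] by metis
  \<comment> \<open>\<phi> is controlled by finitely many seminorms, and a is absolutely summable in
    each of them, so b is a summable majorant.\<close>
  define b where "b m = C * (\<Sum>p\<in>S. p (a m))" for m
  have b: "norm (\<phi> (a m)) \<le> b m" for m
    using S(4) rapid_mem[OF a] by (simp add: b_def)
  have "(\<lambda>m. \<Sum>p\<in>S. p (a m)) summable_on UNIV"
    using S(1,2)
  proof (induction S)
    case (insert q S)
    then have "q \<in> seminorms X" "(\<lambda>m. \<Sum>p\<in>S. p (a m)) summable_on UNIV" by auto
    from summable_on_add[OF rapid_summable0[OF a this(1)] this(2)]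
    show ?case using insert.hyps by simp
  qed simp
  then have b_sum: "b summable_on UNIV"
    unfolding b_def by (rule summable_on_cmult_right)
  note cont = dual_smooth(1)[OF synth_smooth_periodic[OF a] \<phi>]
  have "norm (torus_mean (\<lambda>x. \<phi> (synth a x) * torus_char (- n) x) - \<phi> (a n)) \<le> tail_sum b N"
    if N: "finite N" "n \<in> N" for N
  proof -
    let ?s = "\<lambda>x. \<Sum>m\<in>N. \<phi> (a m) * torus_char (m - n) x"
    have cs: "continuous_on UNIV ?s" by (intro continuous_intros)
    have "torus_mean ?s = (\<Sum>m\<in>N. \<phi> (a m) * torus_mean (torus_char (m - n)))"
      by (subst torus_mean_sum) (auto intro: continuous_intros simp: torus_mean_cmult)
    also have "\<dots> = (\<Sum>m\<in>N. if m = n then \<phi> (a n) else 0)"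
      by (intro sum.cong refl) (auto simp: torus_mean_char)
    also have "\<dots> = \<phi> (a n)" using N by simp
    finally have s: "torus_mean ?s = \<phi> (a n)" .
    have "norm (torus_mean (\<lambda>x. \<phi> (synth a x) * torus_char (- n) x - ?s x)) \<le> tail_sum b N"
    proof (rule norm_torus_mean_le)
      show "continuous_on UNIV (\<lambda>x. \<phi> (synth a x) * torus_char (- n) x - ?s x)"
        by (intro continuous_on_diff continuous_on_mult cont cs continuous_on_torus_char)
      fix x :: "real^'d::{finite,linorder}"
      have hs: "((\<lambda>m. torus_char m x * \<phi> (a m)) has_sum \<phi> (synth a x)) UNIV"
        using dual_series_limit[OF rapid_char[OF a, of x] \<phi>]
        by (simp add: synth_def dual_scale[OF \<phi> rapid_mem[OF a]])
      have "norm (\<phi> (synth a x) - (\<Sum>m\<in>N. torus_char m x * \<phi> (a m))) \<le> tail_sum b N"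
        by (rule has_sum_tail_bound[OF hs _ b_sum N(1)]) (simp add: norm_mult b)
      moreover have "\<phi> (synth a x) * torus_char (- n) x - ?s x
          = (\<phi> (synth a x) - (\<Sum>m\<in>N. torus_char m x * \<phi> (a m))) * torus_char (- n) x"
      proof -
        have "torus_char (m - n) x = torus_char m x * torus_char (- n) x" for m
          using torus_char_add[of m "- n" x] by simp
        then have "?s x = (\<Sum>m\<in>N. torus_char m x * \<phi> (a m)) * torus_char (- n) x"
          unfolding sum_distrib_right by (intro sum.cong) (simp_all add: mult_ac)
        then show ?thesis by (simp add: left_diff_distrib)
      qed
      ultimately show "norm (\<phi> (synth a x) * torus_char (- n) x - ?s x) \<le> tail_sum b N"
        by (simp add: norm_mult)
    qed
    also have "torus_mean (\<lambda>x. \<phi> (synth a x) * torus_char (- n) x - ?s x)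
        = torus_mean (\<lambda>x. \<phi> (synth a x) * torus_char (- n) x) - \<phi> (a n)"
      by (subst torus_mean_diff[OF _ cs])
        (simp_all only: s cont continuous_on_mult continuous_on_torus_char)
    finally show ?thesis .
  qed
  then have "\<forall>\<^sub>F N in finite_subsets_at_top UNIV.
      norm (torus_mean (\<lambda>x. \<phi> (synth a x) * torus_char (- n) x) - \<phi> (a n)) \<le> tail_sum b N"
    unfolding eventually_finite_subsets_at_top by (intro exI[of _ "{n}"]) auto
  from tendsto_lowerbound[OF tail_sum_tendsto[OF b_sum] this finite_subsets_at_top_neq_bot]
  show ?thesis by simp
qed

lemma fourier_coeff_synth:
  fixes a :: "int^'d::{finite,linorder} \<Rightarrow> 'a"
  assumes "rapid a"
  shows "fourier_coeff X (synth a) = a"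
proof
  fix n
  show "fourier_coeff X (synth a) n = a n"
    by (rule fourier_coeffI[OF synth_smooth_periodic[OF assms] rapid_mem[OF assms]])
      (rule torus_mean_dual_synth[OF assms, symmetric])
qed

text \<open>Both functions have the same coefficients. For every functional \<phi> their difference
  becomes a continuous periodic scalar function orthogonal to all characters, and
  \<open>torus_char_complete\<close> applies.\<close>

lemma synth_fourier_coeff:
  assumes f: "f \<in> points (smooth_periodic X)"
  shows "synth (fourier_coeff X f) = f"
proof
  fix y
  let ?a = "fourier_coeff X f"
  have a: "rapid ?a" by (rule rapid_fourier_coeff[OF f])
  note g = synth_smooth_periodic[OF a]
  show "synth ?a y = f y"
  proof (rule dual_separates)
    show "synth ?a y \<in> points X" "f y \<in> points X"
      by (rule smooth_periodic_mem[OF g], rule smooth_periodic_mem[OF f])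
    fix \<phi> assume \<phi>: "\<phi> \<in> dual X"
    note cg = dual_smooth(1)[OF g \<phi>] and cf = dual_smooth(1)[OF f \<phi>]
    have "\<phi> (synth ?a y) - \<phi> (f y) = 0"
    proof (rule torus_char_complete)
      show "continuous_on UNIV (\<lambda>x. \<phi> (synth ?a x) - \<phi> (f x))"
        by (intro continuous_on_diff cg cf)
      show "\<phi> (synth ?a (x + axis i (2 * pi))) - \<phi> (f (x + axis i (2 * pi))) = \<phi> (synth ?a x) - \<phi> (f x)" for i x
        by (simp add: smooth_periodicD(2)[OF f] synth_periodic)
      show "torus_mean (\<lambda>x. (\<phi> (synth ?a x) - \<phi> (f x)) * torus_char n x) = 0" for n
      proof -
        \<comment> \<open>\<open>torus_char_complete\<close> tests with e_n, the coefficients are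
          formed with e_(-n); hence the double negation.\<close>
        have "torus_mean (\<lambda>x. (\<phi> (synth ?a x) - \<phi> (f x)) * torus_char n x)
            = torus_mean (\<lambda>x. \<phi> (synth ?a x) * torus_char (- (- n)) x) - torus_mean (\<lambda>x. \<phi> (f x) * torus_char (- (- n)) x)"
          by (subst torus_mean_diff[symmetric])
            (auto intro!: continuous_on_mult cg cf continuous_on_torus_char simp: left_diff_distrib)
        also have "\<dots> = \<phi> (?a (- n)) - \<phi> (?a (- n))"
          by (simp only: torus_mean_dual_synth[OF a \<phi>] dual_fourier_coeff[OF f \<phi>])
        finally show ?thesis by simp
      qed
    qed
    then show "\<phi> (synth ?a y) = \<phi> (f y)" by simp
  qed
qed

end

section \<open>The Fourier isomorphism and the Schauder decomposition\<close>

text \<open>For seminorms defined by suprema, one inequality of homogeneity is immediate; the other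
  follows by scaling back with 1/a.\<close>

lemma lc_spaceI:
  fixes X :: "'a::complex_vector lcs"
  assumes zero: "0 \<in> points X"
    and add: "\<And>x y. x \<in> points X \<Longrightarrow> y \<in> points X \<Longrightarrow> x + y \<in> points X"
    and scale: "\<And>a x. x \<in> points X \<Longrightarrow> a *\<^sub>C x \<in> points X"
    and nonneg: "\<And>p x. p \<in> seminorms X \<Longrightarrow> x \<in> points X \<Longrightarrow> 0 \<le> p x"
    and triangle: "\<And>p x y. p \<in> seminorms X \<Longrightarrow> x \<in> points X \<Longrightarrow> y \<in> points X \<Longrightarrow> p (x + y) \<le> p x + p y"
    and le: "\<And>p a x. p \<in> seminorms X \<Longrightarrow> x \<in> points X \<Longrightarrow> p (a *\<^sub>C x) \<le> norm a * p x"
    and ex: "seminorms X \<noteq> {}"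
  shows "lc_space X"
proof
  fix p x a assume p: "p \<in> seminorms X" and x: "x \<in> points X"
  show "p (a *\<^sub>C x) = norm a * p x"
  proof (cases "a = 0")
    case True
    then show ?thesis using le[OF p x, of 0] nonneg[OF p zero] by simp
  next
    case False
    then have "p x \<le> norm (1 / a) * p (a *\<^sub>C x)"
      using le[OF p scale[OF x, of a], of "1 / a"] by (simp add: scaleC_scaleC)
    then have "norm a * p x \<le> p (a *\<^sub>C x)"
      using False by (simp add: norm_divide field_simps)
    then show ?thesis using le[OF p x, of a] by simp
  qed
qed (use assms in auto)

lemma sum_fun_apply: "(\<Sum>i\<in>A. f i) x = (\<Sum>i\<in>A. f i x)"
  for f :: "'i \<Rightarrow> 'x \<Rightarrow> 'b::comm_monoid_add"
  by (induction A rule: infinite_finite_induct) (simp_all add: zero_fun_def plus_fun_def)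

lemma cube_nonempty: "cube \<noteq> {}"
proof -
  have "0 \<in> cube" by (simp add: mem_cube)
  then show ?thesis by blast
qed

text \<open>Partial sums over balls thereby become a special case of unordered sums: every finite
  set of lattice points lies in all sufficiently large balls.\<close>

lemma filterlim_lattice_balls:
  "filterlim (\<lambda>k. {n :: int^'d. norm (real_vec n) \<le> real k}) (finite_subsets_at_top UNIV) sequentially"
  unfolding filterlim_finite_subsets_at_top
proof (intro allI impI)
  fix Y :: "(int^'d) set" assume Y: "finite Y \<and> Y \<subseteq> UNIV"
  have "\<forall>\<^sub>F k in sequentially. norm (real_vec n) \<le> real k" for n :: "int^'d"
    using filterlim_real_sequentially unfolding filterlim_at_top by blast
  then have "\<forall>\<^sub>F k in sequentially. \<forall>n\<in>Y. norm (real_vec n) \<le> real k"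
    using Y by (intro eventually_ball_finite) auto
  then show "\<forall>\<^sub>F k in sequentially. finite {n :: int^'d. norm (real_vec n) \<le> real k} \<and>
      Y \<subseteq> {n. norm (real_vec n) \<le> real k} \<and> {n :: int^'d. norm (real_vec n) \<le> real k} \<subseteq> UNIV"
    by eventually_elim (auto simp: finite_lattice_ball)
qed

section \<open>The sequence space in terms of rapid families\<close>

context lc_complete
begin

definition rapid_sn :: "nat \<Rightarrow> ('a \<Rightarrow> real) \<Rightarrow> (int^'d::finite \<Rightarrow> 'a) \<Rightarrow> real" where
  "rapid_sn j p x = (SUP k. p (x k) * (1 + (norm (real_vec k))\<^sup>2) powr (real j / 2))"

lemma seminorms_rapidly_decreasing:
  "seminorms (rapidly_decreasing X) = {rapid_sn j p | j p. j \<ge> 1 \<and> p \<in> seminorms X}"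
  unfolding rapidly_decreasing_def rapid_sn_def[abs_def] by simp

text \<open>Together with the equality for even j below, this makes the weights with exponent j/2
  and the integer powers of the bracket comparable in both directions.\<close>

lemma powr_half_le: "(1 + (norm (real_vec n))\<^sup>2) powr (real j / 2) \<le> bracket n ^ j"
proof -
  have "bracket n powr (real j / 2) \<le> bracket n powr real j"
    using bracket_ge_1[of n] by (intro powr_mono) auto
  then show ?thesis
    using bracket_pos[of n] by (simp add: powr_realpow bracket_def)
qed

lemma powr_half_even: "(1 + (norm (real_vec n))\<^sup>2) powr (real (2 * m) / 2) = bracket n ^ m"
  using bracket_pos[of n] by (simp add: powr_realpow bracket_def)

lemma rapid_bdd:
  assumes a: "rapid a" and p: "p \<in> seminorms X"
  shows "bdd_above (range (\<lambda>k. p (a k) * (1 + (norm (real_vec k))\<^sup>2) powr (real j / 2)))"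
proof -
  obtain C where C: "\<And>n. p (a n) * bracket n ^ j \<le> C"
    using a p unfolding rapid_def by blast
  show ?thesis
  proof (rule bdd_aboveI2)
    fix n
    show "p (a n) * (1 + (norm (real_vec n))\<^sup>2) powr (real j / 2) \<le> C"
      by (rule order_trans[OF mult_left_mono[OF powr_half_le sn_nonneg[OF p rapid_mem[OF a]]] C])
  qed
qed

lemma points_rapidly_decreasing: "points (rapidly_decreasing X) = {a. rapid a}"
proof (intro set_eqI iffI)
  fix a :: "int^'b \<Rightarrow> 'a" assume "a \<in> {a. rapid a}"
  then show "a \<in> points (rapidly_decreasing X)"
    using rapid_bdd[of a] rapid_mem[of a] by (simp add: rapidly_decreasing_def)
next
  fix a :: "int^'b \<Rightarrow> 'a" assume a: "a \<in> points (rapidly_decreasing X)"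
  have mem: "a n \<in> points X" for n using a by (simp add: rapidly_decreasing_def)
  have "\<exists>C. \<forall>n. p (a n) * bracket n ^ m \<le> C" if p: "p \<in> seminorms X" for m p
  proof -
    \<comment> \<open>The index 2 (m + 1) is positive for m = 0 as well; the definition speaks of j
      \<ge> 1 only.\<close>
    have "bdd_above (range (\<lambda>k. p (a k) * (1 + (norm (real_vec k))\<^sup>2) powr (real (2 * Suc m) / 2)))"
      using a p unfolding rapidly_decreasing_def
      by (simp del: mult_Suc_right of_nat_Suc of_nat_mult)
    then obtain C where C: "\<And>n. p (a n) * bracket n ^ Suc m \<le> C"
      unfolding powr_half_even by (auto simp: bdd_above_def)
    have "p (a n) * bracket n ^ m \<le> C" for n
      by (rule order_trans[OF mult_left_mono[OF bracket_power_mono[of m "Suc m"] sn_nonneg[OF p mem]] C]) simp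
    then show ?thesis by blast
  qed
  then show "a \<in> {a. rapid a}" using mem by (simp add: rapid_def)
qed

lemma rapid_sn_upper:
  assumes "rapid a" "p \<in> seminorms X"
  shows "p (a n) * (1 + (norm (real_vec n))\<^sup>2) powr (real j / 2) \<le> rapid_sn j p a"
  unfolding rapid_sn_def by (rule cSUP_upper[OF _ rapid_bdd[OF assms]]) simp

lemma rapid_sn_upper_even:
  "rapid a \<Longrightarrow> p \<in> seminorms X \<Longrightarrow> p (a n) * bracket n ^ m \<le> rapid_sn (2 * m) p a"
  using rapid_sn_upper[of a p n "2 * m"] unfolding powr_half_even by simp

lemma rapid_sn_least:
  assumes "\<And>n. p (a n) * (1 + (norm (real_vec n))\<^sup>2) powr (real j / 2) \<le> B"
  shows "rapid_sn j p a \<le> B"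
  unfolding rapid_sn_def by (rule cSUP_least) (use assms in auto)

lemma rapid_zero: "rapid 0"
  using rapid_finite[of "{}" "\<lambda>_. 0"] by (simp add: zero_fun_def)

lemma rapid_plus: "rapid a \<Longrightarrow> rapid b \<Longrightarrow> rapid (a + b)"
  unfolding plus_fun_def by (rule rapid_add)

lemma rapid_scale: "rapid a \<Longrightarrow> rapid (c *\<^sub>C a)"
  unfolding scaleC_fun_def by (rule rapid_multiplier[of _ _ "norm c" 0]) auto

lemma lc_space_rapidly_decreasing: "lc_space (rapidly_decreasing X :: (int^'d::finite \<Rightarrow> 'a) lcs)"
proof (rule lc_spaceI; (unfold points_rapidly_decreasing mem_Collect_eq)?)
  show "rapid (0 :: int^'d \<Rightarrow> 'a)" by (rule rapid_zero)
  show "rapid a \<Longrightarrow> rapid b \<Longrightarrow> rapid (a + b)" for a b :: "int^'d \<Rightarrow> 'a" by (rule rapid_plus)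
  show "rapid a \<Longrightarrow> rapid (c *\<^sub>C a)" for c and a :: "int^'d \<Rightarrow> 'a" by (rule rapid_scale)
  obtain p where "p \<in> seminorms X" using sn_ex by blast
  then show "seminorms (rapidly_decreasing X) \<noteq> ({} :: ((int^'d \<Rightarrow> 'a) \<Rightarrow> real) set)"
    unfolding seminorms_rapidly_decreasing by blast
  fix q :: "(int^'d \<Rightarrow> 'a) \<Rightarrow> real" and a :: "int^'d \<Rightarrow> 'a" assume "q \<in> seminorms (rapidly_decreasing X)" and a: "rapid a"
  then obtain j p where q: "q = rapid_sn j p" and p: "p \<in> seminorms X"
    unfolding seminorms_rapidly_decreasing by blast
  have w: "0 \<le> (1 + (norm (real_vec n))\<^sup>2) powr (real j / 2)" for n :: "int^'d" by simp
  show "0 \<le> q a"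
    unfolding q
    by (rule order_trans[OF mult_nonneg_nonneg[OF sn_nonneg[OF p rapid_mem[OF a]] w] rapid_sn_upper[OF a p, of 0 j]])
  show "q (a + b) \<le> q a + q b" if b: "rapid b" for b
    unfolding q
  proof (rule rapid_sn_least)
    fix n
    have "p ((a + b) n) * (1 + (norm (real_vec n))\<^sup>2) powr (real j / 2)
        \<le> (p (a n) + p (b n)) * (1 + (norm (real_vec n))\<^sup>2) powr (real j / 2)"
      unfolding plus_fun_def by (intro mult_right_mono sn_add p rapid_mem a b w)
    also have "\<dots> \<le> rapid_sn j p a + rapid_sn j p b"
      unfolding distrib_right by (intro add_mono rapid_sn_upper a b p)
    finally show "p ((a + b) n) * (1 + (norm (real_vec n))\<^sup>2) powr (real j / 2) \<le> rapid_sn j p a + rapid_sn j p b" .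
  qed
  show "q (c *\<^sub>C a) \<le> norm c * q a" for c
    unfolding q
  proof (rule rapid_sn_least)
    fix n
    have "norm c * (p (a n) * (1 + (norm (real_vec n))\<^sup>2) powr (real j / 2)) \<le> norm c * rapid_sn j p a"
      by (intro mult_left_mono rapid_sn_upper a p) simp
    then show "p ((c *\<^sub>C a) n) * (1 + (norm (real_vec n))\<^sup>2) powr (real j / 2) \<le> norm c * rapid_sn j p a"
      by (simp add: scaleC_fun_def sn_scale[OF p rapid_mem[OF a]])
  qed
qed

section \<open>Linear structure of the space of smooth periodic functions\<close>

lemma synth_plus: "rapid a \<Longrightarrow> rapid b \<Longrightarrow> synth (a + b) = synth a + synth b"
  unfolding plus_fun_def by (intro ext synth_add)

lemma synth_scaleC: "rapid a \<Longrightarrow> synth (c *\<^sub>C a) = c *\<^sub>C synth a"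
  unfolding scaleC_fun_def by (intro ext synth_scale)

lemma smooth_periodic_synthE:
  fixes f :: "real^'d::{finite,linorder} \<Rightarrow> 'a"
  assumes "f \<in> points (smooth_periodic X)"
  obtains a where "rapid a" "f = synth a"
  using that[of "fourier_coeff X f"] rapid_fourier_coeff[OF assms] synth_fourier_coeff[OF assms] by simp

lemma rapid_symbol: "rapid a \<Longrightarrow> rapid (\<lambda>n. derivative_symbol \<beta> n *\<^sub>C a n)"
  by (rule rapid_multiplier[OF _ norm_derivative_symbol[OF order_refl]])

lemma multi_partial_synth_plus:
  assumes a: "rapid a" and b: "rapid b"
  shows "multi_partial X \<beta> (synth a + synth b) x = multi_partial X \<beta> (synth a) x + multi_partial X \<beta> (synth b) x"
  by (simp only: synth_plus[OF a b, symmetric] multi_partial_synth[OF a] multi_partial_synth[OF b]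
      multi_partial_synth[OF rapid_plus[OF a b]] scaleC_add_right plus_fun_apply
      synth_add[OF rapid_symbol[OF a] rapid_symbol[OF b]])

lemma multi_partial_synth_scale:
  assumes a: "rapid a"
  shows "multi_partial X \<beta> (c *\<^sub>C synth a) x = c *\<^sub>C multi_partial X \<beta> (synth a) x"
proof -
  have "(\<lambda>n. derivative_symbol \<beta> n *\<^sub>C (c *\<^sub>C a) n) = (\<lambda>n. c *\<^sub>C derivative_symbol \<beta> n *\<^sub>C a n)"
    by (simp add: scaleC_fun_def scaleC_scaleC mult.commute)
  then show ?thesis
    by (simp only: synth_scaleC[OF a, symmetric] multi_partial_synth[OF a]
        multi_partial_synth[OF rapid_scale[OF a]] synth_scale[OF rapid_symbol[OF a]])
qed

lemma lc_space_smooth_periodic: "lc_space (smooth_periodic X :: (real^'d::{finite,linorder} \<Rightarrow> 'a) lcs)"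
proof (rule lc_spaceI)
  let ?S = "smooth_periodic X :: (real^'d::{finite,linorder} \<Rightarrow> 'a) lcs"
  have "synth (0 *\<^sub>C 0) = 0 *\<^sub>C synth (0 :: int^'d::{finite,linorder} \<Rightarrow> 'a)"
    by (rule synth_scaleC[OF rapid_zero])
  then have "synth (0 :: int^'d::{finite,linorder} \<Rightarrow> 'a) = 0" by simp
  then show "0 \<in> points ?S"
    using synth_smooth_periodic[OF rapid_zero] by metis
  show "f + g \<in> points ?S" if f: "f \<in> points ?S" and g: "g \<in> points ?S" for f g
  proof -
    obtain a b where "rapid a" "f = synth a" "rapid b" "g = synth b"
      using smooth_periodic_synthE[OF f] smooth_periodic_synthE[OF g] by metis
    then show ?thesis using synth_smooth_periodic[OF rapid_plus] by (simp add: synth_plus[symmetric])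
  qed
  show "c *\<^sub>C f \<in> points ?S" if f: "f \<in> points ?S" for c f
  proof -
    obtain a where "rapid a" "f = synth a" by (rule smooth_periodic_synthE[OF f])
    then show ?thesis using synth_smooth_periodic[OF rapid_scale] by (simp add: synth_scaleC[symmetric])
  qed
  obtain p where "p \<in> seminorms X" using sn_ex by blast
  then have "smooth_sn {0} 0 p \<in> seminorms ?S"
    unfolding seminorms_smooth_periodic
    by (intro CollectI exI[of _ "{0}"] exI[of _ 0] exI[of _ p]) simp
  then show "seminorms ?S \<noteq> {}" by blast
  fix q f assume "q \<in> seminorms ?S" and f: "f \<in> points ?S"
  then obtain K m p where q: "q = smooth_sn K m p" and K: "compact K" "K \<noteq> {}" and p: "p \<in> seminorms X"
    unfolding seminorms_smooth_periodic by blast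
  obtain a where a: "rapid a" "f = synth a" by (rule smooth_periodic_synthE[OF f])
  obtain x where x: "x \<in> K" using K by blast
  have "0 \<le> p (multi_partial X (\<lambda>_. 0) f x)"
    by (rule sn_nonneg[OF p smooth_periodic_mem[OF multi_partial_smooth[OF f]]])
  then show "0 \<le> q f"
    using smooth_sn_upper[OF f p K(1) x, of "\<lambda>_. 0" m] by (simp add: q)
  show "q (f + g) \<le> q f + q g" if g: "g \<in> points ?S" for g
  proof -
    obtain b where b: "rapid b" "g = synth b" by (rule smooth_periodic_synthE[OF g])
    show ?thesis
      unfolding q
    proof (rule smooth_sn_least[OF K(2)])
      fix x and \<beta> :: "'d \<Rightarrow> nat" assume x: "x \<in> K" and \<beta>: "(\<Sum>i\<in>UNIV. \<beta> i) \<le> m"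
      have "p (multi_partial X \<beta> (f + g) x) \<le> p (multi_partial X \<beta> f x) + p (multi_partial X \<beta> g x)"
        using multi_partial_synth_plus[OF a(1) b(1), of \<beta> x] a(2) b(2)
          sn_add[OF p smooth_periodic_mem[OF multi_partial_smooth[OF f], of \<beta> x]
            smooth_periodic_mem[OF multi_partial_smooth[OF g], of \<beta> x]] by simp
      also have "\<dots> \<le> smooth_sn K m p f + smooth_sn K m p g"
        by (intro add_mono smooth_sn_upper f g p K x \<beta>)
      finally show "p (multi_partial X \<beta> (f + g) x) \<le> smooth_sn K m p f + smooth_sn K m p g" .
    qed
  qed
  show "q (c *\<^sub>C f) \<le> norm c * q f" for c
    unfolding q
  proof (rule smooth_sn_least[OF K(2)])
    fix x and \<beta> :: "'d \<Rightarrow> nat" assume x: "x \<in> K" and \<beta>: "(\<Sum>i\<in>UNIV. \<beta> i) \<le> m"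
    have "p (multi_partial X \<beta> (c *\<^sub>C f) x) = norm c * p (multi_partial X \<beta> f x)"
      using multi_partial_synth_scale[OF a(1), of \<beta> c x] a(2)
        sn_scale[OF p smooth_periodic_mem[OF multi_partial_smooth[OF f], of \<beta> x]] by simp
    also have "\<dots> \<le> norm c * smooth_sn K m p f"
      by (intro mult_left_mono smooth_sn_upper f p K x \<beta>) simp
    finally show "p (multi_partial X \<beta> (c *\<^sub>C f) x) \<le> norm c * smooth_sn K m p f" .
  qed
qed

lemma smooth_sn_synth:
  fixes a :: "int^'d::{finite,linorder} \<Rightarrow> 'a"
  assumes a: "rapid a" and p: "p \<in> seminorms X" and K: "K \<noteq> {}"
  shows "smooth_sn K m p (synth a) \<le> infsum (\<lambda>n. p (a n) * bracket n ^ m) UNIV"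
proof (rule smooth_sn_least[OF K])
  fix x :: "real^'d::{finite,linorder}" and \<beta> :: "'d \<Rightarrow> nat" assume \<beta>: "(\<Sum>i\<in>UNIV. \<beta> i) \<le> m"
  have "multi_partial X \<beta> (synth a) x = series_limit (\<lambda>n. (torus_char n x * derivative_symbol \<beta> n) *\<^sub>C a n)"
    unfolding multi_partial_synth[OF a] by (simp add: synth_def scaleC_scaleC)
  also have "p \<dots> \<le> 1 * infsum (\<lambda>n. p (a n) * bracket n ^ m) UNIV"
    using norm_derivative_symbol[OF \<beta>]
    by (intro series_limit_multiplier_bound[OF a _ p]) (simp add: norm_mult)
  finally show "p (multi_partial X \<beta> (synth a) x) \<le> infsum (\<lambda>n. p (a n) * bracket n ^ m) UNIV" by simp
qed

text \<open>The series over the lattice is replaced by a supremum at the price of CARD('d) further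
  powers of the bracket, whose inverses have the sum \<open>bracket_sum\<close>.\<close>

lemma smooth_sn_synth_bound:
  fixes a :: "int^'d::{finite,linorder} \<Rightarrow> 'a"
  assumes a: "rapid a" and p: "p \<in> seminorms X" and K: "K \<noteq> {}"
    and C: "\<And>n. p (a n) * bracket n ^ (m + CARD('d)) \<le> C"
  shows "smooth_sn K m p (synth a) \<le> bracket_sum TYPE('d) * C"
proof -
  have "infsum (\<lambda>n. p (a n) * bracket n ^ m) UNIV \<le> infsum (\<lambda>n :: int^'d::{finite,linorder}. C * (1 / bracket n ^ CARD('d))) UNIV"
  proof (rule infsum_mono)
    show "(\<lambda>n. p (a n) * bracket n ^ m) summable_on UNIV" by (rule rapid_summable[OF a p])
    show "(\<lambda>n :: int^'d::{finite,linorder}. C * (1 / bracket n ^ CARD('d))) summable_on UNIV"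
      by (intro summable_on_cmult_right summable_bracket)
    show "p (a n) * bracket n ^ m \<le> C * (1 / bracket n ^ CARD('d))" for n
      using C[of n] bracket_pos[of n] by (simp add: power_add field_simps)
  qed
  also have "\<dots> = C * bracket_sum TYPE('d)"
    unfolding bracket_sum_def by (rule infsum_cmult_right')
  finally show ?thesis
    using smooth_sn_synth[OF a p K, of m] by (simp add: mult.commute)
qed

section \<open>The Fourier transform and its inverse as continuous linear maps\<close>

lemma fourier_coeff_plus:
  assumes f: "f \<in> points (smooth_periodic X)" and g: "g \<in> points (smooth_periodic X)"
  shows "fourier_coeff X (f + g) = fourier_coeff X f + fourier_coeff X g"
proof -
  note r = rapid_fourier_coeff[OF f] rapid_fourier_coeff[OF g]
  have "f + g = synth (fourier_coeff X f + fourier_coeff X g)"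
    by (simp add: synth_plus[OF r] synth_fourier_coeff[OF f] synth_fourier_coeff[OF g])
  then show ?thesis using fourier_coeff_synth[OF rapid_plus[OF r]] by simp
qed

lemma fourier_coeff_scale:
  assumes f: "f \<in> points (smooth_periodic X)"
  shows "fourier_coeff X (c *\<^sub>C f) = c *\<^sub>C fourier_coeff X f"
proof -
  note r = rapid_fourier_coeff[OF f]
  have "c *\<^sub>C f = synth (c *\<^sub>C fourier_coeff X f)"
    by (simp add: synth_scaleC[OF r] synth_fourier_coeff[OF f])
  then show ?thesis using fourier_coeff_synth[OF rapid_scale[OF r]] by simp
qed

lemma continuous_linear_fourier_coeff:
  "continuous_linear (smooth_periodic X :: (real^'d::{finite,linorder} \<Rightarrow> 'a) lcs)
    (rapidly_decreasing X) (fourier_coeff X)"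
proof (rule continuous_linearI[OF lc_space_smooth_periodic lc_space_rapidly_decreasing])
  let ?S = "smooth_periodic X :: (real^'d::{finite,linorder} \<Rightarrow> 'a) lcs"
  show "fourier_coeff X f \<in> points (rapidly_decreasing X)" if "f \<in> points ?S" for f
    using rapid_fourier_coeff[OF that] by (simp add: points_rapidly_decreasing)
  fix q :: "(int^'d::{finite,linorder} \<Rightarrow> 'a) \<Rightarrow> real" assume "q \<in> seminorms (rapidly_decreasing X)"
  then obtain j p where q: "q = rapid_sn j p" and p: "p \<in> seminorms X"
    unfolding seminorms_rapidly_decreasing by blast
  have "q (fourier_coeff X f) \<le> 2 * (1 + real CARD('d)) ^ j * smooth_sn cube (2 * j) p f" if f: "f \<in> points ?S" for f
    unfolding q
    by (rule rapid_sn_least)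
      (rule order_trans[OF mult_left_mono[OF powr_half_le sn_nonneg[OF p fourier_coeff_mem[OF f]]] fourier_coeff_decay[OF f p]])
  moreover have "smooth_sn cube (2 * j) p \<in> seminorms ?S"
    unfolding seminorms_smooth_periodic using compact_cube p
    by (auto intro!: exI[of _ cube] exI[of _ "2 * j"] exI[of _ p] simp: cube_nonempty)
  ultimately show "\<exists>p\<in>seminorms ?S. \<exists>C. \<forall>f\<in>points ?S. q (fourier_coeff X f) \<le> C * p f"
    by blast
qed (rule fourier_coeff_plus fourier_coeff_scale; assumption)+

lemma continuous_linear_synth:
  "continuous_linear (rapidly_decreasing X)
    (smooth_periodic X :: (real^'d::{finite,linorder} \<Rightarrow> 'a) lcs) synth"
proof (rule continuous_linearI[OF lc_space_rapidly_decreasing lc_space_smooth_periodic])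
  let ?S = "smooth_periodic X :: (real^'d::{finite,linorder} \<Rightarrow> 'a) lcs"
  fix q assume "q \<in> seminorms ?S"
  then obtain K m p where q: "q = smooth_sn K m p" and K: "K \<noteq> {}" and p: "p \<in> seminorms X"
    unfolding seminorms_smooth_periodic by blast
  have "q (synth a) \<le> bracket_sum TYPE('d) * rapid_sn (2 * (m + CARD('d))) p a" if "rapid a" for a
    unfolding q by (rule smooth_sn_synth_bound[OF that p K rapid_sn_upper_even[OF that p]])
  moreover have "rapid_sn (2 * (m + CARD('d))) p \<in> seminorms (rapidly_decreasing X)"
  proof -
    \<comment> \<open>The exponent is positive even for m = 0, because the index type is
      nonempty.\<close>
    have "2 * (m + CARD('d)) \<ge> 1" using zero_less_card_finite[where 'a='d] by (simp add: Suc_le_eq)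
    then show ?thesis unfolding seminorms_rapidly_decreasing using p by blast
  qed
  ultimately show "\<exists>p\<in>seminorms (rapidly_decreasing X). \<exists>C. \<forall>a\<in>points (rapidly_decreasing X).
      q (synth a :: real^'d::{finite,linorder} \<Rightarrow> 'a) \<le> C * p a"
    unfolding points_rapidly_decreasing by blast
qed (auto simp: points_rapidly_decreasing synth_smooth_periodic synth_plus synth_scaleC)

theorem isomorphism_fourier_coeff:
  "isomorphism (smooth_periodic X :: (real^'d::{finite,linorder} \<Rightarrow> 'a) lcs)
    (rapidly_decreasing X) (fourier_coeff X)"
proof -
  let ?S = "smooth_periodic X :: (real^'d::{finite,linorder} \<Rightarrow> 'a) lcs"
  interpret S: lc_space ?S by (rule lc_space_smooth_periodic)
  interpret R: lc_space "rapidly_decreasing X :: (int^'d::{finite,linorder} \<Rightarrow> 'a) lcs"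
    by (rule lc_space_rapidly_decreasing)
  have "homeomorphic_maps (lc_topology ?S) (lc_topology (rapidly_decreasing X)) (fourier_coeff X) synth"
    unfolding homeomorphic_maps_def
    using continuous_linear_fourier_coeff continuous_linear_synth
    by (auto simp: continuous_linear_def synth_fourier_coeff points_rapidly_decreasing fourier_coeff_synth)
  then show ?thesis
    unfolding isomorphism_def homeomorphic_map_maps using continuous_linear_fourier_coeff by blast
qed

section \<open>Partial sums of Fourier series\<close>

definition truncate :: "'i set \<Rightarrow> ('i \<Rightarrow> 'a) \<Rightarrow> 'i \<Rightarrow> 'a" where
  "truncate N a = (\<lambda>n. if n \<in> N then a n else 0)"

lemma rapid_truncate: "rapid a \<Longrightarrow> rapid (truncate N a)"
  unfolding truncate_def by (rule rapid_if)

text \<open>On coefficients a partial sum is a truncation, so the algebra of the projections becomes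
  that of index sets.\<close>

lemma sum_fourier_term:
  fixes f :: "real^'d::{finite,linorder} \<Rightarrow> 'a"
  assumes f: "f \<in> points (smooth_periodic X)" and N: "finite N"
  shows "(\<Sum>n\<in>N. fourier_term X n f) = synth (truncate N (fourier_coeff X f))"
proof
  fix x
  have "synth (truncate N (fourier_coeff X f)) x
      = (\<Sum>n\<in>N. torus_char n x *\<^sub>C truncate N (fourier_coeff X f) n)"
    unfolding synth_def
    by (rule series_limit_finite[OF N]) (auto simp: truncate_def intro!: scale_mem fourier_coeff_mem[OF f])
  also have "\<dots> = (\<Sum>n\<in>N. fourier_term X n f x)"
    by (intro sum.cong) (auto simp: truncate_def fourier_term_def torus_char_def)
  finally show "(\<Sum>n\<in>N. fourier_term X n f) x = synth (truncate N (fourier_coeff X f)) x"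
    by (simp add: sum_fun_apply)
qed

lemma fourier_series_converges:
  fixes f :: "real^'d::{finite,linorder} \<Rightarrow> 'a"
  assumes f: "f \<in> points (smooth_periodic X)"
  shows "limitin (lc_topology (smooth_periodic X)) (\<lambda>N. \<Sum>n\<in>N. fourier_term X n f) f
    (finite_subsets_at_top UNIV)"
proof -
  let ?S = "smooth_periodic X :: (real^'d::{finite,linorder} \<Rightarrow> 'a) lcs"
  interpret S: lc_space ?S by (rule lc_space_smooth_periodic)
  let ?a = "fourier_coeff X f"
  have a: "rapid ?a" by (rule rapid_fourier_coeff[OF f])
  have fin: "\<forall>\<^sub>F N in finite_subsets_at_top (UNIV :: (int^'d::{finite,linorder}) set). finite N"
    by (rule eventually_finite_subsets_at_top_weakI) simp
  have mem: "(\<Sum>n\<in>N. fourier_term X n f) \<in> points ?S" if "finite N" for N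
    unfolding sum_fourier_term[OF f that] by (intro synth_smooth_periodic rapid_truncate a)
  show ?thesis
  proof (rule S.limitin_lcI[OF f])
    show "\<forall>\<^sub>F N in finite_subsets_at_top UNIV. (\<Sum>n\<in>N. fourier_term X n f) \<in> points ?S"
      using fin by eventually_elim (rule mem)
    fix q assume qS: "q \<in> seminorms ?S"
    then obtain K m p where q: "q = smooth_sn K m p" and K: "K \<noteq> {}" and p: "p \<in> seminorms X"
      unfolding seminorms_smooth_periodic by blast
    define g where "g n = p (?a n) * bracket n ^ m" for n
    have g: "g summable_on UNIV" "\<And>n. 0 \<le> g n"
      using rapid_summable[OF a p] sn_nonneg[OF p fourier_coeff_mem[OF f]] by (simp_all add: g_def[abs_def])
    have le: "q ((\<Sum>n\<in>N. fourier_term X n f) - f) \<le> tail_sum g N" if N: "finite N" for N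
    proof -
      \<comment> \<open>Minus the coefficients off N, so that its synthesis is the partial sum minus
        f.\<close>
      let ?b = "(- 1) *\<^sub>C truncate (- N) ?a"
      have b: "rapid ?b" by (intro rapid_scale rapid_truncate a)
      have "?a + ?b = truncate N ?a"
        by (auto simp: truncate_def scaleC_fun_def plus_fun_def)
      then have "(\<Sum>n\<in>N. fourier_term X n f) = synth ?a + synth ?b"
        by (simp only: sum_fourier_term[OF f N] synth_plus[OF a b, symmetric])
      then have "(\<Sum>n\<in>N. fourier_term X n f) - f = synth ?b"
        by (simp add: synth_fourier_coeff[OF f])
      then have "q ((\<Sum>n\<in>N. fourier_term X n f) - f) \<le> infsum (\<lambda>n. p (?b n) * bracket n ^ m) UNIV"
        unfolding q using smooth_sn_synth[OF b p K, of m] by simp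
      also have "\<dots> \<le> tail_sum g N"
      proof (rule infsum_le_finite_sums)
        show "(\<lambda>n. p (?b n) * bracket n ^ m) summable_on UNIV" by (rule rapid_summable[OF b p])
        fix M :: "(int^'d::{finite,linorder}) set" assume M: "finite M"
        have "(\<Sum>n\<in>M. p (?b n) * bracket n ^ m) = (\<Sum>n\<in>M. if n \<in> N then 0 else g n)"
          using sn_minus[OF p fourier_coeff_mem[OF f]] sn_zero[OF p]
          by (intro sum.cong) (auto simp: g_def truncate_def scaleC_fun_def)
        also have "\<dots> = sum g (M - N)"
          using M by (intro sum.mono_neutral_cong_right) auto
        also have "\<dots> \<le> tail_sum g N"
          using M N g by (intro tail_sum_bound) auto
        finally show "(\<Sum>n\<in>M. p (?b n) * bracket n ^ m) \<le> tail_sum g N" .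
      qed
      finally show ?thesis .
    qed
    show "((\<lambda>N. q ((\<Sum>n\<in>N. fourier_term X n f) - f)) \<longlongrightarrow> 0) (finite_subsets_at_top UNIV)"
    proof (rule tendsto_sandwich[of "\<lambda>_. 0" _ _ "tail_sum g"])
      show "\<forall>\<^sub>F N in finite_subsets_at_top UNIV. 0 \<le> q ((\<Sum>n\<in>N. fourier_term X n f) - f)"
        using fin by eventually_elim (intro S.sn_nonneg qS S.diff_mem mem f)
      show "\<forall>\<^sub>F N in finite_subsets_at_top UNIV. q ((\<Sum>n\<in>N. fourier_term X n f) - f) \<le> tail_sum g N"
        using fin by eventually_elim (rule le)
    qed (use tail_sum_tendsto[OF g(1)] in auto)
  qed
qed

text \<open>Truncation never enlarges a coefficient, so the decay estimate for f carries over, with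
  constants that do not depend on N.\<close>

lemma continuous_linear_sum_fourier_term:
  fixes N :: "(int^'d::{finite,linorder}) set"
  assumes N: "finite N"
  shows "continuous_linear (smooth_periodic X) (smooth_periodic X) (\<lambda>f. \<Sum>n\<in>N. fourier_term X n f)"
proof (rule continuous_linearI[OF lc_space_smooth_periodic lc_space_smooth_periodic])
  let ?S = "smooth_periodic X :: (real^'d::{finite,linorder} \<Rightarrow> 'a) lcs"
  interpret S: lc_space ?S by (rule lc_space_smooth_periodic)
  fix f assume f: "f \<in> points ?S"
  note rf = rapid_truncate[OF rapid_fourier_coeff[OF f], of N]
  show "(\<Sum>n\<in>N. fourier_term X n f) \<in> points ?S"
    unfolding sum_fourier_term[OF f N] by (intro synth_smooth_periodic rf)
  show "(\<Sum>n\<in>N. fourier_term X n (c *\<^sub>C f)) = c *\<^sub>C (\<Sum>n\<in>N. fourier_term X n f)" for c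
  proof -
    have "truncate N (c *\<^sub>C fourier_coeff X f) = c *\<^sub>C truncate N (fourier_coeff X f)"
      by (auto simp: truncate_def scaleC_fun_def)
    then show ?thesis
      by (simp only: sum_fourier_term[OF f N] sum_fourier_term[OF S.scale_mem[OF f] N]
          fourier_coeff_scale[OF f] synth_scaleC[OF rf])
  qed
  show "(\<Sum>n\<in>N. fourier_term X n (f + g)) = (\<Sum>n\<in>N. fourier_term X n f) + (\<Sum>n\<in>N. fourier_term X n g)"
    if g: "g \<in> points ?S" for g
  proof -
    have "truncate N (fourier_coeff X f + fourier_coeff X g)
        = truncate N (fourier_coeff X f) + truncate N (fourier_coeff X g)"
      by (auto simp: truncate_def plus_fun_def)
    then show ?thesis
      by (simp only: sum_fourier_term[OF f N] sum_fourier_term[OF g N] sum_fourier_term[OF S.add_mem[OF f g] N]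
          fourier_coeff_plus[OF f g] synth_plus[OF rf rapid_truncate[OF rapid_fourier_coeff[OF g]]])
  qed
next
  let ?S = "smooth_periodic X :: (real^'d::{finite,linorder} \<Rightarrow> 'a) lcs"
  fix q assume "q \<in> seminorms ?S"
  then obtain K m p where q: "q = smooth_sn K m p" and K: "K \<noteq> {}" and p: "p \<in> seminorms X"
    unfolding seminorms_smooth_periodic by blast
  let ?m = "m + CARD('d)"
  let ?C = "2 * (1 + real CARD('d)) ^ ?m"
  have "q (\<Sum>n\<in>N. fourier_term X n f) \<le> (bracket_sum TYPE('d) * ?C) * smooth_sn cube (2 * ?m) p f"
    if f: "f \<in> points ?S" for f
  proof -
    have "smooth_sn K m p (synth (truncate N (fourier_coeff X f)))
        \<le> bracket_sum TYPE('d) * (?C * smooth_sn cube (2 * ?m) p f)"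
    proof (rule smooth_sn_synth_bound[OF rapid_truncate[OF rapid_fourier_coeff[OF f]] p K])
      fix n
      have "p (truncate N (fourier_coeff X f) n) \<le> p (fourier_coeff X f n)"
        using sn_nonneg[OF p fourier_coeff_mem[OF f]] sn_zero[OF p] by (simp add: truncate_def)
      then have "p (truncate N (fourier_coeff X f) n) * bracket n ^ ?m \<le> p (fourier_coeff X f n) * bracket n ^ ?m"
        by (intro mult_right_mono) auto
      also have "\<dots> \<le> ?C * smooth_sn cube (2 * ?m) p f" by (rule fourier_coeff_decay[OF f p])
      finally show "p (truncate N (fourier_coeff X f) n) * bracket n ^ ?m \<le> ?C * smooth_sn cube (2 * ?m) p f" .
    qed
    then show ?thesis unfolding q sum_fourier_term[OF f N] by (simp only: mult.assoc)
  qed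
  moreover have "smooth_sn cube (2 * ?m) p \<in> seminorms ?S"
    unfolding seminorms_smooth_periodic using compact_cube p
    by (auto intro!: exI[of _ cube] exI[of _ "2 * ?m"] exI[of _ p] simp: cube_nonempty)
  ultimately show "\<exists>r\<in>seminorms ?S. \<exists>C. \<forall>f\<in>points ?S. q (\<Sum>n\<in>N. fourier_term X n f) \<le> C * r f"
    by blast
qed

theorem schauder_decomposition_fourier:
  assumes nontrivial: "c \<in> points X" "c \<noteq> 0"
  shows "schauder_decomposition (smooth_periodic X :: (real^'d::{finite,linorder} \<Rightarrow> 'a) lcs)
    (\<lambda>k f. \<Sum>n | norm (real_vec n) \<le> real k. fourier_term X n f)"
proof -
  let ?S = "smooth_periodic X :: (real^'d::{finite,linorder} \<Rightarrow> 'a) lcs"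
  define N where "N k = {n :: int^'d::{finite,linorder}. norm (real_vec n) \<le> real k}" for k :: nat
  define P where "P k f = (\<Sum>n\<in>N k. fourier_term X n f)" for k and f :: "real^'d::{finite,linorder} \<Rightarrow> 'a"
  have fin: "finite (N k)" for k unfolding N_def by (rule finite_lattice_ball)
  have P: "P k f = synth (truncate (N k) (fourier_coeff X f))" if "f \<in> points ?S" for k f
    unfolding P_def by (rule sum_fourier_term[OF that fin])
  have memP: "P k f \<in> points ?S" if "f \<in> points ?S" for k f
    unfolding P[OF that] by (intro synth_smooth_periodic rapid_truncate rapid_fourier_coeff that)
  have coeff: "fourier_coeff X (P k f) = truncate (N k) (fourier_coeff X f)" if "f \<in> points ?S" for k f
    unfolding P[OF that] by (intro fourier_coeff_synth rapid_truncate rapid_fourier_coeff that)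
  have PP: "P k (P j f) = P (min j k) f" if f: "f \<in> points ?S" for k j f
  proof -
    have "truncate (N k) (truncate (N j) a) = truncate (N (min j k)) a" for a :: "int^'d::{finite,linorder} \<Rightarrow> 'a"
      by (auto simp: truncate_def N_def of_nat_min)
    note tt = this
    have "P k (P j f) = synth (truncate (N k) (truncate (N j) (fourier_coeff X f)))"
      by (simp only: P[OF memP[OF f]] coeff[OF f])
    then show ?thesis by (simp only: tt P[OF f])
  qed
  have "\<exists>f\<in>points ?S. P k f \<noteq> P j f" if "j < k" for k j
  proof
    \<comment> \<open>A lattice point of norm exactly k, inside the k-th ball and outside the j-th.
      It carries the nonzero vector c; here the nontriviality of the space enters.\<close>
    let ?n = "axis undefined (int k) :: int^'d::{finite,linorder}"
    let ?a = "\<lambda>n. if n \<in> {?n} then c else 0"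
    have a: "rapid ?a" using nontrivial by (intro rapid_finite) auto
    show f: "synth ?a \<in> points ?S" by (rule synth_smooth_periodic[OF a])
    have "real_vec ?n = axis undefined (real k)" by (auto simp: vec_eq_iff axis_def)
    then have "norm (real_vec ?n) = real k" by (simp add: norm_eq_sqrt_inner inner_axis_axis)
    then have "?n \<in> N k" "?n \<notin> N j" using that by (auto simp: N_def)
    then have "fourier_coeff X (P k (synth ?a)) ?n \<noteq> fourier_coeff X (P j (synth ?a)) ?n"
      unfolding coeff[OF f] fourier_coeff_synth[OF a] truncate_def using nontrivial by simp
    then show "P k (synth ?a) \<noteq> P j (synth ?a)" by metis
  qed
  then have ne: "\<exists>f\<in>points ?S. P k f \<noteq> P j f" if "k \<noteq> j" for k j
    using that by (metis linorder_neqE_nat)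
  have lim: "limitin (lc_topology ?S) (\<lambda>k. P k f) f sequentially" if f: "f \<in> points ?S" for f
    using fourier_series_converges[OF f] filterlim_lattice_balls
    unfolding limitin_def P_def N_def by (auto simp: filterlim_iff)
  have "schauder_decomposition ?S P"
    unfolding schauder_decomposition_def
    using continuous_linear_sum_fourier_term[OF fin] PP ne lim by (auto simp: P_def[abs_def])
  then show ?thesis by (simp add: P_def[abs_def] N_def)
qed

end

section \<open>The \<open>\<epsilon>\<close>-product representation\<close>

global_interpretation scalar: lc_complete scalar_lcs
  by (rule lc_complete_scalar)

lemma scaleC_fun_apply: "(c *\<^sub>C f) x = c *\<^sub>C f x"
  by (simp add: scaleC_fun_def)

section \<open>The dual with uniform convergence on compact discs\<close>

context lc_space
begin

lemma dual_zero_mem: "0 \<in> dual X"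
  by (simp add: dual_def operators_def continuous_linear_def lc_topology_scalar zero_fun_def)

lemma dual_add_mem:
  assumes "\<phi> \<in> dual X" "\<psi> \<in> dual X"
  shows "\<phi> + \<psi> \<in> dual X"
proof -
  have "continuous_map (lc_topology X) euclidean (\<lambda>x. \<phi> x + \<psi> x)"
    by (intro continuous_map_add dual_continuous_map assms)
  then show ?thesis
    using dual_add[OF assms(1)] dual_add[OF assms(2)] dual_scale[OF assms(1)] dual_scale[OF assms(2)]
      dual_outside[OF assms(1)] dual_outside[OF assms(2)]
    by (simp add: dual_def operators_def continuous_linear_def lc_topology_scalar plus_fun_def
        scaleC_complex_def distrib_left)
qed

lemma dual_scale_mem:
  assumes "\<phi> \<in> dual X"
  shows "c *\<^sub>C \<phi> \<in> dual X"
proof -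
  have "continuous_map euclidean euclidean (\<lambda>z :: complex. c * z)"
    by (simp add: continuous_on_mult_const)
  from continuous_map_compose[OF dual_continuous_map[OF assms] this]
  have "continuous_map (lc_topology X) euclidean (\<lambda>x. c * \<phi> x)"
    by (simp add: o_def)
  then show ?thesis
    using dual_add[OF assms] dual_scale[OF assms] dual_outside[OF assms]
    by (simp add: dual_def operators_def continuous_linear_def lc_topology_scalar scaleC_fun_def
        scaleC_complex_def distrib_left)
qed

definition compact_sn :: "'a set \<Rightarrow> ('a \<Rightarrow> complex) \<Rightarrow> real" where
  "compact_sn K \<phi> = (SUP x\<in>K. norm (\<phi> x))"

lemma points_dual_kappa: "points (dual_kappa X) = dual X"
  by (simp add: dual_kappa_def)

lemma seminorms_dual_kappa:
  "seminorms (dual_kappa X) = {compact_sn K | K. absolutely_convex K \<and> compactin (lc_topology X) K}"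
  unfolding dual_kappa_def compact_sn_def[abs_def] by simp

lemma compact_sn_upper:
  assumes \<phi>: "\<phi> \<in> dual X" and K: "compactin (lc_topology X) K" and x: "x \<in> K"
  shows "norm (\<phi> x) \<le> compact_sn K \<phi>"
proof -
  have "compact (\<phi> ` K)"
    using image_compactin[OF K dual_continuous_map[OF \<phi>]] by simp
  then have "bounded (\<phi> ` K)" by (rule compact_imp_bounded)
  then have "bdd_above ((\<lambda>x. norm (\<phi> x)) ` K)"
    by (auto simp: bounded_iff bdd_above_def)
  from cSUP_upper[OF x this] show ?thesis by (simp add: compact_sn_def)
qed

lemma compact_sn_least:
  assumes "absolutely_convex K" "\<And>x. x \<in> K \<Longrightarrow> norm (\<phi> x) \<le> B"
  shows "compact_sn K \<phi> \<le> B"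
  unfolding compact_sn_def using assms by (intro cSUP_least) (auto simp: absolutely_convex_def)

lemma lc_space_dual_kappa: "lc_space (dual_kappa X)"
proof (rule lc_spaceI; (unfold points_dual_kappa)?)
  show "0 \<in> dual X" by (rule dual_zero_mem)
  show "\<phi> + \<psi> \<in> dual X" if "\<phi> \<in> dual X" "\<psi> \<in> dual X" for \<phi> \<psi>
    using that by (rule dual_add_mem)
  show "c *\<^sub>C \<phi> \<in> dual X" if "\<phi> \<in> dual X" for \<phi> c
    using that by (rule dual_scale_mem)
  have "absolutely_convex {0 :: 'a}" by (simp add: absolutely_convex_def)
  moreover have "compactin (lc_topology X) {0}"
    using zero_mem by (intro finite_imp_compactin) auto
  ultimately show "seminorms (dual_kappa X) \<noteq> {}"
    unfolding seminorms_dual_kappa by blast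
  fix q \<phi> assume "q \<in> seminorms (dual_kappa X)" and \<phi>: "\<phi> \<in> dual X"
  then obtain K where q: "q = compact_sn K" and K: "absolutely_convex K" "compactin (lc_topology X) K"
    unfolding seminorms_dual_kappa by blast
  obtain x where x: "x \<in> K" using K(1) by (auto simp: absolutely_convex_def)
  show "0 \<le> q \<phi>"
    unfolding q by (rule order_trans[OF norm_ge_zero compact_sn_upper[OF \<phi> K(2) x]])
  show "q (\<phi> + \<psi>) \<le> q \<phi> + q \<psi>" if \<psi>: "\<psi> \<in> dual X" for \<psi>
    unfolding q
  proof (rule compact_sn_least[OF K(1)])
    fix x assume x: "x \<in> K"
    show "norm ((\<phi> + \<psi>) x) \<le> compact_sn K \<phi> + compact_sn K \<psi>"
      unfolding plus_fun_apply
      by (rule order_trans[OF norm_triangle_ineq add_mono[OF compact_sn_upper[OF \<phi> K(2) x] compact_sn_upper[OF \<psi> K(2) x]]])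
  qed
  show "q (c *\<^sub>C \<phi>) \<le> norm c * q \<phi>" for c
    unfolding q
  proof (rule compact_sn_least[OF K(1)])
    fix x assume x: "x \<in> K"
    show "norm ((c *\<^sub>C \<phi>) x) \<le> norm c * compact_sn K \<phi>"
      using mult_left_mono[OF compact_sn_upper[OF \<phi> K(2) x], of "norm c"]
      by (simp add: scaleC_fun_def scaleC_complex_def norm_mult)
  qed
qed

lemma sn_bounded_on_compact:
  assumes p: "p \<in> seminorms X" and K: "compactin (lc_topology X) K"
  obtains B where "\<And>x. x \<in> K \<Longrightarrow> p x \<le> B"
proof -
  define U where "U n = {y \<in> points X. p (y - 0) < real (Suc n)}" for n
  have KX: "K \<subseteq> points X" using compactin_subset_topspace[OF K] by simp
  have "\<exists>\<F>. finite \<F> \<and> \<F> \<subseteq> range U \<and> K \<subseteq> \<Union> \<F>"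
  proof (rule compactinD[OF K])
    show "openin (lc_topology X) V" if "V \<in> range U" for V
      using that openin_lcI[OF p zero_mem] by (auto simp: U_def)
    show "K \<subseteq> \<Union> (range U)"
    proof
      fix x assume x: "x \<in> K"
      have "p x < real (Suc (nat \<lceil>p x\<rceil>))" by linarith
      then have "x \<in> U (nat \<lceil>p x\<rceil>)" using x KX by (auto simp: U_def)
      then show "x \<in> \<Union> (range U)" by blast
    qed
  qed
  then obtain I where I: "finite I" "K \<subseteq> \<Union> (U ` I)"
    by (metis finite_subset_image)
  \<comment> \<open>\<open>insert 0\<close> gives the maximum a meaning when no ball is
    selected.\<close>
  have "p x \<le> real (Suc (Max (insert 0 I)))" if xK: "x \<in> K" for x
  proof -
    obtain n where n: "n \<in> I" "x \<in> U n" using xK I by blast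
    then have "n \<le> Max (insert 0 I)" using I by simp
    then show ?thesis using n by (simp add: U_def)
  qed
  then show thesis using that by blast
qed

end

lemma continuous_linear_sum:
  assumes X: "lc_space X" and T: "continuous_linear X Y T" and f: "\<And>i. i \<in> A \<Longrightarrow> f i \<in> points X"
  shows "T (sum f A) = (\<Sum>i\<in>A. T (f i))"
proof -
  interpret X: lc_space X by fact
  have T0: "T 0 = 0"
    using T X.zero_mem unfolding continuous_linear_def by (metis complex_vector.scale_zero_left)
  show ?thesis
    using f
  proof (induction A rule: infinite_finite_induct)
    case (insert i A)
    then have "T (f i + sum f A) = T (f i) + T (sum f A)"
      using T X.sum_mem[of A f] unfolding continuous_linear_def by auto
    then show ?case using insert by simp
  qed (simp_all add: T0)
qed

section \<open>Characters and functionals on the test space\<close>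

abbreviation test_space :: "(real^'d::{finite,linorder} \<Rightarrow> complex) lcs" where
  "test_space \<equiv> smooth_periodic scalar_lcs"

interpretation test: lc_space "test_space :: (real^'d::{finite,linorder} \<Rightarrow> complex) lcs"
  by (rule scalar.lc_space_smooth_periodic)

lemma scalar_identity_dual: "(\<lambda>z. z) \<in> dual scalar_lcs"
  by (rule scalar.dualI[of _ norm 1]) (simp_all add: scaleC_complex_def)

lemma norm_scalar_sn: "norm \<in> seminorms scalar_lcs" by simp

lemma scalar_fourier_coeff:
  "g \<in> points test_space \<Longrightarrow> fourier_coeff scalar_lcs g n = torus_mean (\<lambda>x. g x * torus_char (- n) x)"
  using scalar.dual_fourier_coeff[OF _ scalar_identity_dual] .

lemma rapid_delta: "scalar.rapid (\<lambda>m :: int^'d::finite. if m \<in> {n} then c else 0)"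
  by (rule scalar.rapid_finite) auto

text \<open>Writing characters as syntheses of one-point families makes the estimates for
  \<open>synth\<close> available for them.\<close>

lemma synth_delta:
  "scalar.synth (\<lambda>m :: int^'d::{finite,linorder}. if m \<in> {n} then c else 0) = c *\<^sub>C torus_char n"
proof
  fix x :: "real^'d::{finite,linorder}"
  have "scalar.synth (\<lambda>m. if m \<in> {n} then c else 0) x
      = (\<Sum>m\<in>{n}. torus_char m x *\<^sub>C (if m \<in> {n} then c else 0))"
    unfolding scalar.synth_def by (rule scalar.series_limit_finite) auto
  then show "scalar.synth (\<lambda>m. if m \<in> {n} then c else 0) x = (c *\<^sub>C torus_char n) x"
    by (simp add: scaleC_fun_def scaleC_complex_def mult.commute)
qed

lemma torus_char_smooth: "torus_char n \<in> points (test_space :: (real^'d::{finite,linorder} \<Rightarrow> complex) lcs)"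
  using scalar.synth_smooth_periodic[OF rapid_delta, of n 1] synth_delta[of n 1] by simp

lemma smooth_sn_torus_char:
  fixes n :: "int^'d::{finite,linorder}"
  assumes K: "K \<noteq> {}"
  shows "scalar.smooth_sn K m norm (torus_char n) \<le> bracket n ^ m"
proof -
  let ?a = "\<lambda>m :: int^'d::{finite,linorder}. if m \<in> {n} then 1 else 0 :: complex"
  have "scalar.smooth_sn K m norm (torus_char n) \<le> infsum (\<lambda>k. norm (?a k) * bracket k ^ m) UNIV"
    using scalar.smooth_sn_synth[OF rapid_delta norm_scalar_sn K, of m n 1] synth_delta[of n 1] by simp
  also have "\<dots> \<le> bracket n ^ m"
  proof (rule infsum_le_finite_sums)
    show "(\<lambda>k. norm (?a k) * bracket k ^ m) summable_on UNIV"
      by (rule scalar.rapid_summable[OF rapid_delta norm_scalar_sn])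
    fix M :: "(int^'d::{finite,linorder}) set" assume M: "finite M"
    have "(\<Sum>k\<in>M. norm (?a k) * bracket k ^ m) = (\<Sum>k\<in>M. if k = n then bracket n ^ m else 0)"
      by (intro sum.cong) auto
    also have "\<dots> \<le> bracket n ^ m" using M by simp
    finally show "(\<Sum>k\<in>M. norm (?a k) * bracket k ^ m) \<le> bracket n ^ m" .
  qed
  finally show ?thesis .
qed

text \<open>A functional is bounded by finitely many seminorms, each of which grows polynomially
  along the characters. Hence n \<mapsto> \<phi>(e_n) is an admissible multiplier of rapid
  families.\<close>

lemma dual_torus_char_bound:
  assumes \<phi>: "\<phi> \<in> dual (test_space :: (real^'d::{finite,linorder} \<Rightarrow> complex) lcs)"
  shows "\<exists>B k. \<forall>n. norm (\<phi> (torus_char n)) \<le> B * bracket n ^ k"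
proof -
  obtain S C where S: "finite S" "S \<subseteq> seminorms (test_space :: (real^'d::{finite,linorder} \<Rightarrow> complex) lcs)" "C \<ge> 0"
    "\<forall>g\<in>points test_space. norm (\<phi> g) \<le> C * (\<Sum>q\<in>S. q g)"
    using test.dual_bound[OF \<phi>] by metis
  have "\<exists>m. \<forall>n. q (torus_char n) \<le> bracket n ^ m" if qS: "q \<in> S" for q
  proof -
    have "q \<in> seminorms (test_space :: (real^'d::{finite,linorder} \<Rightarrow> complex) lcs)" using qS S(2) by blast
    then obtain K m where "q = scalar.smooth_sn K m norm" "K \<noteq> {}"
      unfolding scalar.seminorms_smooth_periodic by auto
    then show ?thesis using smooth_sn_torus_char[of K m] by blast
  qed
  then obtain m where m: "\<And>q n. q \<in> S \<Longrightarrow> q (torus_char n) \<le> bracket n ^ m q" by metis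
  \<comment> \<open>The sum of the exponents dominates each of them.\<close>
  define k where "k = (\<Sum>q\<in>S. m q)"
  have mk: "m q \<le> k" if "q \<in> S" for q
    unfolding k_def using S(1) that by (intro member_le_sum) auto
  have "norm (\<phi> (torus_char n)) \<le> (C * real (card S)) * bracket n ^ k" for n
  proof -
    have "(\<Sum>q\<in>S. q (torus_char n)) \<le> real (card S) * bracket n ^ k"
      by (rule sum_bounded_above) (rule order_trans[OF m bracket_power_mono[OF mk]])
    then have "C * (\<Sum>q\<in>S. q (torus_char n)) \<le> C * (real (card S) * bracket n ^ k)"
      by (intro mult_left_mono S(3))
    moreover have "norm (\<phi> (torus_char n)) \<le> C * (\<Sum>q\<in>S. q (torus_char n))"
      using S(4) torus_char_smooth by blast
    ultimately show ?thesis by (simp add: mult.assoc)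
  qed
  then show ?thesis by blast
qed

lemma point_eval_dual:
  "point_eval test_space x \<in> dual (test_space :: (real^'d::{finite,linorder} \<Rightarrow> complex) lcs)"
proof (rule test.dualI[of _ "scalar.smooth_sn {x} 0 norm" 1])
  show "scalar.smooth_sn {x} 0 norm \<in> seminorms (test_space :: (real^'d::{finite,linorder} \<Rightarrow> complex) lcs)"
    unfolding scalar.seminorms_smooth_periodic
    by (intro CollectI exI[of _ "{x}"] exI[of _ 0] exI[of _ norm]) simp
  show "norm (point_eval test_space x g) \<le> 1 * scalar.smooth_sn {x} 0 norm g"
    if g: "g \<in> points test_space" for g :: "real^'d::{finite,linorder} \<Rightarrow> complex"
    using scalar.smooth_sn_upper[OF g norm_scalar_sn, of "{x}" x "\<lambda>_. 0" 0] g
      multi_partial_single[of scalar_lcs undefined 0 g]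
    by (simp add: point_eval_def)
qed (auto simp: point_eval_def test.add_mem test.scale_mem scaleC_fun_apply scaleC_complex_def)

lemma point_eval_rapid_dual:
  "point_eval (rapidly_decreasing scalar_lcs) n \<in> dual (rapidly_decreasing scalar_lcs :: (int^'d::finite \<Rightarrow> complex) lcs)"
proof -
  let ?R = "rapidly_decreasing scalar_lcs :: (int^'d::finite \<Rightarrow> complex) lcs"
  interpret R: lc_space ?R by (rule scalar.lc_space_rapidly_decreasing)
  show ?thesis
  proof (rule R.dualI[of _ "scalar.rapid_sn 2 norm" 1])
    show "scalar.rapid_sn 2 norm \<in> seminorms ?R"
      unfolding scalar.seminorms_rapidly_decreasing
      by (intro CollectI exI[of _ 2] exI[of _ norm]) simp
    show "norm (point_eval ?R n a) \<le> 1 * scalar.rapid_sn 2 norm a" if a: "a \<in> points ?R" for a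
    proof -
      have "scalar.rapid a" using a by (simp add: scalar.points_rapidly_decreasing)
      from scalar.rapid_sn_upper_even[OF this norm_scalar_sn, of n 1]
      have "norm (a n) * bracket n \<le> scalar.rapid_sn 2 norm a" by simp
      moreover have "norm (a n) * 1 \<le> norm (a n) * bracket n"
        by (intro mult_left_mono bracket_ge_1) simp
      ultimately show ?thesis using a by (simp add: point_eval_def)
    qed
  qed (auto simp: point_eval_def R.add_mem R.scale_mem scaleC_fun_apply scaleC_complex_def)
qed

text \<open>Extended by 0 because members of \<open>dual\<close> vanish outside the space.\<close>

definition coeff_functional :: "int^'d::{finite,linorder} \<Rightarrow> (real^'d::{finite,linorder} \<Rightarrow> complex) \<Rightarrow> complex" where
  "coeff_functional n g = (if g \<in> points test_space then fourier_coeff scalar_lcs g n else 0)"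

lemma transpose_point_eval:
  "transpose_op test_space (fourier_coeff scalar_lcs) (point_eval (rapidly_decreasing scalar_lcs) n) = coeff_functional n"
  using scalar.rapid_fourier_coeff
  by (auto simp: fun_eq_iff transpose_op_def coeff_functional_def point_eval_def scalar.points_rapidly_decreasing)

lemma coeff_functional_dual: "coeff_functional n \<in> dual test_space"
proof (rule test.dualI[of _ "scalar.smooth_sn cube 0 norm" 2])
  show "scalar.smooth_sn cube 0 norm \<in> seminorms test_space"
    unfolding scalar.seminorms_smooth_periodic
    by (intro CollectI exI[of _ cube] exI[of _ 0] exI[of _ norm]) (simp add: compact_cube cube_nonempty)
  \<comment> \<open>The constant is that of \<open>fourier_coeff_decay\<close> for m = 0.\<close>
  show "norm (coeff_functional n g) \<le> 2 * scalar.smooth_sn cube 0 norm g" if g: "g \<in> points test_space" for g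
    using scalar.fourier_coeff_decay[OF g norm_scalar_sn, of n 0] g by (simp add: coeff_functional_def)
qed (auto simp: coeff_functional_def test.add_mem test.scale_mem scalar.fourier_coeff_plus
    scalar.fourier_coeff_scale scaleC_fun_apply scaleC_complex_def)

definition riemann_functional :: "nat \<Rightarrow> int^'d::{finite,linorder} \<Rightarrow> (real^'d::{finite,linorder} \<Rightarrow> complex) \<Rightarrow> complex" where
  "riemann_functional k n = (\<Sum>v\<in>grid k. complex_of_real (weight k v) *\<^sub>C torus_char (- n) v *\<^sub>C point_eval test_space v)"

text \<open>The error bound for a Riemann sum depends on g only through bounds for g and its first
  derivatives on \<open>wide_cube\<close>. One seminorm of the test space controls these, and a
  compact K is bounded in it, so the convergence is uniform on K.\<close>

lemma riemann_functional_limit: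
  fixes n :: "int^'d::{finite,linorder}"
  shows "limitin (lc_topology (dual_kappa test_space)) (\<lambda>k. riemann_functional k n) (coeff_functional n) sequentially"
proof -
  interpret D: lc_space "dual_kappa (test_space :: (real^'d::{finite,linorder} \<Rightarrow> complex) lcs)"
    by (rule test.lc_space_dual_kappa)
  have mem: "riemann_functional k n \<in> points (dual_kappa test_space)" for k
    unfolding riemann_functional_def
    by (intro D.sum_mem D.scale_mem) (simp add: test.points_dual_kappa point_eval_dual)
  have lmem: "coeff_functional n \<in> points (dual_kappa test_space)"
    by (simp add: test.points_dual_kappa coeff_functional_dual)
  show ?thesis
  proof (rule D.limitin_lcI[OF lmem])
    show "\<forall>\<^sub>F k in sequentially. riemann_functional k n \<in> points (dual_kappa test_space)"
      using mem by simp
    fix q assume qD: "q \<in> seminorms (dual_kappa (test_space :: (real^'d::{finite,linorder} \<Rightarrow> complex) lcs))"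
    then obtain K where q: "q = test.compact_sn K"
      and K: "absolutely_convex K" "compactin (lc_topology (test_space :: (real^'d::{finite,linorder} \<Rightarrow> complex) lcs)) K"
      unfolding test.seminorms_dual_kappa by blast
    let ?W = "wide_cube :: (real^'d::{finite,linorder}) set"
    have W: "?W \<noteq> {}" using cube_nonempty cube_subset_wide by blast
    let ?r = "scalar.smooth_sn ?W 1 norm"
    have "?r \<in> seminorms test_space"
      unfolding scalar.seminorms_smooth_periodic
      using W compact_wide_cube by (intro CollectI exI[of _ ?W] exI[of _ 1] exI[of _ norm]) simp
    then obtain B where B: "\<And>g. g \<in> K \<Longrightarrow> ?r g \<le> B"
      using test.sn_bounded_on_compact[OF _ K(2)] by blast
    define L where "L = (B + B * norm (real_vec n)) * real CARD('d)"
    have le: "q (riemann_functional k n - coeff_functional n) \<le> L * (1 / 2) ^ k" for k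
      unfolding q
    proof (rule test.compact_sn_least[OF K(1)])
      fix g assume gK: "g \<in> K"
      then have g: "g \<in> points test_space" using compactin_subset_topspace[OF K(2)] by auto
      have rg: "riemann_functional k n g = (\<Sum>v\<in>grid k. of_real (weight k v) * (g v * torus_char (- n) v))"
        unfolding riemann_functional_def sum_fun_apply
        by (simp add: scaleC_fun_def scaleC_complex_def point_eval_def g mult_ac)
      have cg: "coeff_functional n g = torus_mean (\<lambda>x. g x * torus_char (- n) x)"
        using g by (simp add: coeff_functional_def scalar_fourier_coeff)
      have "norm (coeff_functional n g - riemann_functional k n g) \<le> L * (1 / 2) ^ k"
        unfolding rg cg L_def
      proof (rule riemann_char_error)
        show "continuous_on UNIV g" using scalar.dual_smooth(1)[OF g scalar_identity_dual] .
        show "has_partial scalar_lcs i g x (partial scalar_lcs i g x)" for i x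
          using scalar.dual_smooth(2)[OF g scalar_identity_dual] .
        fix x assume x: "x \<in> ?W"
        show "norm (g x) \<le> B"
          using scalar.smooth_sn_upper[OF g norm_scalar_sn compact_wide_cube x, of "\<lambda>_. 0" 1] B[OF gK]
            multi_partial_single[of scalar_lcs undefined 0 g] by simp
        show "norm (partial scalar_lcs i g x) \<le> B" for i
          using scalar.smooth_sn_upper[OF g norm_scalar_sn compact_wide_cube x, of "\<lambda>l. if l = i then 1 else 0" 1] B[OF gK]
            multi_partial_single[of scalar_lcs i 1 g] by simp
      qed
      then show "norm ((riemann_functional k n - coeff_functional n) g) \<le> L * (1 / 2) ^ k"
        by (simp add: norm_minus_commute)
    qed
    show "(\<lambda>k. q (riemann_functional k n - coeff_functional n)) \<longlonglongrightarrow> 0"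
    proof (rule tendsto_sandwich[of "\<lambda>_. 0" _ _ "\<lambda>k. L * (1 / 2) ^ k"])
      have "(\<lambda>k. L * (1 / 2) ^ k) \<longlonglongrightarrow> L * 0"
        by (intro tendsto_mult tendsto_const LIMSEQ_power_zero) simp
      then show "(\<lambda>k. L * (1 / 2) ^ k) \<longlonglongrightarrow> 0" by simp
      show "\<forall>\<^sub>F k in sequentially. 0 \<le> q (riemann_functional k n - coeff_functional n)"
        by (intro always_eventually allI D.sn_nonneg[OF qD] D.diff_mem mem lmem)
    qed (use le in auto)
  qed
qed

text \<open>By Tychonoff's theorem the boxes of coefficient families are compact, and synthesis is continuous on
  them for the topology of coordinatewise convergence.\<close>

lemma synth_box_compact:
  fixes b :: "int^'d::{finite,linorder} \<Rightarrow> real"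
  assumes b: "\<And>n. 0 \<le> b n" "\<And>m. \<exists>C. \<forall>n. b n * bracket n ^ m \<le> C"
  defines "D \<equiv> {c :: int^'d::{finite,linorder} \<Rightarrow> complex. \<forall>n. norm (c n) \<le> b n}"
  shows "absolutely_convex (scalar.synth ` D)" "compactin (lc_topology test_space) (scalar.synth ` D)"
proof -
  have rapid: "scalar.rapid c" if "c \<in> D" for c
    unfolding scalar.rapid_def
  proof (intro conjI allI ballI)
    fix m p assume "p \<in> seminorms scalar_lcs"
    then have p: "p = norm" by simp
    obtain C where C: "\<And>n. b n * bracket n ^ m \<le> C" using b(2) by blast
    have "norm (c n) * bracket n ^ m \<le> C" for n
      using that by (intro order_trans[OF mult_right_mono C]) (auto simp: D_def)
    then show "\<exists>C. \<forall>n. p (c n) * bracket n ^ m \<le> C" unfolding p by blast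
  qed simp
  show "absolutely_convex (scalar.synth ` D)"
    unfolding absolutely_convex_def
  proof (intro conjI ballI allI impI)
    have "(\<lambda>_. 0) \<in> D" using b(1) by (simp add: D_def)
    then show "scalar.synth ` D \<noteq> {}" by blast
    fix f g \<alpha> \<beta> assume "f \<in> scalar.synth ` D" "g \<in> scalar.synth ` D" and ab: "norm (\<alpha> :: complex) + norm (\<beta> :: complex) \<le> 1"
    then obtain c c' where c: "c \<in> D" "f = scalar.synth c" and c': "c' \<in> D" "g = scalar.synth c'" by blast
    have "norm (\<alpha> * c n + \<beta> * c' n) \<le> b n" for n
    proof -
      have "norm (\<alpha> * c n + \<beta> * c' n) \<le> norm \<alpha> * norm (c n) + norm \<beta> * norm (c' n)"
        using norm_triangle_ineq[of "\<alpha> * c n" "\<beta> * c' n"] by (simp add: norm_mult)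
      also have "\<dots> \<le> norm \<alpha> * b n + norm \<beta> * b n"
        using c(1) c'(1) by (intro add_mono mult_left_mono) (auto simp: D_def)
      also have "\<dots> \<le> 1 * b n"
        unfolding distrib_right[symmetric] by (intro mult_right_mono ab b)
      finally show ?thesis by simp
    qed
    then have "\<alpha> *\<^sub>C c + \<beta> *\<^sub>C c' \<in> D"
      by (simp add: D_def scaleC_fun_def scaleC_complex_def)
    moreover have "scalar.synth (\<alpha> *\<^sub>C c + \<beta> *\<^sub>C c') = \<alpha> *\<^sub>C f + \<beta> *\<^sub>C g"
      unfolding c(2) c'(2)
      by (simp only: scalar.synth_plus[OF scalar.rapid_scale[OF rapid[OF c(1)]] scalar.rapid_scale[OF rapid[OF c'(1)]]]
          scalar.synth_scaleC[OF rapid[OF c(1)]] scalar.synth_scaleC[OF rapid[OF c'(1)]])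
    ultimately show "\<alpha> *\<^sub>C f + \<beta> *\<^sub>C g \<in> scalar.synth ` D" by (metis imageI)
  qed
  let ?P = "product_topology (\<lambda>_ :: int^'d::{finite,linorder}. euclidean :: complex topology) UNIV"
  have D: "D = Pi\<^sub>E UNIV (\<lambda>n. cball 0 (b n))"
    by (auto simp: D_def)
  have "compactin ?P D"
    unfolding D compactin_PiE by simp
  then have cD: "compactin (subtopology ?P D) D"
    by (simp add: compactin_subtopology)
  have "continuous_map (subtopology ?P D) (lc_topology test_space) scalar.synth"
  proof (rule test.continuous_map_from_bound)
    show "scalar.synth c \<in> points test_space" if "c \<in> topspace (subtopology ?P D)" for c
      using that by (intro scalar.synth_smooth_periodic rapid) simp
    fix q c and e :: real
    assume "q \<in> seminorms (test_space :: (real^'d::{finite,linorder} \<Rightarrow> complex) lcs)"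
      and "c \<in> topspace (subtopology ?P D)" and e: "e > 0"
    then obtain K m where q: "q = scalar.smooth_sn K m norm" and K: "K \<noteq> {}" and cD: "c \<in> D"
      unfolding scalar.seminorms_smooth_periodic by auto
    \<comment> \<open>Two members of the box differ by at most 2 b n in the coordinate n.\<close>
    define g where "g n = 2 * (b n * bracket n ^ m)" for n
    have "scalar.rapid (\<lambda>n. complex_of_real (b n))"
      by (rule rapid) (simp add: D_def b)
    from scalar.rapid_summable[OF this norm_scalar_sn, of m]
    have "(\<lambda>n. b n * bracket n ^ m) summable_on UNIV" by (simp add: b)
    then have g: "g summable_on UNIV" unfolding g_def[abs_def] by (rule summable_on_cmult_right)
    have g0: "0 \<le> g n" for n by (simp add: g_def b)
    have "\<forall>\<^sub>F N in finite_subsets_at_top UNIV. tail_sum g N < e / 2"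
      by (rule order_tendstoD(2)[OF tail_sum_tendsto[OF g]]) (use e in simp)
    then obtain N where N: "finite N" "tail_sum g N < e / 2"
      unfolding eventually_finite_subsets_at_top by auto
    \<comment> \<open>The difference of two syntheses is split: h involves the finitely many
      coordinates in N and is continuous for the product topology, and the tail stays below e/2 for
      all members of the box.\<close>
    define h where "h c' = (\<Sum>n\<in>N. norm (c' n - c n) * bracket n ^ m)" for c' :: "int^'d::{finite,linorder} \<Rightarrow> complex"
    define U where "U = {c' \<in> topspace (subtopology ?P D). h c' \<in> {..<e / 2}}"
    have "continuous_map ?P euclidean (\<lambda>c'. norm (c' n - c n) * bracket n ^ m)" for n
    proof -
      have "continuous_map ?P euclidean (\<lambda>c'. c' n)"
        by (rule continuous_map_product_projection) simp
      moreover have "continuous_map euclidean euclidean (\<lambda>z. norm (z - c n) * bracket n ^ m)"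
        by (simp, intro continuous_intros)
      ultimately show ?thesis
        using continuous_map_compose[of ?P euclidean "\<lambda>c'. c' n" euclidean "\<lambda>z. norm (z - c n) * bracket n ^ m"]
        by (simp add: o_def)
    qed
    then have "continuous_map ?P euclidean h"
      unfolding h_def[abs_def] using N(1) by (intro continuous_map_sum) auto
    then have "openin (subtopology ?P D) U"
      unfolding U_def
      by (intro openin_continuous_map_preimage[of _ euclidean]) (auto intro: continuous_map_from_subtopology)
    moreover have "c \<in> U" using cD e by (simp add: U_def h_def)
    moreover have "q (scalar.synth c' - scalar.synth c) < e" if "c' \<in> U" for c'
    proof -
      have c': "c' \<in> D" "h c' < e / 2" using that by (auto simp: U_def)
      let ?d = "c' + (- 1) *\<^sub>C c"
      have r: "scalar.rapid ((- 1) *\<^sub>C c)" by (intro scalar.rapid_scale rapid cD)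
      have d: "scalar.rapid ?d" by (intro scalar.rapid_plus r rapid c')
      have dn: "?d n = c' n - c n" for n by (simp add: scaleC_fun_def scaleC_complex_def)
      have dle: "norm (?d n) * bracket n ^ m \<le> g n" for n
      proof -
        have "norm (c' n - c n) \<le> 2 * b n"
          using norm_triangle_ineq4[of "c' n" "c n"] c'(1) cD unfolding D_def by (smt (verit) mem_Collect_eq)
        then show ?thesis unfolding dn g_def
          using mult_right_mono[of "norm (c' n - c n)" "2 * b n" "bracket n ^ m"] by (simp add: mult.assoc)
      qed
      have "scalar.synth c' - scalar.synth c = scalar.synth ?d"
        unfolding scalar.synth_plus[OF rapid[OF c'(1)] r] scalar.synth_scaleC[OF rapid[OF cD]] by simp
      then have "q (scalar.synth c' - scalar.synth c) \<le> infsum (\<lambda>n. norm (?d n) * bracket n ^ m) UNIV"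
        unfolding q using scalar.smooth_sn_synth[OF d norm_scalar_sn K, of m] by simp
      also have "\<dots> \<le> h c' + tail_sum g N"
      proof (rule infsum_le_finite_sums)
        show "(\<lambda>n. norm (?d n) * bracket n ^ m) summable_on UNIV"
          by (rule scalar.rapid_summable[OF d norm_scalar_sn])
        fix M :: "(int^'d::{finite,linorder}) set" assume M: "finite M"
        have "(\<Sum>n\<in>M. norm (?d n) * bracket n ^ m)
            \<le> (\<Sum>n\<in>N \<union> (M - N). norm (?d n) * bracket n ^ m)"
          using M N(1) by (intro sum_mono2) auto
        also have "\<dots> = (\<Sum>n\<in>N. norm (?d n) * bracket n ^ m) + (\<Sum>n\<in>M - N. norm (?d n) * bracket n ^ m)"
          using M N(1) by (intro sum.union_disjoint) auto
        also have "(\<Sum>n\<in>N. norm (?d n) * bracket n ^ m) = h c'"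
          unfolding h_def dn ..
        also have "(\<Sum>n\<in>M - N. norm (?d n) * bracket n ^ m) \<le> (\<Sum>n\<in>M - N. g n)"
          by (intro sum_mono dle)
        also have "\<dots> \<le> tail_sum g N"
          using M N(1) g g0 by (intro tail_sum_bound) auto
        finally show "(\<Sum>n\<in>M. norm (?d n) * bracket n ^ m) \<le> h c' + tail_sum g N" by simp
      qed
      finally show ?thesis using c'(2) N(2) by simp
    qed
    ultimately show "\<exists>U. openin (subtopology ?P D) U \<and> c \<in> U \<and>
        (\<forall>c'\<in>U. q (scalar.synth c' - scalar.synth c) < e)" by blast
  qed
  from image_compactin[OF cD this] show "compactin (lc_topology test_space) (scalar.synth ` D)" .
qed

section \<open>Preimages under S and the factorisation\<close>

context lc_complete
begin

text \<open>The preimage of \<open>f\<close> is the operator that sends \<open>\<phi>\<close> to the sum of the \<open>\<phi> (torus_char n) *\<^sub>C fourier_coeff X f n\<close>.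
  It is continuous on \<open>F'\<^sub>\<kappa>\<close> because suitable multiples of the characters lie in a compact disc.\<close>

lemma S_map_surjective:
  fixes f :: "real^'d::{finite,linorder} \<Rightarrow> 'a"
  assumes f: "f \<in> points (smooth_periodic X)"
  shows "f \<in> S_map test_space ` points (eps_product test_space X)"
proof -
  let ?a = "fourier_coeff X f"
  let ?T = "test_space :: (real^'d::{finite,linorder} \<Rightarrow> complex) lcs"
  have a: "rapid ?a" by (rule rapid_fourier_coeff[OF f])
  define u where "u \<phi> = (if \<phi> \<in> dual ?T then series_limit (\<lambda>n. \<phi> (torus_char n) *\<^sub>C ?a n) else 0)" for \<phi>
  have r: "rapid (\<lambda>n. \<phi> (torus_char n) *\<^sub>C ?a n)" if \<phi>: "\<phi> \<in> dual ?T" for \<phi>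
  proof -
    obtain B k where "\<And>n. norm (\<phi> (torus_char n)) \<le> B * bracket n ^ k"
      using dual_torus_char_bound[OF \<phi>] by blast
    then show ?thesis by (rule rapid_multiplier[OF a])
  qed
  have "continuous_linear (dual_kappa ?T) X u"
  proof (rule continuous_linearI[OF test.lc_space_dual_kappa lc_space_axioms]; (unfold test.points_dual_kappa)?)
    fix \<phi> assume \<phi>: "\<phi> \<in> dual ?T"
    show "u \<phi> \<in> points X" using \<phi> series_limit_mem[OF r[OF \<phi>]] by (simp add: u_def)
    show "u (c *\<^sub>C \<phi>) = c *\<^sub>C u \<phi>" for c
      using test.dual_scale_mem[OF \<phi>, of c] \<phi> series_limit_scale[OF r[OF \<phi>], of c]
      by (simp add: u_def scaleC_fun_def scaleC_complex_def scaleC_scaleC)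
    show "u (\<phi> + \<psi>) = u \<phi> + u \<psi>" if \<psi>: "\<psi> \<in> dual ?T" for \<psi>
      using test.dual_add_mem[OF \<phi> \<psi>] \<phi> \<psi> series_limit_add[OF r[OF \<phi>] r[OF \<psi>]]
      by (simp add: u_def scaleC_add_left)
  next
    fix p assume p: "p \<in> seminorms X"
    \<comment> \<open>The bracket power is chosen so that b_n |\<phi>(e_n)| \<le> s, with s the
      supremum of |\<phi>| on the disc, bounds p(\<phi>(e_n) f^(n)) by s over the d-th power of the
      bracket, which is summable.\<close>
    define b where "b n = p (?a n) * bracket n ^ CARD('d)" for n
    have b0: "0 \<le> b n" for n
      using sn_nonneg[OF p rapid_mem[OF a]] by (simp add: b_def)
    have bC: "\<exists>C. \<forall>n. b n * bracket n ^ m \<le> C" for m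
    proof -
      obtain C where "\<And>n. p (?a n) * bracket n ^ (CARD('d) + m) \<le> C"
        using a p unfolding rapid_def by blast
      then show ?thesis by (intro exI[of _ C]) (simp add: b_def power_add mult.assoc)
    qed
    define D where "D = {c :: int^'d::{finite,linorder} \<Rightarrow> complex. \<forall>n. norm (c n) \<le> b n}"
    let ?K = "scalar.synth ` D :: (real^'d::{finite,linorder} \<Rightarrow> complex) set"
    have K: "absolutely_convex ?K" "compactin (lc_topology ?T) ?K"
      unfolding D_def by (rule synth_box_compact[OF b0 bC])+
    have le: "p (u \<phi>) \<le> bracket_sum TYPE('d) * test.compact_sn ?K \<phi>" if \<phi>: "\<phi> \<in> dual ?T" for \<phi>
    proof -
      let ?s = "test.compact_sn ?K \<phi>"
      have "p (u \<phi>) \<le> infsum (\<lambda>n. p (\<phi> (torus_char n) *\<^sub>C ?a n)) UNIV"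
        using \<phi> sn_series_limit[OF r[OF \<phi>] p] by (simp add: u_def)
      also have "\<dots> \<le> infsum (\<lambda>n :: int^'d::{finite,linorder}. ?s * (1 / bracket n ^ CARD('d))) UNIV"
      proof (rule infsum_mono)
        show "(\<lambda>n. p (\<phi> (torus_char n) *\<^sub>C ?a n)) summable_on UNIV" by (rule rapid_summable0[OF r[OF \<phi>] p])
        show "(\<lambda>n :: int^'d::{finite,linorder}. ?s * (1 / bracket n ^ CARD('d))) summable_on UNIV"
          by (intro summable_on_cmult_right summable_bracket)
        fix n :: "int^'d::{finite,linorder}"
        \<comment> \<open>The family with b n at n and 0 elsewhere lies in the box, and its
          synthesis is b_n e_n.\<close>
        have "(\<lambda>m. if m \<in> {n} then complex_of_real (b n) else 0) \<in> D"
          using b0 by (simp add: D_def)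
        from imageI[OF this, of scalar.synth]
        have "complex_of_real (b n) *\<^sub>C torus_char n \<in> ?K"
          unfolding synth_delta .
        from test.compact_sn_upper[OF \<phi> K(2) this]
        have "b n * norm (\<phi> (torus_char n)) \<le> ?s"
          by (simp add: test.dual_scale[OF \<phi> torus_char_smooth] norm_mult b0)
        then show "p (\<phi> (torus_char n) *\<^sub>C ?a n) \<le> ?s * (1 / bracket n ^ CARD('d))"
          using bracket_pos[of n] by (simp add: b_def sn_scale[OF p rapid_mem[OF a]] field_simps)
      qed
      also have "\<dots> = ?s * bracket_sum TYPE('d)"
        unfolding bracket_sum_def by (rule infsum_cmult_right')
      finally show ?thesis by (simp add: mult.commute)
    qed
    have "test.compact_sn ?K \<in> seminorms (dual_kappa ?T)"
      unfolding test.seminorms_dual_kappa using K by blast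
    then show "\<exists>q\<in>seminorms (dual_kappa ?T). \<exists>C. \<forall>\<phi>\<in>dual ?T. p (u \<phi>) \<le> C * q \<phi>"
      using le by blast
  qed
  then have "u \<in> points (eps_product ?T X)"
    by (simp add: eps_product_def operators_def test.points_dual_kappa u_def)
  moreover have "S_map ?T u = f"
  proof
    fix x
    \<comment> \<open>At a point evaluation the series defining u turns into the synthesis of the
      coefficients of f.\<close>
    have "point_eval ?T x (torus_char n) = torus_char n x" for n
      by (simp add: point_eval_def torus_char_smooth)
    then have "u (point_eval ?T x) = series_limit (\<lambda>n. torus_char n x *\<^sub>C ?a n)"
      by (simp add: u_def point_eval_dual)
    also have "\<dots> = f x"
      using synth_fourier_coeff[OF f] by (simp add: synth_def[symmetric])
    finally show "S_map ?T u x = f x" by (simp add: S_map_def)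
  qed
  ultimately show ?thesis by blast
qed

lemma eps_coeff_functional:
  fixes u :: "((real^'d::{finite,linorder} \<Rightarrow> complex) \<Rightarrow> complex) \<Rightarrow> 'a"
  assumes u: "u \<in> points (eps_product test_space X)" and f: "S_map test_space u \<in> points (smooth_periodic X)"
  shows "u (coeff_functional n) = fourier_coeff X (S_map test_space u) n"
proof -
  let ?T = "test_space :: (real^'d::{finite,linorder} \<Rightarrow> complex) lcs"
  have cl: "continuous_linear (dual_kappa ?T) X u"
    using u by (simp add: eps_product_def operators_def)
  interpret D: lc_space "dual_kappa ?T" by (rule test.lc_space_dual_kappa)
  have ev: "point_eval ?T v \<in> points (dual_kappa ?T)" for v
    by (simp add: test.points_dual_kappa point_eval_dual)
  have scale: "u (c *\<^sub>C \<phi>) = c *\<^sub>C u \<phi>" if "\<phi> \<in> points (dual_kappa ?T)" for c \<phi>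
    using cl that unfolding continuous_linear_def by blast
  have "u (riemann_functional k n) = riemann k n (S_map ?T u)" for k
    unfolding riemann_functional_def riemann_def
    by (subst continuous_linear_sum[OF D.lc_space_axioms cl])
      (auto simp: ev D.scale_mem scale S_map_def)
  then have "limitin (lc_topology X) (\<lambda>k. riemann k n (S_map ?T u)) (u (coeff_functional n)) sequentially"
    using limitin_continuous_linear[OF cl riemann_functional_limit[of n]] by simp
  then show ?thesis
    using lc_limit_unique[OF _ fourier_coeff_riemann[OF f]] by simp
qed

theorem fourier_coeff_eps:
  fixes f :: "real^'d::{finite,linorder} \<Rightarrow> 'a"
  assumes f: "f \<in> points (smooth_periodic X)"
  shows "fourier_coeff X f =
    (S_map (rapidly_decreasing scalar_lcs)
     \<circ> eps_id test_space (rapidly_decreasing scalar_lcs) (fourier_coeff scalar_lcs)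
     \<circ> inv_into (points (eps_product test_space X)) (S_map test_space)) f"
proof
  fix n
  define u where "u = inv_into (points (eps_product test_space X)) (S_map test_space) f"
  have u: "u \<in> points (eps_product test_space X)" and Su: "S_map test_space u = f"
    unfolding u_def using S_map_surjective[OF f] by (rule inv_into_into, rule f_inv_into_f)
  have "fourier_coeff X f n = u (coeff_functional n)"
    using eps_coeff_functional[OF u, of n] f by (simp add: Su)
  \<comment> \<open>Evaluation at n lies in the dual of the sequence space, so \<open>eps_id\<close>
    takes its first branch, and the transpose of that evaluation is
    \<open>coeff_functional n\<close>.\<close>
  then show "fourier_coeff X f n =
    (S_map (rapidly_decreasing scalar_lcs)
     \<circ> eps_id test_space (rapidly_decreasing scalar_lcs) (fourier_coeff scalar_lcs)
     \<circ> inv_into (points (eps_product test_space X)) (S_map test_space)) f n"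
    by (simp add: S_map_def eps_id_def point_eval_rapid_dual transpose_point_eval flip: u_def)
qed

end

theorem theorem5p6p14:
  fixes E :: "'e::complex_vector lcs"
  assumes "lcHs E" and "locally_complete E"
  shows
    "schauder_decomposition
       (smooth_periodic E :: (real^'d::{finite,linorder} \<Rightarrow> 'e) lcs)
       (\<lambda>k f. \<Sum>n | norm (real_vec n) \<le> real k. fourier_term E n f)
     \<and>
     (\<forall>f \<in> points (smooth_periodic E :: (real^'d::{finite,linorder} \<Rightarrow> 'e) lcs).
        limitin (lc_topology (smooth_periodic E))
          (\<lambda>N. \<Sum>n\<in>N. fourier_term E n f) f (finite_subsets_at_top UNIV))
     \<and>
     isomorphism
       (smooth_periodic E :: (real^'d::{finite,linorder} \<Rightarrow> 'e) lcs)
       (rapidly_decreasing E :: (int^'d::{finite,linorder} \<Rightarrow> 'e) lcs)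
       (fourier_coeff E)
     \<and>
     (\<forall>f \<in> points (smooth_periodic E :: (real^'d::{finite,linorder} \<Rightarrow> 'e) lcs).
        fourier_coeff E f =
          (S_map (rapidly_decreasing scalar_lcs)
           \<circ> eps_id (smooth_periodic scalar_lcs) (rapidly_decreasing scalar_lcs)
               (fourier_coeff scalar_lcs)
           \<circ> inv_into (points (eps_product (smooth_periodic scalar_lcs) E))
               (S_map (smooth_periodic scalar_lcs))) f)"
proof -
  interpret lc_complete E
    by (rule locally_complete_imp_lc_complete[OF assms])
  have "points E \<noteq> {0}" "0 \<in> points E"
    using assms(1) by (simp_all add: lcHs_def)
  \<comment> \<open>This nonzero vector serves to distinguish the projections of the
    decomposition.\<close>
  then obtain c where "c \<in> points E" "c \<noteq> 0" by blast
  then show ?thesis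
    by (intro conjI ballI schauder_decomposition_fourier fourier_series_converges
        isomorphism_fourier_coeff fourier_coeff_eps)
qed

end
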